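(* Let $(M,\Sigma,g_c)$ be a sub-Riemannian manifold, with $\Sigma$ of rank $k$, and let $y\in M$. Then there exist a neighborhood $\mathcal O$ of $y$ and a horizontal frame $\{E_1,\dots,E_k\}$ on $\mathcal O$ (smooth sections of $\Sigma$ over $\mathcal O$ forming a basis of $\Sigma$ at each point of $\mathcal O$) with $\|E_i\|^2:=g_c(E_i,E_i)=1$ such that, for each $i=1,\dots,k$, any integral curve of $E_i$ is a nonholonomic geodesic in $\mathcal O$.
   Context: A sub-Riemannian manifold $(M,\Sigma,g_c)$ is a smooth manifold $M$ of dimension $m$ with a smooth (non-integrable) distribution $\Sigma\subset TM$ of rank $k<m$ and a smooth inner product $g_c$ on $\Sigma$. Throughout, $g_c=g|_\Sigma$ for a fixed Riemannian metric $g$ on $M$, $TM=\Sigma\oplus\Sigma^\perp$ is the $g$-orthogonal decomposition, $\mathcal P$ is the projection onto $\Sigma$, and $\nabla$ is the Levi-Civita connection of $g$. The horizontal connection is $D_XY:=\mathcal P(\nabla_XY)$ for $X,Y\in\Gamma(\Sigma)$ (smooth sections of $\Sigma$); it induces differentiation of horizontal vector fields along horizontal curves (curves with $\dot\gamma\in\Sigma_\gamma$). A nonholonomic geodesic is a smooth horizontal curve with $D_{\dot\gamma}\dot\gamma=\mathcal P(\nabla_{\dot\gamma}\dot\gamma)=0$. *)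

theory Defs
  imports "HOL-Analysis.Analysis" "HOL-Library.Function_Algebras"
begin

text \<open>
  Tangent vectors are derivations, hence elements of a function space; the pointwise real vector
  space structure makes \<^const>\<open>span\<close>, \<^const>\<open>independent\<close>, \<^const>\<open>dim\<close> available for them.
\<close>

instantiation "fun" :: (type, real_vector) real_vector
begin

definition scaleR_fun :: "real \<Rightarrow> ('a \<Rightarrow> 'b) \<Rightarrow> 'a \<Rightarrow> 'b"
  where "scaleR_fun r f = (\<lambda>x. r *\<^sub>R f x)"

instance
  by standard (simp_all add: scaleR_fun_def plus_fun_def scaleR_add_right scaleR_add_left)

end


section \<open>Smooth maps between open subsets of normed spaces\<close>

text \<open>
  Only meant for open \<open>S\<close>. Over a finite-dimensional domain, continuity of all directional
  derivatives is continuity of the derivative.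
\<close>

primrec Ck_on :: "nat \<Rightarrow> 'e::real_normed_vector set \<Rightarrow> ('e \<Rightarrow> 'f::real_normed_vector) \<Rightarrow> bool"
  where
    "Ck_on 0 = (\<lambda>S f. continuous_on S f)"
  | "Ck_on (Suc n) = (\<lambda>S f. (\<forall>x\<in>S. f differentiable (at x)) \<and>
        (\<forall>v. Ck_on n S (\<lambda>x. frechet_derivative f (at x) v)))"

definition smooth_on :: "'e::real_normed_vector set \<Rightarrow> ('e \<Rightarrow> 'f::real_normed_vector) \<Rightarrow> bool"
  where "smooth_on S f \<longleftrightarrow> (\<forall>n. Ck_on n S f)"


section \<open>Smooth manifolds\<close>

text \<open>
  A chart is a pair of its domain and its coordinate map. The model space \<open>'e\<close> is an arbitrary
  Euclidean space, so the dimension of the manifold is \<open>DIM('e)\<close>.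
\<close>

type_synonym ('a, 'e) chart = "'a set \<times> ('a \<Rightarrow> 'e)"

record ('a, 'e) mfd =
  mtop :: "'a topology"
  atlas :: "('a, 'e) chart set"

abbreviation carrier :: "('a, 'e) mfd \<Rightarrow> 'a set"
  where "carrier M \<equiv> topspace (mtop M)"

definition chart_inv :: "('a, 'e) chart \<Rightarrow> 'e \<Rightarrow> 'a"
  where "chart_inv c = inv_into (fst c) (snd c)"

definition is_chart :: "('a, 'e::euclidean_space) mfd \<Rightarrow> ('a, 'e) chart \<Rightarrow> bool"
  where "is_chart M c \<longleftrightarrow> openin (mtop M) (fst c) \<and> open (snd c ` fst c) \<and>
    homeomorphic_map (subtopology (mtop M) (fst c)) (top_of_set (snd c ` fst c)) (snd c)"

definition smooth_transition :: "('a, 'e::euclidean_space) chart \<Rightarrow> ('a, 'e) chart \<Rightarrow> bool"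
  where "smooth_transition c d \<longleftrightarrow> smooth_on (snd c ` (fst c \<inter> fst d)) (snd d \<circ> chart_inv c)"

definition smooth_manifold :: "('a, 'e::euclidean_space) mfd \<Rightarrow> bool"
  where "smooth_manifold M \<longleftrightarrow>
    Hausdorff_space (mtop M) \<and> second_countable (mtop M) \<and>
    (\<forall>c\<in>atlas M. is_chart M c) \<and> (\<Union>c\<in>atlas M. fst c) = carrier M \<and>
    (\<forall>c\<in>atlas M. \<forall>d\<in>atlas M. smooth_transition c d)"

text \<open>Membership of a chart in the maximal atlas.\<close>

definition smooth_chart :: "('a, 'e::euclidean_space) mfd \<Rightarrow> ('a, 'e) chart \<Rightarrow> bool"
  where "smooth_chart M c \<longleftrightarrow> is_chart M c \<and>
    (\<forall>d\<in>atlas M. smooth_transition c d \<and> smooth_transition d c)"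

definition smooth_fun :: "('a, 'e::euclidean_space) mfd \<Rightarrow> 'a set \<Rightarrow> ('a \<Rightarrow> real) \<Rightarrow> bool"
  where "smooth_fun M W f \<longleftrightarrow>
    (\<forall>c\<in>atlas M. smooth_on (snd c ` (fst c \<inter> W)) (f \<circ> chart_inv c))"

definition smooth_near :: "('a, 'e::euclidean_space) mfd \<Rightarrow> 'a \<Rightarrow> ('a \<Rightarrow> real) \<Rightarrow> bool"
  where "smooth_near M p f \<longleftrightarrow> (\<exists>W. openin (mtop M) W \<and> p \<in> W \<and> smooth_fun M W f)"


section \<open>Tangent vectors and vector fields\<close>

text \<open>
  The tangent space at \<open>p\<close> is the space of derivations on germs at \<open>p\<close> of smooth functions. A germ
  is represented by any total function that is smooth near \<open>p\<close>; derivations are normalised to be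
  0 on all other functions, so that a tangent vector is determined by its action on germs.
\<close>

type_synonym 'a tangent = "('a \<Rightarrow> real) \<Rightarrow> real"

definition tangent_space :: "('a, 'e::euclidean_space) mfd \<Rightarrow> 'a \<Rightarrow> 'a tangent set"
  where "tangent_space M p = {v.
    (\<forall>f h. smooth_near M p f \<and> smooth_near M p h \<longrightarrow>
        v (\<lambda>q. f q + h q) = v f + v h \<and>
        v (\<lambda>q. f q * h q) = f p * v h + h p * v f) \<and>
    (\<forall>r f. smooth_near M p f \<longrightarrow> v (\<lambda>q. r * f q) = r * v f) \<and>
    (\<forall>f h W. smooth_near M p f \<and> openin (mtop M) W \<and> p \<in> W \<and> (\<forall>q\<in>W. f q = h q) \<longrightarrow> v f = v h) \<and>
    (\<forall>f. \<not> smooth_near M p f \<longrightarrow> v f = 0)}"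

text \<open>
  Fields are total functions, but only their values on the open set \<open>W\<close> under consideration matter.
\<close>

type_synonym 'a field = "'a \<Rightarrow> 'a tangent"

definition smooth_field :: "('a, 'e::euclidean_space) mfd \<Rightarrow> 'a set \<Rightarrow> 'a field \<Rightarrow> bool"
  where "smooth_field M W X \<longleftrightarrow> (\<forall>p\<in>W. X p \<in> tangent_space M p) \<and>
    (\<forall>W' f. openin (mtop M) W' \<and> W' \<subseteq> W \<and> smooth_fun M W' f \<longrightarrow> smooth_fun M W' (\<lambda>p. X p f))"

definition lie_bracket :: "('a, 'e::euclidean_space) mfd \<Rightarrow> 'a field \<Rightarrow> 'a field \<Rightarrow> 'a field"
  where "lie_bracket M X Y p =
    (\<lambda>f. if smooth_near M p f then X p (\<lambda>q. Y q f) - Y p (\<lambda>q. X q f) else 0)"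

definition coord :: "('a, 'e::euclidean_space) chart \<Rightarrow> 'e \<Rightarrow> 'a \<Rightarrow> real"
  where "coord c b p = snd c p \<bullet> b"

definition coord_field ::
  "('a, 'e::euclidean_space) mfd \<Rightarrow> ('a, 'e) chart \<Rightarrow> 'e \<Rightarrow> 'a field"
  where "coord_field M c b p =
    (\<lambda>f. if smooth_near M p f then frechet_derivative (f \<circ> chart_inv c) (at (snd c p)) b else 0)"

text \<open>The differential of the coordinate map of a chart.\<close>

definition chart_diff :: "('a, 'e::euclidean_space) chart \<Rightarrow> 'a tangent \<Rightarrow> 'e"
  where "chart_diff c v = (\<Sum>b\<in>Basis. v (coord c b) *\<^sub>R b)"


section \<open>Riemannian metrics and the Levi-Civita connection\<close>

definition inner_product_on :: "'v::real_vector set \<Rightarrow> ('v \<Rightarrow> 'v \<Rightarrow> real) \<Rightarrow> bool"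
  where "inner_product_on V ip \<longleftrightarrow>
    (\<forall>u\<in>V. \<forall>v\<in>V. \<forall>w\<in>V. ip (u + v) w = ip u w + ip v w) \<and>
    (\<forall>r. \<forall>u\<in>V. \<forall>w\<in>V. ip (r *\<^sub>R u) w = r * ip u w) \<and>
    (\<forall>u\<in>V. \<forall>w\<in>V. ip u w = ip w u) \<and>
    (\<forall>u\<in>V. u \<noteq> 0 \<longrightarrow> ip u u > 0)"

type_synonym 'a metric_tensor = "'a \<Rightarrow> 'a tangent \<Rightarrow> 'a tangent \<Rightarrow> real"

definition riemannian_metric :: "('a, 'e::euclidean_space) mfd \<Rightarrow> 'a metric_tensor \<Rightarrow> bool"
  where "riemannian_metric M g \<longleftrightarrow>
    (\<forall>p\<in>carrier M. inner_product_on (tangent_space M p) (g p)) \<and>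
    (\<forall>W X Y. openin (mtop M) W \<and> smooth_field M W X \<and> smooth_field M W Y \<longrightarrow>
        smooth_fun M W (\<lambda>p. g p (X p) (Y p)))"

text \<open>
  A linear connection on the tangent bundle, acting on fields over arbitrary open sets compatibly
  with restriction (second clause), so that \<open>\<nabla>\<close> can be applied to coordinate fields.
\<close>

definition connection ::
  "('a, 'e::euclidean_space) mfd \<Rightarrow> ('a field \<Rightarrow> 'a field \<Rightarrow> 'a field) \<Rightarrow> bool"
  where "connection M nabla \<longleftrightarrow> (\<forall>W. openin (mtop M) W \<longrightarrow>
    (\<forall>X Y. smooth_field M W X \<and> smooth_field M W Y \<longrightarrow> smooth_field M W (nabla X Y)) \<and>
    (\<forall>X X' Y Y'. smooth_field M W X \<and> smooth_field M W X' \<and>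
        smooth_field M W Y \<and> smooth_field M W Y' \<and> (\<forall>p\<in>W. X p = X' p \<and> Y p = Y' p) \<longrightarrow>
        (\<forall>p\<in>W. nabla X Y p = nabla X' Y' p)) \<and>
    (\<forall>X X' Y. smooth_field M W X \<and> smooth_field M W X' \<and> smooth_field M W Y \<longrightarrow>
        (\<forall>p\<in>W. nabla (\<lambda>q. X q + X' q) Y p = nabla X Y p + nabla X' Y p)) \<and>
    (\<forall>f X Y. smooth_fun M W f \<and> smooth_field M W X \<and> smooth_field M W Y \<longrightarrow>
        (\<forall>p\<in>W. nabla (\<lambda>q. f q *\<^sub>R X q) Y p = f p *\<^sub>R nabla X Y p)) \<and>
    (\<forall>X Y Y'. smooth_field M W X \<and> smooth_field M W Y \<and> smooth_field M W Y' \<longrightarrow>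
        (\<forall>p\<in>W. nabla X (\<lambda>q. Y q + Y' q) p = nabla X Y p + nabla X Y' p)) \<and>
    (\<forall>f X Y. smooth_fun M W f \<and> smooth_field M W X \<and> smooth_field M W Y \<longrightarrow>
        (\<forall>p\<in>W. nabla X (\<lambda>q. f q *\<^sub>R Y q) p = X p f *\<^sub>R Y p + f p *\<^sub>R nabla X Y p)))"

definition levi_civita :: "('a, 'e::euclidean_space) mfd \<Rightarrow> 'a metric_tensor \<Rightarrow>
    ('a field \<Rightarrow> 'a field \<Rightarrow> 'a field) \<Rightarrow> bool"
  where "levi_civita M g nabla \<longleftrightarrow> connection M nabla \<and> (\<forall>W. openin (mtop M) W \<longrightarrow>
    (\<forall>X Y. smooth_field M W X \<and> smooth_field M W Y \<longrightarrow>
        (\<forall>p\<in>W. nabla X Y p - nabla Y X p = lie_bracket M X Y p)) \<and>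
    (\<forall>X Y Z. smooth_field M W X \<and> smooth_field M W Y \<and> smooth_field M W Z \<longrightarrow>
        (\<forall>p\<in>W. X p (\<lambda>q. g q (Y q) (Z q)) =
            g p (nabla X Y p) (Z p) + g p (Y p) (nabla X Z p))))"


section \<open>Sub-Riemannian manifolds\<close>

type_synonym 'a distribution = "'a \<Rightarrow> 'a tangent set"

text \<open>
  Smooth sections \<open>E 1, \<dots>, E k\<close> of \<open>\<Sigma>\<close> over \<open>W\<close> forming a basis of \<open>\<Sigma>\<close> at each point of \<open>W\<close>.
\<close>

definition horizontal_frame :: "('a, 'e::euclidean_space) mfd \<Rightarrow> 'a distribution \<Rightarrow> nat \<Rightarrow>
    'a set \<Rightarrow> (nat \<Rightarrow> 'a field) \<Rightarrow> bool"
  where "horizontal_frame M \<Sigma> k W E \<longleftrightarrow>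
    (\<forall>i\<in>{1..k}. smooth_field M W (E i) \<and> (\<forall>p\<in>W. E i p \<in> \<Sigma> p)) \<and>
    (\<forall>p\<in>W. inj_on (\<lambda>i. E i p) {1..k} \<and> independent ((\<lambda>i. E i p) ` {1..k}) \<and>
        span ((\<lambda>i. E i p) ` {1..k}) = \<Sigma> p)"

definition smooth_distribution ::
  "('a, 'e::euclidean_space) mfd \<Rightarrow> nat \<Rightarrow> 'a distribution \<Rightarrow> bool"
  where "smooth_distribution M k \<Sigma> \<longleftrightarrow>
    (\<forall>p\<in>carrier M. subspace (\<Sigma> p) \<and> \<Sigma> p \<subseteq> tangent_space M p \<and> dim (\<Sigma> p) = k \<and>
      (\<exists>W E. openin (mtop M) W \<and> p \<in> W \<and> horizontal_frame M \<Sigma> k W E))"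

text \<open>
  Integrability: through each point \<open>p\<close> passes an integral manifold of \<open>\<Sigma>\<close>, described locally as
  the slice through \<open>p\<close> of a chart, i.e. as the part of the chart domain that the chart maps into
  the affine subspace parallel to \<open>S\<close>.
\<close>

definition integrable_distribution ::
  "('a, 'e::euclidean_space) mfd \<Rightarrow> nat \<Rightarrow> 'a distribution \<Rightarrow> bool"
  where "integrable_distribution M k \<Sigma> \<longleftrightarrow>
    (\<forall>p\<in>carrier M. \<exists>c S. smooth_chart M c \<and> p \<in> fst c \<and> subspace S \<and> dim S = k \<and>
      (\<forall>q\<in>fst c. snd c q - snd c p \<in> S \<longrightarrow> chart_diff c ` \<Sigma> q = S))"

definition sub_riemannian_manifold ::
  "('a, 'e::euclidean_space) mfd \<Rightarrow> nat \<Rightarrow> 'a distribution \<Rightarrow> 'a metric_tensor \<Rightarrow> bool"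
  where "sub_riemannian_manifold M k \<Sigma> gc \<longleftrightarrow>
    smooth_manifold M \<and> k < DIM('e) \<and>
    smooth_distribution M k \<Sigma> \<and> \<not> integrable_distribution M k \<Sigma> \<and>
    (\<forall>p\<in>carrier M. inner_product_on (\<Sigma> p) (gc p)) \<and>
    (\<forall>W X Y. openin (mtop M) W \<and> smooth_field M W X \<and> smooth_field M W Y \<and>
        (\<forall>p\<in>W. X p \<in> \<Sigma> p \<and> Y p \<in> \<Sigma> p) \<longrightarrow> smooth_fun M W (\<lambda>p. gc p (X p) (Y p)))"

definition horizontal_proj ::
  "'a metric_tensor \<Rightarrow> 'a distribution \<Rightarrow> 'a \<Rightarrow> 'a tangent \<Rightarrow> 'a tangent"
  where "horizontal_proj g \<Sigma> p v = (THE w. w \<in> \<Sigma> p \<and> (\<forall>u\<in>\<Sigma> p. g p (v - w) u = 0))"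


section \<open>Curves\<close>

text \<open>Curves are considered on open intervals \<open>I\<close> only.\<close>

definition smooth_curve ::
  "('a, 'e::euclidean_space) mfd \<Rightarrow> real set \<Rightarrow> (real \<Rightarrow> 'a) \<Rightarrow> bool"
  where "smooth_curve M I \<gamma> \<longleftrightarrow> continuous_map (top_of_set I) (mtop M) \<gamma> \<and>
    (\<forall>c\<in>atlas M. smooth_on {t\<in>I. \<gamma> t \<in> fst c} (snd c \<circ> \<gamma>))"

definition velocity ::
  "('a, 'e::euclidean_space) mfd \<Rightarrow> (real \<Rightarrow> 'a) \<Rightarrow> real \<Rightarrow> 'a tangent"
  where "velocity M \<gamma> t = (\<lambda>f. if smooth_near M (\<gamma> t) f then deriv (f \<circ> \<gamma>) t else 0)"

text \<open>
  Integral curves in \<open>W\<close> of a vector field on \<open>W\<close>; they are only required to be continuous and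
  differentiable, with velocity \<open>X\<close>.
\<close>

definition integral_curve :: "('a, 'e::euclidean_space) mfd \<Rightarrow> 'a set \<Rightarrow> 'a field \<Rightarrow>
    real set \<Rightarrow> (real \<Rightarrow> 'a) \<Rightarrow> bool"
  where "integral_curve M W X I \<gamma> \<longleftrightarrow> open I \<and> is_interval I \<and> \<gamma> ` I \<subseteq> W \<and>
    continuous_map (top_of_set I) (mtop M) \<gamma> \<and>
    (\<forall>t\<in>I. \<forall>f. smooth_near M (\<gamma> t) f \<longrightarrow> ((f \<circ> \<gamma>) has_real_derivative X (\<gamma> t) f) (at t))"

text \<open>
  The covariant derivative at time \<open>t\<close> of a vector field \<open>V\<close> along \<open>\<gamma>\<close>, computed in a chart
  around \<open>\<gamma> t\<close>. In terms of the coordinate fields \<open>\<partial>\<^sub>b\<close>, write \<open>V = (\<Sum>b. V\<^sub>b \<partial>\<^sub>b)\<close> and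
  \<open>\<gamma>' = (\<Sum>a. \<gamma>'\<^sub>a \<partial>\<^sub>a)\<close> along \<open>\<gamma>\<close>; then \<open>\<nabla>\<close> induces
  \<open>(\<Sum>b. V\<^sub>b' \<partial>\<^sub>b + V\<^sub>b (\<Sum>a. \<gamma>'\<^sub>a \<nabla> \<partial>\<^sub>a \<partial>\<^sub>b))\<close>. The components of a tangent vector are
  its values at the coordinate functions.
\<close>

definition cov_deriv_along :: "('a, 'e::euclidean_space) mfd \<Rightarrow>
    ('a field \<Rightarrow> 'a field \<Rightarrow> 'a field) \<Rightarrow> ('a, 'e) chart \<Rightarrow> (real \<Rightarrow> 'a) \<Rightarrow>
    (real \<Rightarrow> 'a tangent) \<Rightarrow> real \<Rightarrow> 'a tangent"
  where "cov_deriv_along M nabla c \<gamma> V t =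
    (\<Sum>b\<in>Basis. deriv (\<lambda>s. V s (coord c b)) t *\<^sub>R coord_field M c b (\<gamma> t) +
      V t (coord c b) *\<^sub>R (\<Sum>a\<in>Basis. velocity M \<gamma> t (coord c a) *\<^sub>R
        nabla (coord_field M c a) (coord_field M c b) (\<gamma> t)))"

text \<open>
  The covariant derivative does not depend on the chart, so quantifying over all charts of the
  atlas around \<open>\<gamma> t\<close>, which exist, amounts to choosing one of them.
\<close>

definition nonholonomic_geodesic :: "('a, 'e::euclidean_space) mfd \<Rightarrow> 'a distribution \<Rightarrow>
    'a metric_tensor \<Rightarrow> ('a field \<Rightarrow> 'a field \<Rightarrow> 'a field) \<Rightarrow> real set \<Rightarrow> (real \<Rightarrow> 'a) \<Rightarrow> bool"
  where "nonholonomic_geodesic M \<Sigma> g nabla I \<gamma> \<longleftrightarrow> open I \<and> is_interval I \<and>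
    smooth_curve M I \<gamma> \<and> (\<forall>t\<in>I. velocity M \<gamma> t \<in> \<Sigma> (\<gamma> t)) \<and>
    (\<forall>t\<in>I. \<forall>c\<in>atlas M. \<gamma> t \<in> fst c \<longrightarrow>
      horizontal_proj g \<Sigma> (\<gamma> t) (cov_deriv_along M nabla c \<gamma> (velocity M \<gamma>) t) = 0)"

end

theory Submission
  imports Defs
begin

text \<open>
  Choose a chart around \<open>y\<close> and an orthonormal frame \<open>X\<^sub>1, \<dots>, X\<^sub>k\<close> of \<open>\<Sigma>\<close> over a neighbourhood in
  its domain (\<open>orthonormal_frame\<close>). A horizontal field \<open>E = (\<Sum>i. u\<^sub>i X\<^sub>i)\<close> satisfies
  \<open>D\<^sub>E E = 0\<close> if and only if its coefficients solve the quasilinear first order system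
  \<open>E u\<^sub>l = - (\<Sum>i j. \<Gamma> l i j u\<^sub>i u\<^sub>j)\<close>, where \<open>\<Gamma> l i j = g (nabla X\<^sub>i X\<^sub>j, X\<^sub>l)\<close>. Geometrically, such an
  \<open>E\<close> arises by prescribing a horizontal unit field along a hypersurface transverse to it and
  sweeping out a neighbourhood by the geodesics with these initial velocities. Analytically, this is
  the method of characteristics (\<open>quasilinear_first_order\<close>). Starting with \<open>E = X\<^sub>m\<close> on a
  hypersurface through \<open>y\<close> that is transverse to \<open>X\<^sub>m\<close> yields a field \<open>E\<^sub>m\<close> that equals \<open>X\<^sub>m\<close>
  at \<open>y\<close> and is close to it nearby (\<open>geodesic_field\<close>).

  Each \<open>E\<^sub>m\<close> has length 1 because \<open>nabla\<close> is metric: \<open>\<Gamma> l i j = - \<Gamma> j i l\<close>, so geodesics have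
  constant speed. The fields \<open>E\<^sub>1, \<dots>, E\<^sub>k\<close> agree with an orthonormal frame at \<open>y\<close>, hence they
  still form a frame near \<open>y\<close> (\<open>near_identity_frame\<close>). Finally, along any integral curve of
  \<open>E\<^sub>m\<close>, in any chart, the covariant derivative of the velocity is \<open>nabla E\<^sub>m E\<^sub>m\<close>, and the
  equation for the coefficients says that this is orthogonal to \<open>\<Sigma>\<close>
  (\<open>integral_curve_nonholonomic_geodesic\<close>).

  The analytic core is that solutions of ordinary differential equations depend smoothly on their
  initial values (\<open>smooth_local_flow\<close>). Existence is Picard's theorem. Solutions are differentiable
  in the parameters by a Gronwall estimate against the matrix solution of the linearised equation
  (\<open>ode_variational\<close>). For higher derivatives, note that a parameter derivative of a solution of a
  linear equation solves the linear equation with the same coefficient and a new inhomogeneity, so that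
  smoothness follows by induction on its degree within one fixed space (\<open>linear_ode_Ck\<close>). The same lemma
  makes integrals with parameters smooth, which gives Hadamard's lemma (\<open>hadamard\<close>), and
  this in turn identifies derivations with coordinate vectors (\<open>tangent_chart_representation\<close>).
\<close>

section \<open>Calculus of finitely often differentiable maps\<close>

lemma Ck_on_SucD:
  assumes "Ck_on (Suc n) S f" "x \<in> S"
  shows "(f has_derivative frechet_derivative f (at x)) (at x)"
  using assms by (simp add: frechet_derivative_works)

lemma Ck_on_cong:
  assumes "open S" "\<And>x. x \<in> S \<Longrightarrow> f x = g x"
  shows "Ck_on n S f = Ck_on n S g"
  using assms(2)
proof (induction n arbitrary: f g)
  case 0
  then show ?case by (auto cong: continuous_on_cong)
next
  case (Suc n)
  have der: "(f has_derivative D) (at x) \<longleftrightarrow> (g has_derivative D) (at x)" if "x \<in> S" for D x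
    using has_derivative_transform_within_open[OF _ assms(1) that, of f D UNIV g]
      has_derivative_transform_within_open[OF _ assms(1) that, of g D UNIV f] Suc.prems by auto
  have diff: "f differentiable (at x) \<longleftrightarrow> g differentiable (at x)" if "x \<in> S" for x
    using der[OF that] by (simp add: differentiable_def)
  have fr: "frechet_derivative f (at x) = frechet_derivative g (at x)" if "x \<in> S" for x
    using der[OF that] by (simp add: frechet_derivative_def)
  have "Ck_on n S (\<lambda>x. frechet_derivative f (at x) v) = Ck_on n S (\<lambda>x. frechet_derivative g (at x) v)" for v
    by (rule Suc.IH) (simp add: fr)
  with diff show ?case by simp
qed

lemma Ck_on_subset: "Ck_on n S f \<Longrightarrow> T \<subseteq> S \<Longrightarrow> Ck_on n T f"
proof (induction n arbitrary: f)
  case 0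
  then show ?case using continuous_on_subset by auto
next
  case (Suc n)
  then show ?case by (simp add: subset_eq)
qed

text \<open>
  Derivatives are unique on an open set, so any formula for them may replace
  \<^const>\<open>frechet_derivative\<close>.
\<close>

lemma Ck_on_SucI:
  assumes "open S" "\<And>x. x \<in> S \<Longrightarrow> (f has_derivative f' x) (at x)" "\<And>v. Ck_on n S (\<lambda>x. f' x v)"
  shows "Ck_on (Suc n) S f"
proof -
  have "frechet_derivative f (at x) = f' x" if "x \<in> S" for x
    using frechet_derivative_at[OF assms(2)[OF that]] by simp
  then have "Ck_on n S (\<lambda>x. frechet_derivative f (at x) v) = Ck_on n S (\<lambda>x. f' x v)" for v
    by (intro Ck_on_cong[OF assms(1)]) simp
  moreover have "f differentiable (at x)" if "x \<in> S" for x
    using assms(2)[OF that] by (rule differentiableI)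
  ultimately show ?thesis using assms(3) by simp
qed

lemma Ck_on_Suc_imp: "Ck_on (Suc n) S f \<Longrightarrow> Ck_on n S f"
proof (induction n arbitrary: f)
  case 0
  then show ?case
    by (auto intro!: differentiable_imp_continuous_on differentiable_at_imp_differentiable_on)
next
  case (Suc n)
  then show ?case by simp
qed

lemma Ck_on_imp_continuous_on: "Ck_on n S f \<Longrightarrow> continuous_on S f"
proof (induction n arbitrary: f)
  case (Suc n)
  then show ?case using Ck_on_Suc_imp by blast
qed simp

lemma Ck_on_const [simp]:
  fixes c :: "'f::real_normed_vector"
  shows "open S \<Longrightarrow> Ck_on n S (\<lambda>x. c)"
proof (induction n arbitrary: c)
  case (Suc n)
  show ?case
  proof (rule Ck_on_SucI[OF Suc.prems])
    show "((\<lambda>x. c) has_derivative (\<lambda>v. 0)) (at x)" for x by simp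
    show "Ck_on n S (\<lambda>x. 0::'f)" by (rule Suc.IH[OF Suc.prems])
  qed
qed simp

lemma Ck_on_bounded_linear:
  assumes "open S" "bounded_linear h"
  shows "Ck_on n S h"
proof (cases n)
  case 0
  then show ?thesis using assms(2) by (simp add: linear_continuous_on)
next
  case (Suc m)
  show ?thesis unfolding Suc
    by (rule Ck_on_SucI[where f'="\<lambda>x. h", OF assms(1) bounded_linear_imp_has_derivative[OF assms(2)] Ck_on_const[OF assms(1)]])
qed

lemma Ck_on_linear_comp:
  assumes "open S" "bounded_linear h" "Ck_on n S f"
  shows "Ck_on n S (\<lambda>x. h (f x))"
  using assms(3)
proof (induction n arbitrary: f)
  case 0
  then show ?case
    using continuous_on_compose2[OF linear_continuous_on[OF assms(2), of UNIV], of S f] by simp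
next
  case (Suc n)
  show ?case
  proof (rule Ck_on_SucI[OF assms(1)])
    show "((\<lambda>x. h (f x)) has_derivative (\<lambda>v. h (frechet_derivative f (at x) v))) (at x)" if "x \<in> S" for x
      by (rule bounded_linear.has_derivative[OF assms(2) Ck_on_SucD[OF Suc.prems that]])
    show "Ck_on n S (\<lambda>x. h (frechet_derivative f (at x) v))" for v
      using Suc by simp
  qed
qed

lemma Ck_on_add:
  assumes "open S" "Ck_on n S f" "Ck_on n S g"
  shows "Ck_on n S (\<lambda>x. f x + g x)"
  using assms(2,3)
proof (induction n arbitrary: f g)
  case 0
  then show ?case by (auto intro: continuous_intros)
next
  case (Suc n)
  show ?case
    by (rule Ck_on_SucI[OF assms(1) has_derivative_add[OF Ck_on_SucD[OF Suc.prems(1)] Ck_on_SucD[OF Suc.prems(2)]]])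
      (use Suc in auto)
qed

lemma Ck_on_bilinear:
  assumes "open S" "bounded_bilinear B" "Ck_on n S f" "Ck_on n S g"
  shows "Ck_on n S (\<lambda>x. B (f x) (g x))"
  using assms(3,4)
proof (induction n arbitrary: f g)
  case 0
  then show ?case using bounded_bilinear.continuous_on[OF assms(2)] by auto
next
  case (Suc n)
  show ?case
  proof (rule Ck_on_SucI[OF assms(1) bounded_bilinear.FDERIV[OF assms(2) Ck_on_SucD[OF Suc.prems(1)] Ck_on_SucD[OF Suc.prems(2)]]])
    fix v
    show "Ck_on n S (\<lambda>x. B (f x) (frechet_derivative g (at x) v) + B (frechet_derivative f (at x) v) (g x))"
      using Suc.prems
      by (intro Ck_on_add[OF assms(1)] Suc.IH Ck_on_Suc_imp[OF Suc.prems(1)] Ck_on_Suc_imp[OF Suc.prems(2)]) simp_all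
  qed auto
qed

lemma Ck_on_sum:
  assumes "open S" "\<And>i. i \<in> J \<Longrightarrow> Ck_on n S (f i)"
  shows "Ck_on n S (\<lambda>x. \<Sum>i\<in>J. f i x)"
  using assms(2)
proof (induction J rule: infinite_finite_induct)
  case (insert i J)
  then show ?case by (simp add: Ck_on_add[OF assms(1)])
qed (use assms(1) in auto)

lemma Ck_on_scaleR:
  "open S \<Longrightarrow> Ck_on n S f \<Longrightarrow> Ck_on n S g \<Longrightarrow> Ck_on n S (\<lambda>x. f x *\<^sub>R g x)"
  by (rule Ck_on_bilinear[OF _ bounded_bilinear_scaleR])

lemma Ck_on_mult:
  fixes f g :: "'e::real_normed_vector \<Rightarrow> real"
  shows "open S \<Longrightarrow> Ck_on n S f \<Longrightarrow> Ck_on n S g \<Longrightarrow> Ck_on n S (\<lambda>x. f x * g x)"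
  by (rule Ck_on_bilinear[OF _ bounded_bilinear_mult])

lemma Ck_on_inner_left:
  "open S \<Longrightarrow> Ck_on n S f \<Longrightarrow> Ck_on n S (\<lambda>x. f x \<bullet> b)"
  by (rule Ck_on_linear_comp[OF _ bounded_linear_inner_left])

lemma Ck_on_minus: "open S \<Longrightarrow> Ck_on n S f \<Longrightarrow> Ck_on n S (\<lambda>x. - f x)"
  using Ck_on_linear_comp[OF _ bounded_linear_minus[OF bounded_linear_ident]] by blast

lemma Ck_on_diff:
  "open S \<Longrightarrow> Ck_on n S f \<Longrightarrow> Ck_on n S g \<Longrightarrow> Ck_on n S (\<lambda>x. f x - g x)"
  using Ck_on_add[of S n f "\<lambda>x. - g x"] Ck_on_minus[of S n g] by simp

lemma Ck_on_Pair:
  assumes "open S" "Ck_on n S f" "Ck_on n S g"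
  shows "Ck_on n S (\<lambda>x. (f x, g x))"
proof -
  have l1: "bounded_linear (\<lambda>y. (y, 0))" and l2: "bounded_linear (\<lambda>y. (0, y))"
    by (rule bounded_linear_Pair; simp)+
  have "Ck_on n S (\<lambda>x. (f x, 0) + (0, g x))"
    using Ck_on_linear_comp[OF assms(1) l1 assms(2)] Ck_on_linear_comp[OF assms(1) l2 assms(3)]
    by (rule Ck_on_add[OF assms(1)])
  then show ?thesis by simp
qed

text \<open>
  The induction uses the chain rule in the form
  \<open>\<partial>\<^sub>v (g \<circ> f) = (\<Sum>b. (\<partial>\<^sub>v f \<bullet> b) (\<partial>\<^sub>b g \<circ> f))\<close>, which keeps the type of the outer map.
\<close>

lemma Ck_on_compose:
  fixes f :: "'e::real_normed_vector \<Rightarrow> 'f::euclidean_space" and g :: "'f \<Rightarrow> 'g::real_normed_vector"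
  assumes "open S" "open T" "f ` S \<subseteq> T" "Ck_on n S f" "Ck_on n T g"
  shows "Ck_on n S (\<lambda>x. g (f x))"
  using assms(4,5)
proof (induction n arbitrary: g)
  case 0
  then show ?case using assms(3) by (auto intro: continuous_on_compose2)
next
  case (Suc n)
  have T: "f x \<in> T" if "x \<in> S" for x using assms(3) that by auto
  let ?D = "\<lambda>x v. \<Sum>b\<in>Basis. (frechet_derivative f (at x) v \<bullet> b) *\<^sub>R frechet_derivative g (at (f x)) b"
  show ?case
  proof (rule Ck_on_SucI[OF assms(1), where f'="?D"])
    fix x assume x: "x \<in> S"
    have g: "(g has_derivative frechet_derivative g (at (f x))) (at (f x))"
      by (rule Ck_on_SucD[OF Suc.prems(2) T[OF x]])
    have "frechet_derivative g (at (f x)) (frechet_derivative f (at x) v) = ?D x v" for v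
    proof -
      have "frechet_derivative g (at (f x)) (frechet_derivative f (at x) v) =
          frechet_derivative g (at (f x)) (\<Sum>b\<in>Basis. (frechet_derivative f (at x) v \<bullet> b) *\<^sub>R b)"
        by (simp add: euclidean_representation)
      also have "\<dots> = ?D x v"
        by (simp add: linear_sum[OF has_derivative_linear[OF g]] linear_scale[OF has_derivative_linear[OF g]])
      finally show ?thesis .
    qed
    then show "((\<lambda>x. g (f x)) has_derivative ?D x) (at x)"
      using has_derivative_compose[OF Ck_on_SucD[OF Suc.prems(1) x] g] by simp
  next
    fix v
    show "Ck_on n S (\<lambda>x. ?D x v)"
      using Suc.prems assms(1)
      by (intro Ck_on_sum Ck_on_scaleR Ck_on_inner_left Suc.IH Ck_on_Suc_imp[OF Suc.prems(1)]) simp_all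
  qed
qed

text \<open>
  In the operator norm a family of operators is as smooth as its values on a basis: it is the finite
  sum of these values multiplied by the coordinate functionals.
\<close>

lemma Ck_on_blinfunI:
  fixes A :: "'e::real_normed_vector \<Rightarrow> 'f::euclidean_space \<Rightarrow>\<^sub>L 'g::real_normed_vector"
  assumes "open S" "\<And>b. b \<in> Basis \<Longrightarrow> Ck_on n S (\<lambda>x. A x b)"
  shows "Ck_on n S A"
proof -
  define h where "h b w = blinfun_scaleR_left w o\<^sub>L blinfun_inner_left b" for b :: 'f and w :: 'g
  have h: "bounded_linear (h b)" for b
    unfolding h_def
    by (intro bounded_linear_compose[OF bounded_bilinear.bounded_linear_left[OF bounded_bilinear_blinfun_compose]]
        bounded_linear_blinfun_scaleR_left)
  have happ: "h b w x = (x \<bullet> b) *\<^sub>R w" for b w x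
    by (simp add: h_def)
  have "A x = (\<Sum>b\<in>Basis. h b (A x b))" for x
  proof (rule blinfun_eqI)
    fix v
    have "A x v = A x (\<Sum>b\<in>Basis. (v \<bullet> b) *\<^sub>R b)" by (simp add: euclidean_representation)
    also have "\<dots> = (\<Sum>b\<in>Basis. (v \<bullet> b) *\<^sub>R A x b)"
      by (simp add: blinfun.sum_right blinfun.scaleR_right)
    finally show "A x v = (\<Sum>b\<in>Basis. h b (A x b)) v"
      by (simp add: blinfun.sum_left happ)
  qed
  moreover have "Ck_on n S (\<lambda>x. \<Sum>b\<in>Basis. h b (A x b))"
    using assms by (intro Ck_on_sum Ck_on_linear_comp[OF _ h]) auto
  ultimately show ?thesis by (metis (no_types, lifting) ext)
qed

lemma Ck_on_blinfun_apply:
  "open S \<Longrightarrow> Ck_on n S A \<Longrightarrow> Ck_on n S f \<Longrightarrow> Ck_on n S (\<lambda>x. blinfun_apply (A x) (f x))"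
  by (rule Ck_on_bilinear[OF _ bounded_bilinear_blinfun_apply])

text \<open>
  Operator norms and products of derivatives occur in the theory of differential equations, which
  therefore uses the derivative as a map into the bounded linear operators.
\<close>

lemma Ck_on_SucE:
  fixes f :: "'e::euclidean_space \<Rightarrow> 'f::real_normed_vector"
  assumes "open S" "Ck_on (Suc n) S f"
  obtains f' :: "'e \<Rightarrow> 'e \<Rightarrow>\<^sub>L 'f"
  where "\<And>x. x \<in> S \<Longrightarrow> (f has_derivative blinfun_apply (f' x)) (at x)" "Ck_on n S f'"
proof
  let ?f' = "\<lambda>x. Blinfun (frechet_derivative f (at x))"
  have f': "blinfun_apply (?f' x) = frechet_derivative f (at x)" if "x \<in> S" for x
    using Ck_on_SucD[OF assms(2) that] by (simp add: bounded_linear_Blinfun_apply has_derivative_bounded_linear)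
  show "(f has_derivative blinfun_apply (?f' x)) (at x)" if "x \<in> S" for x
    using Ck_on_SucD[OF assms(2) that] f'[OF that] by simp
  show "Ck_on n S ?f'"
  proof (rule Ck_on_blinfunI[OF assms(1)])
    fix b :: 'e
    have "Ck_on n S (\<lambda>x. frechet_derivative f (at x) b)" using assms(2) by simp
    then show "Ck_on n S (\<lambda>x. ?f' x b)"
      by (subst Ck_on_cong[OF assms(1), of _ "\<lambda>x. frechet_derivative f (at x) b"]) (auto simp: f')
  qed
qed

text \<open>
  The function \<open>r = 1 / sqrt\<close> satisfies \<open>r' = - r\<^sup>3 / 2\<close>, so each degree of differentiability
  yields the next one.
\<close>

lemma Ck_on_inverse_sqrt: "Ck_on n {0<..} (\<lambda>x::real. inverse (sqrt x))"
proof (induction n)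
  case 0
  then show ?case by (auto intro!: continuous_intros)
next
  case (Suc n)
  let ?r = "\<lambda>x::real. inverse (sqrt x)"
  show ?case
  proof (rule Ck_on_SucI[where f'="\<lambda>x v. (- 1 / 2) *\<^sub>R (?r x * (?r x * ?r x)) * v"])
    fix x :: real assume "x \<in> {0<..}"
    then have "x > 0" by simp
    then show "(?r has_derivative (\<lambda>v. (- 1 / 2) *\<^sub>R (?r x * (?r x * ?r x)) * v)) (at x)"
      by (auto intro!: derivative_eq_intros simp: divide_simps)
  next
    fix v :: real
    show "Ck_on n {0<..} (\<lambda>x. (- 1 / 2) *\<^sub>R (?r x * (?r x * ?r x)) * v)"
      using Suc by (intro Ck_on_mult Ck_on_scaleR Ck_on_const) auto
  qed simp
qed

text \<open>
  Multiplying out \<open>C A = id\<close> gives \<open>C y - C x = - C y (A y - A x) C x\<close>. This bounds \<open>C\<close> near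
  \<open>x\<close>, makes it continuous, and then differentiable with derivative \<open>- C A' C\<close>. That formula
  has the same degree of differentiability as \<open>C\<close> and \<open>A'\<close>, which drives the induction.
\<close>

lemma Ck_on_blinfun_inverse:
  fixes A C :: "'e::real_normed_vector \<Rightarrow> 'f::real_normed_vector \<Rightarrow>\<^sub>L 'f"
  assumes "open S" "Ck_on n S A"
    and inv: "\<And>x. x \<in> S \<Longrightarrow> C x o\<^sub>L A x = id_blinfun" "\<And>x. x \<in> S \<Longrightarrow> A x o\<^sub>L C x = id_blinfun"
  shows "Ck_on n S C"
proof -
  have diff: "C y - C x = - (C y o\<^sub>L (A y - A x) o\<^sub>L C x)" if "x \<in> S" "y \<in> S" for x y
  proof -
    have i: "blinfun_apply (C z) (blinfun_apply (A z) v) = v" "blinfun_apply (A z) (blinfun_apply (C z) v) = v"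
      if "z \<in> S" for z v
      using arg_cong[OF inv(1)[OF that], of "\<lambda>B. blinfun_apply B v"]
        arg_cong[OF inv(2)[OF that], of "\<lambda>B. blinfun_apply B v"] by simp_all
    show ?thesis
      by (rule blinfun_eqI) (simp add: blinfun.bilinear_simps i that)
  qed
  have cont: "continuous_on S C"
  proof (rule continuous_at_imp_continuous_on, rule ballI)
    fix x assume x: "x \<in> S"
    have A: "(A \<longlongrightarrow> A x) (at x)"
      using Ck_on_imp_continuous_on[OF assms(2)] assms(1) x
      by (simp add: continuous_on_eq_continuous_at isCont_def)
    have "\<forall>\<^sub>F y in at x. dist (A y) (A x) < 1 / (2 * (norm (C x) + 1))"
      using A by (rule tendstoD) (simp add: add_nonneg_pos)
    moreover have "\<forall>\<^sub>F y in at x. y \<in> S"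
      using assms(1) x by (rule eventually_at_in_open')
    ultimately have ev: "\<forall>\<^sub>F y in at x. norm (C y - C x) \<le> 2 * norm (C x) * norm (A y - A x) * norm (C x)"
    proof eventually_elim
      case (elim y)
      let ?d = "norm (A y - A x)"
      have d: "?d * norm (C x) \<le> 1/2"
      proof -
        have "?d * norm (C x) \<le> 1 / (2 * (norm (C x) + 1)) * (norm (C x) + 1)"
          using elim(1) by (intro mult_mono) (auto simp: dist_norm)
        also have "\<dots> = 1/2" by (simp add: add_nonneg_eq_0_iff)
        finally show ?thesis .
      qed
      have b: "norm (C y - C x) \<le> norm (C y) * ?d * norm (C x)"
        unfolding diff[OF x elim(2)] norm_minus_cancel
        by (meson mult_right_mono norm_blinfun_compose norm_ge_zero order_trans)
      also have "\<dots> \<le> norm (C y) * (1/2)"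
        using mult_left_mono[OF d norm_ge_zero[of "C y"]] by (simp add: mult.assoc)
      finally have "norm (C y) \<le> 2 * norm (C x)"
        using norm_triangle_ineq[of "C y - C x" "C x"] by simp
      then show ?case
        using b by (meson mult_right_mono norm_ge_zero order_trans)
    qed
    have "((\<lambda>y. 2 * norm (C x) * norm (A y - A x) * norm (C x)) \<longlongrightarrow> 2 * norm (C x) * norm (A x - A x) * norm (C x)) (at x)"
      by (intro tendsto_intros A)
    then have "((\<lambda>y. 2 * norm (C x) * norm (A y - A x) * norm (C x)) \<longlongrightarrow> 0) (at x)" by simp
    then have "((\<lambda>y. C y - C x) \<longlongrightarrow> 0) (at x)"
      by (rule Lim_null_comparison[OF ev])
    then show "isCont C x" by (simp add: isCont_def LIM_zero_iff)
  qed
  show ?thesis using assms(2)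
  proof (induction n)
    case 0
    then show ?case using cont by simp
  next
    case (Suc n)
    have C: "Ck_on n S C" using Suc Ck_on_Suc_imp by blast
    let ?A' = "\<lambda>x. frechet_derivative A (at x)"
    show ?case
    proof (rule Ck_on_SucI[OF assms(1), where f'="\<lambda>x v. - (C x o\<^sub>L ?A' x v o\<^sub>L C x)"])
      show "Ck_on n S (\<lambda>x. - (C x o\<^sub>L ?A' x v o\<^sub>L C x))" for v
        using Suc.prems C
        by (intro Ck_on_minus[OF assms(1)] Ck_on_bilinear[OF assms(1) bounded_bilinear_blinfun_compose]) auto
    next
      fix x assume x: "x \<in> S"
      have A': "(A has_derivative ?A' x) (at x)" by (rule Ck_on_SucD[OF Suc.prems x])
      let ?\<rho> = "\<lambda>y. norm (A y - A x - ?A' x (y - x)) / norm (y - x)"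
      let ?D = "\<lambda>v. - (C x o\<^sub>L ?A' x v o\<^sub>L C x)"
      obtain K where K: "\<And>v. norm (?A' x v) \<le> norm v * K"
        using bounded_linear.bounded[OF has_derivative_bounded_linear[OF A']] by blast
      have rho: "(?\<rho> \<longlongrightarrow> 0) (at x)"
        using A' by (simp add: has_derivative_iff_norm)
      have C0: "((\<lambda>y. norm (C y - C x)) \<longlongrightarrow> 0) (at x)"
        using cont assms(1) x
        by (simp add: continuous_on_eq_continuous_at isCont_def LIM_zero_iff tendsto_norm_zero_iff)
      let ?e = "\<lambda>y. norm (C y - C x) * (?\<rho> y + K) * norm (C x) + norm (C x) * ?\<rho> y * norm (C x)"
      have "(?e \<longlongrightarrow> 0 * (0 + K) * norm (C x) + norm (C x) * 0 * norm (C x)) (at x)"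
        by (intro tendsto_intros rho C0)
      then have e: "(?e \<longlongrightarrow> 0) (at x)" by simp
      have "\<forall>\<^sub>F y in at x. y \<in> S \<and> y \<noteq> x"
        using eventually_at_in_open[OF assms(1) x] by (auto elim: eventually_mono)
      then have ev: "\<forall>\<^sub>F y in at x. norm (norm (C y - C x - ?D (y - x)) / norm (y - x)) \<le> ?e y"
      proof eventually_elim
        case (elim y)
        let ?h = "norm (y - x)"
        have h: "?h > 0" using elim by simp
        have eq: "C y - C x - ?D (y - x) =
            - ((C y - C x) o\<^sub>L (A y - A x) o\<^sub>L C x) - (C x o\<^sub>L (A y - A x - ?A' x (y - x)) o\<^sub>L C x)"
        proof -
          have "C y - C x - ?D (y - x) = - (C y o\<^sub>L (A y - A x) o\<^sub>L C x) - ?D (y - x)"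
            using diff[OF x conjunct1[OF elim]] by simp
          also have "\<dots> = - ((C y - C x) o\<^sub>L (A y - A x) o\<^sub>L C x) - (C x o\<^sub>L (A y - A x - ?A' x (y - x)) o\<^sub>L C x)"
            by (rule blinfun_eqI) (simp add: blinfun.bilinear_simps)
          finally show ?thesis .
        qed
        have nc: "norm (P o\<^sub>L Q o\<^sub>L R) \<le> norm P * norm Q * norm R" for P Q R :: "'f \<Rightarrow>\<^sub>L 'f"
          by (meson mult_right_mono norm_blinfun_compose norm_ge_zero order_trans)
        have "norm (A y - A x) \<le> norm (A y - A x - ?A' x (y - x)) + norm (?A' x (y - x))"
          using norm_triangle_sub[of "A y - A x" "?A' x (y - x)"] by simp
        also have "\<dots> \<le> ?\<rho> y * ?h + ?h * K"
          using K[of "y - x"] h by simp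
        finally have dA: "norm (A y - A x) \<le> (?\<rho> y + K) * ?h" by (simp add: algebra_simps)
        have "norm (C y - C x - ?D (y - x)) \<le>
            norm (C y - C x) * norm (A y - A x) * norm (C x) +
            norm (C x) * norm (A y - A x - ?A' x (y - x)) * norm (C x)"
          unfolding eq using norm_triangle_ineq4[of "- ((C y - C x) o\<^sub>L (A y - A x) o\<^sub>L C x)"
              "C x o\<^sub>L (A y - A x - ?A' x (y - x)) o\<^sub>L C x"]
            nc[of "C y - C x" "A y - A x" "C x"] nc[of "C x" "A y - A x - ?A' x (y - x)" "C x"]
          by simp
        also have "\<dots> \<le> norm (C y - C x) * ((?\<rho> y + K) * ?h) * norm (C x) +
            norm (C x) * (?\<rho> y * ?h) * norm (C x)"
          using dA h by (intro add_mono mult_right_mono mult_left_mono) auto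
        also have "\<dots> = ?e y * ?h" by (simp only: algebra_simps)
        finally show ?case using h by (simp add: pos_divide_le_eq)
      qed
      have "((\<lambda>y. norm (C y - C x - ?D (y - x)) / norm (y - x)) \<longlongrightarrow> 0) (at x)"
        by (rule Lim_null_comparison[OF ev e])
      moreover have "bounded_linear ?D"
        by (intro bounded_linear_minus
            bounded_linear_compose[OF bounded_bilinear.bounded_linear_left[OF bounded_bilinear_blinfun_compose]]
            bounded_linear_compose[OF bounded_bilinear.bounded_linear_right[OF bounded_bilinear_blinfun_compose]]
            has_derivative_bounded_linear[OF A'])
      ultimately show "(C has_derivative ?D) (at x)"
        by (simp add: has_derivative_iff_norm)
    qed
  qed
qed

section \<open>Ordinary differential equations\<close>

text \<open>
  The norm of \<open>r\<close> need not be differentiable where \<open>r\<close> vanishes, but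
  \<open>\<bar>r\<bar>\<^sup>2 + \<delta>\<^sup>2\<close> is, and its derivative is at most \<open>2 L + 1\<close> times its value. Hence
  its product with a decaying exponential decreases. Negative times follow by reflection.
\<close>

lemma gronwall:
  fixes r r' :: "real \<Rightarrow> 's::real_inner"
  assumes der: "\<And>t. t \<in> closed_segment 0 \<tau> \<Longrightarrow> (r has_vector_derivative r' t) (at t)"
    and bnd: "\<And>t. t \<in> closed_segment 0 \<tau> \<Longrightarrow> norm (r' t) \<le> L * norm (r t) + \<delta>"
    and "0 \<le> L" "0 \<le> \<delta>"
  shows "norm (r \<tau>) \<le> exp ((L + 1) * \<bar>\<tau>\<bar>) * (norm (r 0) + \<delta>)"
proof -
  have pos: "norm (r \<tau>) \<le> exp ((L + 1) * \<tau>) * (norm (r 0) + \<delta>)"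
    if "0 \<le> \<tau>" and der: "\<And>t. t \<in> {0..\<tau>} \<Longrightarrow> (r has_vector_derivative r' t) (at t)"
    and bnd: "\<And>t. t \<in> {0..\<tau>} \<Longrightarrow> norm (r' t) \<le> L * norm (r t) + \<delta>" for r r' :: "real \<Rightarrow> 's" and \<tau> :: real
  proof -
    let ?K = "2 * L + 1"
    let ?q = "\<lambda>t. (r t \<bullet> r t + \<delta>\<^sup>2) * exp (- ?K * t)"
    have "?q \<tau> \<le> ?q 0"
    proof (rule DERIV_nonpos_imp_nonincreasing[OF that(1)])
      fix t assume t: "0 \<le> t" "t \<le> \<tau>"
      have d: "(r has_derivative (\<lambda>h. h *\<^sub>R r' t)) (at t)"
        using der[of t] t by (simp add: has_vector_derivative_def)
      have "((\<lambda>t. r t \<bullet> r t) has_derivative (\<lambda>h. r t \<bullet> (h *\<^sub>R r' t) + (h *\<^sub>R r' t) \<bullet> r t)) (at t)"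
        by (rule has_derivative_inner[OF d d])
      then have i: "((\<lambda>t. r t \<bullet> r t) has_real_derivative 2 * (r t \<bullet> r' t)) (at t)"
        by (rule has_derivative_imp_has_field_derivative) (simp add: inner_commute)
      have "(?q has_real_derivative
          2 * (r t \<bullet> r' t) * exp (- ?K * t) + (r t \<bullet> r t + \<delta>\<^sup>2) * (- ?K * exp (- ?K * t))) (at t)"
        by (rule derivative_eq_intros i refl | simp)+
      moreover have "2 * (r t \<bullet> r' t) * exp (- ?K * t) + (r t \<bullet> r t + \<delta>\<^sup>2) * (- ?K * exp (- ?K * t)) \<le> 0"
      proof -
        have "r t \<bullet> r' t \<le> norm (r t) * norm (r' t)" by (rule norm_cauchy_schwarz)
        also have "\<dots> \<le> norm (r t) * (L * norm (r t) + \<delta>)"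
          using bnd[of t] t by (intro mult_left_mono) auto
        also have "\<dots> = L * (norm (r t))\<^sup>2 + norm (r t) * \<delta>" by (simp add: power2_eq_square algebra_simps)
        finally have 1: "2 * (r t \<bullet> r' t) \<le> 2 * L * (norm (r t))\<^sup>2 + 2 * norm (r t) * \<delta>" by simp
        have "2 * norm (r t) * \<delta> \<le> (norm (r t))\<^sup>2 + \<delta>\<^sup>2"
          by (rule sum_squares_bound)
        with 1 have "2 * (r t \<bullet> r' t) \<le> ?K * (norm (r t))\<^sup>2 + \<delta>\<^sup>2" by (simp add: algebra_simps)
        also have "\<dots> \<le> ?K * ((norm (r t))\<^sup>2 + \<delta>\<^sup>2)"
          using \<open>0 \<le> L\<close> by (simp add: algebra_simps)
        finally have "(2 * (r t \<bullet> r' t) - ?K * (r t \<bullet> r t + \<delta>\<^sup>2)) * exp (- ?K * t) \<le> 0"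
          by (simp add: power2_norm_eq_inner mult_le_0_iff)
        then show ?thesis by (simp add: algebra_simps)
      qed
      ultimately show "\<exists>y. (?q has_real_derivative y) (at t) \<and> y \<le> 0" by blast
    qed
    then have q: "((norm (r \<tau>))\<^sup>2 + \<delta>\<^sup>2) * exp (- ?K * \<tau>) \<le> (norm (r 0))\<^sup>2 + \<delta>\<^sup>2"
      by (simp add: power2_norm_eq_inner)
    have E: "exp (- ?K * \<tau>) * exp (?K * \<tau>) = 1"
      unfolding exp_add[symmetric] by (simp add: algebra_simps)
    have "(norm (r \<tau>))\<^sup>2 + \<delta>\<^sup>2 = ((norm (r \<tau>))\<^sup>2 + \<delta>\<^sup>2) * (exp (- ?K * \<tau>) * exp (?K * \<tau>))"
      unfolding E by simp
    also have "\<dots> = exp (?K * \<tau>) * (((norm (r \<tau>))\<^sup>2 + \<delta>\<^sup>2) * exp (- ?K * \<tau>))"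
      by (simp only: mult_ac)
    also have "\<dots> \<le> exp (?K * \<tau>) * ((norm (r 0))\<^sup>2 + \<delta>\<^sup>2)"
      by (rule mult_left_mono[OF q]) simp
    finally have "(norm (r \<tau>))\<^sup>2 + \<delta>\<^sup>2 \<le> exp (?K * \<tau>) * ((norm (r 0))\<^sup>2 + \<delta>\<^sup>2)" .
    then have "(norm (r \<tau>))\<^sup>2 \<le> exp (?K * \<tau>) * ((norm (r 0))\<^sup>2 + \<delta>\<^sup>2)"
      using zero_le_power2[of \<delta>] by linarith
    also have "\<dots> \<le> exp (2 * ((L + 1) * \<tau>)) * (norm (r 0) + \<delta>)\<^sup>2"
    proof (rule mult_mono)
      show "exp (?K * \<tau>) \<le> exp (2 * ((L + 1) * \<tau>))" using that(1) by (simp add: algebra_simps)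
      show "(norm (r 0))\<^sup>2 + \<delta>\<^sup>2 \<le> (norm (r 0) + \<delta>)\<^sup>2" using \<open>0 \<le> \<delta>\<close> by (simp add: power2_sum)
    qed simp_all
    also have "\<dots> = (exp ((L + 1) * \<tau>) * (norm (r 0) + \<delta>))\<^sup>2"
      by (simp add: power_mult_distrib exp_double)
    finally show ?thesis by (rule power2_le_imp_le) (simp add: \<open>0 \<le> \<delta>\<close>)
  qed
  show ?thesis
  proof (cases "0 \<le> \<tau>")
    case True
    then have "closed_segment 0 \<tau> = {0..\<tau>}" by (simp add: closed_segment_eq_real_ivl)
    with pos[OF True, of r r'] der bnd True show ?thesis by simp
  next
    case False
    then have seg: "closed_segment 0 \<tau> = {\<tau>..0}" by (simp add: closed_segment_eq_real_ivl)
    have "norm (r (- (- \<tau>))) \<le> exp ((L + 1) * (- \<tau>)) * (norm (r (- 0)) + \<delta>)"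
    proof (rule pos[where r' = "\<lambda>t. - r' (- t)"])
      fix t assume "t \<in> {0..- \<tau>}"
      then have t: "- t \<in> closed_segment 0 \<tau>" by (auto simp: seg)
      have "((\<lambda>t. r (- t)) has_derivative (\<lambda>h. (- h) *\<^sub>R r' (- t))) (at t)"
        using der[OF t, unfolded has_vector_derivative_def]
        by (rule has_derivative_compose[rotated]) (auto intro!: derivative_eq_intros)
      then show "((\<lambda>t. r (- t)) has_vector_derivative - r' (- t)) (at t)"
        by (simp add: has_vector_derivative_def)
      show "norm (- r' (- t)) \<le> L * norm (r (- t)) + \<delta>" using bnd[OF t] by simp
    qed (use False in simp)
    then show ?thesis using False by simp
  qed
qed

text \<open>
  This estimate makes the Picard operator a contraction on the whole interval once functions are
  measured in the norm weighted by \<open>exp (- K \<bar>t\<bar>)\<close>: integrating gains a factor \<open>1 / K\<close>.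
\<close>

lemma norm_le_exp_weight:
  fixes r r' :: "real \<Rightarrow> 'b::real_normed_vector"
  assumes cont: "continuous_on {-T..T} r" and "r 0 = 0" "0 < K" "0 \<le> C"
    and der: "\<And>t. t \<in> {-T<..<T} \<Longrightarrow> (r has_vector_derivative r' t) (at t)"
    and bnd: "\<And>t. t \<in> {-T<..<T} \<Longrightarrow> norm (r' t) \<le> C * exp (K * \<bar>t\<bar>)"
    and t: "t \<in> {-T..T}"
  shows "norm (r t) \<le> C / K * exp (K * \<bar>t\<bar>)"
proof -
  have pos: "norm (r t) \<le> C / K * exp (K * t)"
    if "0 < t" "r 0 = 0" and cont: "continuous_on {0..t} r"
    and der: "\<And>s. 0 < s \<Longrightarrow> s < t \<Longrightarrow> (r has_vector_derivative r' s) (at s)"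
    and bnd: "\<And>s. 0 < s \<Longrightarrow> s < t \<Longrightarrow> norm (r' s) \<le> C * exp (K * s)" for r r' :: "real \<Rightarrow> 'b" and t :: real
  proof -
    have "norm (r t - r 0) \<le> C / K * exp (K * t) - C / K * exp (K * 0)"
    proof (rule differentiable_bound_general[OF that(1) cont _ der _ bnd])
      show "continuous_on {0..t} (\<lambda>t. C / K * exp (K * t))" by (intro continuous_intros)
      show "((\<lambda>t. C / K * exp (K * t)) has_vector_derivative C * exp (K * s)) (at s)" for s
        unfolding has_real_derivative_iff_has_vector_derivative[symmetric]
        using \<open>0 < K\<close> by (auto intro!: derivative_eq_intros)
    qed
    also have "\<dots> \<le> C / K * exp (K * t)" using \<open>0 \<le> C\<close> \<open>0 < K\<close> by simp
    finally show ?thesis using that(2) by simp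
  qed
  consider "t = 0" | "t > 0" | "t < 0" by linarith
  then show ?thesis
  proof cases
    case 1
    then show ?thesis using assms by simp
  next
    case 2
    have "norm (r t) \<le> C / K * exp (K * t)"
    proof (rule pos[of t r r', OF 2 \<open>r 0 = 0\<close> continuous_on_subset[OF cont]])
      show "norm (r' s) \<le> C * exp (K * s)" if "0 < s" "s < t" for s
        using bnd[of s] that t by simp
      show "(r has_vector_derivative r' s) (at s)" if "0 < s" "s < t" for s
        using der[of s] that t by simp
    qed (use t 2 in auto)
    then show ?thesis using 2 by simp
  next
    case 3
    have "norm (r (- (- t))) \<le> C / K * exp (K * (- t))"
    proof (rule pos[where r' = "\<lambda>t. - r' (- t)"])
      show "continuous_on {0..- t} (\<lambda>s. r (- s))"
        using t by (intro continuous_on_compose2[OF cont] continuous_intros) auto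
      fix s assume "0 < s" "s < - t"
      then have s: "- s \<in> {-T<..<T}" using t 3 by auto
      have "((\<lambda>t. r (- t)) has_derivative (\<lambda>h. (- h) *\<^sub>R r' (- s))) (at s)"
        using der[OF s, unfolded has_vector_derivative_def]
        by (rule has_derivative_compose[rotated]) (auto intro!: derivative_eq_intros)
      then show "((\<lambda>t. r (- t)) has_vector_derivative - r' (- s)) (at s)"
        by (simp add: has_vector_derivative_def)
      show "norm (- r' (- s)) \<le> C * exp (K * s)" using bnd[OF s] \<open>0 < s\<close> by simp
    qed (use 3 \<open>r 0 = 0\<close> in auto)
    then show ?thesis using 3 by simp
  qed
qed

text \<open>
  Banach's fixed point theorem for the Picard operator. The unknown is \<open>u t = exp (- K \<bar>t\<bar>) \<phi> t\<close>,
  extended by constants beyond the interval, so that it is a bounded continuous function on the line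
  and the supremum norm of \<open>u\<close> is the weighted norm of \<open>\<phi>\<close>.
\<close>

lemma ode_exists:
  fixes f :: "real \<Rightarrow> 'b::banach \<Rightarrow> 'b"
  assumes "0 < T" and cont: "continuous_on ({-T..T} \<times> UNIV) (\<lambda>(t, x). f t x)"
    and lip: "\<And>t x y. t \<in> {-T..T} \<Longrightarrow> norm (f t x - f t y) \<le> L * norm (x - y)"
  obtains \<phi> where "\<phi> 0 = x0" "continuous_on {-T..T} \<phi>"
    "\<And>t. t \<in> {-T<..<T} \<Longrightarrow> (\<phi> has_vector_derivative f t (\<phi> t)) (at t)"
proof -
  \<comment> \<open>With this weight the Picard operator has Lipschitz constant \<open>1/2\<close>.\<close>
  define K where "K = 2 * (\<bar>L\<bar> + 1)"
  have K: "0 < K" by (simp add: K_def)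
  define g where "g u s = f s (exp (K * \<bar>s\<bar>) *\<^sub>R apply_bcontfun u s)" for u :: "real \<Rightarrow>\<^sub>C 'b" and s
  define h where "h u t = x0 + integral {-T..t} (g u) - integral {-T..0} (g u)" for u t
  define cl where "cl t = max (-T) (min T t)" for t
  have cl: "cl t \<in> {-T..T}" "t \<in> {-T..T} \<Longrightarrow> cl t = t" for t using \<open>0 < T\<close> by (auto simp: cl_def)
  have gcont: "continuous_on {-T..T} (g u)" for u
    unfolding g_def by (intro continuous_on_compose2[OF cont, of _ "\<lambda>s. (s, exp (K * \<bar>s\<bar>) *\<^sub>R apply_bcontfun u s)", simplified]
        continuous_intros) auto
  have hder: "(h u has_vector_derivative g u t) (at t within {-T..T})" if "t \<in> {-T..T}" for u t
    unfolding h_def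
    by (rule derivative_eq_intros integral_has_vector_derivative[OF gcont that] refl | simp)+
  have hder': "(h u has_vector_derivative g u t) (at t)" if "t \<in> {-T<..<T}" for u t
    using hder[of t u] that at_within_interior[of t "{-T..T}"] by simp
  have hcont: "continuous_on {-T..T} (h u)" for u
    using has_vector_derivative_continuous[OF hder] by (simp add: continuous_on_eq_continuous_within)
  have h0: "h u 0 = x0" for u by (simp add: h_def)
  define P where "P u = Bcontfun (\<lambda>t. exp (- K * \<bar>cl t\<bar>) *\<^sub>R h u (cl t))" for u
  have P: "apply_bcontfun (P u) t = exp (- K * \<bar>cl t\<bar>) *\<^sub>R h u (cl t)" for u t
  proof -
    let ?w = "\<lambda>t. exp (- K * \<bar>t\<bar>) *\<^sub>R h u t"
    have w: "continuous_on {-T..T} ?w" by (intro continuous_intros hcont)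
    have "continuous_on UNIV cl" unfolding cl_def by (intro continuous_intros)
    then have 1: "continuous_on UNIV (\<lambda>t. ?w (cl t))"
      by (rule continuous_on_compose2[OF w]) (use cl in auto)
    have "bounded (?w ` {-T..T})" by (intro compact_imp_bounded compact_continuous_image[OF w]) simp
    then have "bounded (range (\<lambda>t. ?w (cl t)))" by (rule bounded_subset) (use cl in auto)
    with 1 show ?thesis unfolding P_def by (subst Bcontfun_inverse) (auto simp: bcontfun_def)
  qed
  have "dist (P u) (P v) \<le> 1/2 * dist u v" for u v
  proof (rule dist_bound)
    fix t
    let ?s = "cl t"
    have "norm (h u ?s - h v ?s) \<le> (\<bar>L\<bar> + 1) * dist u v / K * exp (K * \<bar>?s\<bar>)"
    proof (rule norm_le_exp_weight[where r = "\<lambda>t. h u t - h v t" and r' = "\<lambda>t. g u t - g v t" and T = T])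
      show "continuous_on {-T..T} (\<lambda>t. h u t - h v t)" by (intro continuous_intros hcont)
      show "((\<lambda>t. h u t - h v t) has_vector_derivative g u t - g v t) (at t)" if "t \<in> {-T<..<T}" for t
        by (intro has_vector_derivative_diff hder' that)
      show "norm (g u t - g v t) \<le> (\<bar>L\<bar> + 1) * dist u v * exp (K * \<bar>t\<bar>)" if "t \<in> {-T<..<T}" for t
      proof -
        have "norm (g u t - g v t) \<le> L * norm (exp (K * \<bar>t\<bar>) *\<^sub>R u t - exp (K * \<bar>t\<bar>) *\<^sub>R v t)"
          unfolding g_def using that by (intro lip) auto
        also have "\<dots> = L * (exp (K * \<bar>t\<bar>) * dist (u t) (v t))"
          by (simp add: dist_norm scaleR_diff_right[symmetric])
        also have "\<dots> \<le> (\<bar>L\<bar> + 1) * (exp (K * \<bar>t\<bar>) * dist u v)"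
          by (intro mult_mono dist_bounded) auto
        finally show ?thesis by (simp add: algebra_simps)
      qed
    qed (use cl K h0 in auto)
    also have "(\<bar>L\<bar> + 1) * dist u v / K = 1/2 * dist u v" by (simp add: K_def field_simps)
    finally have "norm (h u ?s - h v ?s) \<le> 1/2 * dist u v * exp (K * \<bar>?s\<bar>)" .
    then have "exp (- K * \<bar>?s\<bar>) * norm (h u ?s - h v ?s) \<le>
        exp (- K * \<bar>?s\<bar>) * (1/2 * dist u v * exp (K * \<bar>?s\<bar>))"
      by (rule mult_left_mono) simp
    also have "\<dots> = 1/2 * dist u v * (exp (- K * \<bar>?s\<bar>) * exp (K * \<bar>?s\<bar>))"
      by (simp only: mult_ac)
    also have "exp (- K * \<bar>?s\<bar>) * exp (K * \<bar>?s\<bar>) = 1"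
      unfolding exp_add[symmetric] by simp
    finally show "dist (P u t) (P v t) \<le> 1/2 * dist u v"
      by (simp add: P dist_norm scaleR_diff_right[symmetric])
  qed
  then have "\<exists>!u. P u = u"
    by (intro banach_fix_type[of "1/2"]) auto
  then obtain u where u: "P u = u" by blast
  define \<phi> where "\<phi> t = exp (K * \<bar>t\<bar>) *\<^sub>R apply_bcontfun u t" for t
  have \<phi>: "\<phi> t = h u t" if "t \<in> {-T..T}" for t
  proof -
    have "\<phi> t = exp (K * \<bar>t\<bar>) *\<^sub>R apply_bcontfun (P u) t" by (simp add: \<phi>_def u)
    also have "\<dots> = h u t" using cl(2)[OF that] by (simp add: P exp_minus)
    finally show ?thesis .
  qed
  show thesis
  proof
    show "\<phi> 0 = x0" using \<phi>[of 0] \<open>0 < T\<close> h0 by simp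
    show "continuous_on {-T..T} \<phi>" using \<phi> hcont[of u] by (subst continuous_on_cong[OF refl, of _ \<phi> "h u"]) auto
    show "(\<phi> has_vector_derivative f t (\<phi> t)) (at t)" if "t \<in> {-T<..<T}" for t
    proof (rule has_vector_derivative_transform_within_open)
      show "(h u has_vector_derivative f t (\<phi> t)) (at t)"
        using hder'[OF that, of u] by (simp add: g_def \<phi>_def)
      show "open {-T<..<T}" by simp
    qed (use that \<phi> in auto)
  qed
qed

text \<open>
  The derivative is uniformly continuous on a compact neighbourhood of \<open>K\<close>, which makes the
  remainder of the first order Taylor formula uniformly small. It will be applied along an orbit over a
  compact time interval.
\<close>

lemma C1_uniform_taylor:
  fixes F :: "'s::euclidean_space \<Rightarrow> 's"
  assumes "compact K" "open S" "K \<subseteq> S"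
    and F': "\<And>z. z \<in> S \<Longrightarrow> (F has_derivative blinfun_apply (F' z)) (at z)" "continuous_on S F'"
    and "0 < \<epsilon>"
  obtains \<delta> where "0 < \<delta>"
    "\<And>z z'. z \<in> K \<Longrightarrow> dist z' z < \<delta> \<Longrightarrow> norm (F z' - F z - F' z (z' - z)) \<le> \<epsilon> * norm (z' - z)"
proof -
  obtain e where e: "0 < e" "(\<Union>x\<in>K. cball x e) \<subseteq> S"
    using compact_subset_open_imp_cball_epsilon_subset[OF assms(1-3)] .
  let ?K = "\<Union>x\<in>K. cball x e"
  have "uniformly_continuous_on ?K F'"
    by (intro compact_uniformly_continuous continuous_on_subset[OF F'(2) e(2)]
        compact_minkowski_sum_cball \<open>compact K\<close>)
  then obtain d where d: "0 < d" "\<And>x x'. x \<in> ?K \<Longrightarrow> x' \<in> ?K \<Longrightarrow> dist x' x < d \<Longrightarrow> dist (F' x') (F' x) < \<epsilon>"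
    using \<open>0 < \<epsilon>\<close> by (metis uniformly_continuous_on_def)
  show thesis
  proof
    show "0 < min d e" using d e by simp
    fix z z' assume z: "z \<in> K" and z': "dist z' z < min d e"
    let ?B = "ball z (min d e)"
    have B: "x \<in> ?K" if "x \<in> ?B" for x
    proof -
      have "x \<in> cball z e" using that by simp
      then show ?thesis using z by blast
    qed
    have zB: "z \<in> ?B" using d e by simp
    have "norm (F z' - F z - F' z (z' - z)) \<le> norm (z' - z) * \<epsilon>"
    proof (rule differentiable_bound_linearization[where S = ?B and f' = "\<lambda>x. blinfun_apply (F' x)" and ?x0.0 = z])
      show "z + t *\<^sub>R (z' - z) \<in> ?B" if "t \<in> {0..1}" for t
      proof -
        have "norm (t *\<^sub>R (z' - z)) \<le> 1 * norm (z' - z)"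
          unfolding norm_scaleR using that by (intro mult_right_mono) auto
        then show ?thesis using z' by (simp add: dist_norm norm_minus_commute)
      qed
      show "(F has_derivative F' x) (at x within ?B)" if "x \<in> ?B" for x
        using F'(1) B[OF that] e(2) by (meson has_derivative_at_withinI subsetD)
      show "onorm (blinfun_apply (F' x) - blinfun_apply (F' z)) \<le> \<epsilon>" if "x \<in> ?B" for x
      proof -
        have "dist (F' x) (F' z) < \<epsilon>"
          using d(2)[OF B[OF zB] B[OF that]] that by (simp add: dist_commute)
        then have "norm (F' x - F' z) \<le> \<epsilon>" by (simp add: dist_norm)
        then show ?thesis by (simp add: norm_blinfun.rep_eq minus_blinfun.rep_eq fun_diff_def)
      qed
    qed (use zB in auto)
    then show "norm (F z' - F z - F' z (z' - z)) \<le> \<epsilon> * norm (z' - z)" by (simp add: mult.commute)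
  qed
qed

section \<open>Smooth dependence on parameters\<close>

text \<open>
  Let \<open>X\<close> be the matrix solution of the linearised equation along the orbit of \<open>p0\<close>. For a nearby
  parameter \<open>q = p0 + h\<close> the error \<open>r = \<phi> (t, q) - \<phi> (t, p0) - X t (c' h)\<close> solves the same linear
  equation up to the Taylor remainder of \<open>F\<close>, which is at most
  \<open>\<epsilon> (\<bar>r\<bar> + \<bar>X t (c' h)\<bar>)\<close>. Gronwall's inequality then gives \<open>r = o(\<bar>h\<bar>)\<close>. Working with
  a matrix makes the derivative \<open>X t (c' h)\<close> linear in \<open>h\<close> by construction.
\<close>

lemma ode_variational:
  fixes F :: "'s::euclidean_space \<Rightarrow> 's" and \<phi> :: "real \<times> 'p::euclidean_space \<Rightarrow> 's"
  assumes "open S" and F': "\<And>z. z \<in> S \<Longrightarrow> (F has_derivative blinfun_apply (F' z)) (at z)" "continuous_on S F'"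
    and "open P"
    and inS: "\<And>t p. t \<in> {-T<..<T} \<Longrightarrow> p \<in> P \<Longrightarrow> \<phi> (t, p) \<in> S"
    and cont: "continuous_on ({-T<..<T} \<times> P) \<phi>"
    and ode: "\<And>t p. t \<in> {-T<..<T} \<Longrightarrow> p \<in> P \<Longrightarrow>
      ((\<lambda>s. \<phi> (s, p)) has_vector_derivative F (\<phi> (t, p))) (at t)"
    and init: "((\<lambda>q. \<phi> (0, q)) has_derivative c') (at p0)"
    and p0: "p0 \<in> P" and \<tau>: "0 < \<tau>" "\<tau> < T"
  obtains X where "X 0 = id_blinfun"
    "\<And>t. t \<in> {-\<tau><..<\<tau>} \<Longrightarrow> (X has_vector_derivative (F' (\<phi> (t, p0)) o\<^sub>L X t)) (at t)"
    "\<And>t. t \<in> {-\<tau><..<\<tau>} \<Longrightarrow> ((\<lambda>q. \<phi> (t, q)) has_derivative (\<lambda>h. X t (c' h))) (at p0)"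
proof -
  have I: "t \<in> {-T<..<T}" if "t \<in> {-\<tau>..\<tau>}" for t using that \<tau> by auto
  define A where "A t = F' (\<phi> (t, p0))" for t
  have contA: "continuous_on {-\<tau>..\<tau>} A"
    unfolding A_def
    by (rule continuous_on_compose2[OF F'(2)], rule continuous_on_compose2[OF cont])
      (use I inS p0 in \<open>auto intro!: continuous_intros\<close>)
  have "bounded (A ` {-\<tau>..\<tau>})"
    by (intro compact_imp_bounded compact_continuous_image contA) simp
  then obtain L where L: "0 < L" "\<And>t. t \<in> {-\<tau>..\<tau>} \<Longrightarrow> norm (A t) \<le> L"
    unfolding bounded_pos by blast
  obtain X where X: "X 0 = id_blinfun" "continuous_on {-\<tau>..\<tau>} X"
    "\<And>t. t \<in> {-\<tau><..<\<tau>} \<Longrightarrow> (X has_vector_derivative (A t o\<^sub>L X t)) (at t)"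
  proof (rule ode_exists[OF \<tau>(1), of "\<lambda>t X. A t o\<^sub>L X" L id_blinfun])
    have "continuous_on ({-\<tau>..\<tau>} \<times> UNIV) (\<lambda>z. A (fst z) o\<^sub>L snd z)"
      by (intro bounded_bilinear.continuous_on[OF bounded_bilinear_blinfun_compose]
          continuous_on_compose2[OF contA] continuous_intros) auto
    then show "continuous_on ({-\<tau>..\<tau>} \<times> UNIV) (\<lambda>(t, X). A t o\<^sub>L X)"
      by (simp add: case_prod_beta)
    show "norm ((A t o\<^sub>L X) - (A t o\<^sub>L Y)) \<le> L * norm (X - Y)" if "t \<in> {-\<tau>..\<tau>}" for t and X Y :: "'s \<Rightarrow>\<^sub>L 's"
    proof -
      have "(A t o\<^sub>L X) - (A t o\<^sub>L Y) = A t o\<^sub>L (X - Y)"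
        by (rule blinfun_eqI) (simp add: blinfun.bilinear_simps)
      then have "norm ((A t o\<^sub>L X) - (A t o\<^sub>L Y)) \<le> norm (A t) * norm (X - Y)"
        by (simp add: norm_blinfun_compose)
      also have "\<dots> \<le> L * norm (X - Y)" by (intro mult_right_mono L(2) that) simp
      finally show ?thesis .
    qed
  qed (use that in auto)
  have "bounded (X ` {-\<tau>..\<tau>})"
    by (intro compact_imp_bounded compact_continuous_image X(2)) simp
  then obtain K where K: "0 < K" "\<And>t. t \<in> {-\<tau>..\<tau>} \<Longrightarrow> norm (X t) \<le> K"
    unfolding bounded_pos by blast
  have c'bl: "bounded_linear c'" using init by (rule has_derivative_bounded_linear)
  obtain C where C: "0 < C" "\<And>h. norm (c' h) \<le> norm h * C"
    using bounded_linear.pos_bounded[OF c'bl] by blast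
  have der: "((\<lambda>q. \<phi> (t, q)) has_derivative (\<lambda>h. X t (c' h))) (at p0)" if t: "t \<in> {-\<tau><..<\<tau>}" for t
    unfolding has_derivative_at_alt
  proof (intro conjI allI impI)
    show "bounded_linear (\<lambda>h. X t (c' h))"
      by (rule bounded_linear_compose[OF blinfun.bounded_linear_right c'bl])
    fix e :: real assume "0 < e"
    define G where "G = exp ((L + 2) * \<tau>) * (1 + K * C)"
    have G: "0 < G" using K C by (simp add: G_def add_pos_pos)
    \<comment> \<open>\<open>G\<close> is the factor by which Gronwall's inequality amplifies a relative error \<open>\<epsilon> \<le> 1\<close>.\<close>
    define \<epsilon> where "\<epsilon> = min 1 (e / G)"
    have \<epsilon>: "0 < \<epsilon>" "\<epsilon> \<le> 1" "\<epsilon> * G \<le> e"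
      using \<open>0 < e\<close> G by (auto simp: \<epsilon>_def min_def field_simps)
    have cK: "compact (\<phi> ` ({-\<tau>..\<tau>} \<times> {p0}))"
      by (intro compact_continuous_image continuous_on_subset[OF cont] compact_Times) (use I p0 in auto)
    have sK: "\<phi> ` ({-\<tau>..\<tau>} \<times> {p0}) \<subseteq> S" using I inS p0 by auto
    obtain \<delta> where \<delta>: "0 < \<delta>"
      "\<And>z z'. z \<in> \<phi> ` ({-\<tau>..\<tau>} \<times> {p0}) \<Longrightarrow> dist z' z < \<delta> \<Longrightarrow>
        norm (F z' - F z - F' z (z' - z)) \<le> \<epsilon> * norm (z' - z)"
      using C1_uniform_taylor[OF cK \<open>open S\<close> sK F' \<epsilon>(1)] by blast
    obtain \<rho> where \<rho>: "0 < \<rho>" "cball p0 \<rho> \<subseteq> P"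
      using \<open>open P\<close> p0 open_contains_cball by blast
    have "uniformly_continuous_on ({-\<tau>..\<tau>} \<times> cball p0 \<rho>) \<phi>"
      by (intro compact_uniformly_continuous continuous_on_subset[OF cont] compact_Times)
        (use I \<rho> in auto)
    then obtain d1 where d1: "0 < d1"
      "\<And>z z'. z \<in> {-\<tau>..\<tau>} \<times> cball p0 \<rho> \<Longrightarrow> z' \<in> {-\<tau>..\<tau>} \<times> cball p0 \<rho> \<Longrightarrow> dist z' z < d1 \<Longrightarrow>
        dist (\<phi> z') (\<phi> z) < \<delta>"
      using \<delta>(1) by (metis uniformly_continuous_on_def)
    obtain d2 where d2: "0 < d2" "\<And>q. norm (q - p0) < d2 \<Longrightarrow>
        norm (\<phi> (0, q) - \<phi> (0, p0) - c' (q - p0)) \<le> \<epsilon> * norm (q - p0)"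
      using init \<epsilon>(1) unfolding has_derivative_at_alt by blast
    show "\<exists>d>0. \<forall>q. norm (q - p0) < d \<longrightarrow>
        norm (\<phi> (t, q) - \<phi> (t, p0) - X t (c' (q - p0))) \<le> e * norm (q - p0)"
    proof (intro exI[of _ "min \<rho> (min d1 d2)"] conjI allI impI)
      show "0 < min \<rho> (min d1 d2)" using \<rho> d1 d2 by simp
      fix q assume q: "norm (q - p0) < min \<rho> (min d1 d2)"
      define h where "h = q - p0"
      have qb: "q \<in> cball p0 \<rho>" using q by (simp add: dist_norm norm_minus_commute)
      have qP: "q \<in> P" using qb \<rho> by auto
      define r where "r s = \<phi> (s, q) - \<phi> (s, p0) - X s (c' h)" for s
      define r' where "r' s = F (\<phi> (s, q)) - F (\<phi> (s, p0)) - (A s o\<^sub>L X s) (c' h)" for s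
      have "norm (r t) \<le> exp ((L + 1 + 1) * \<bar>t\<bar>) * (norm (r 0) + \<epsilon> * (K * (C * norm h)))"
      proof (rule gronwall)
        fix s assume "s \<in> closed_segment 0 t"
        then have s: "s \<in> {-\<tau><..<\<tau>}" using t by (auto simp: closed_segment_eq_real_ivl split: if_splits)
        then have s': "s \<in> {-T<..<T}" "s \<in> {-\<tau>..\<tau>}" using \<tau> by auto
        have "((\<lambda>s. X s (c' h)) has_vector_derivative (A s o\<^sub>L X s) (c' h)) (at s)"
          using bounded_linear.has_vector_derivative[OF blinfun.bounded_linear_left X(3)[OF s]] .
        then show "(r has_vector_derivative r' s) (at s)"
          unfolding r_def r'_def by (intro has_vector_derivative_diff ode s' qP p0)
        let ?d = "\<phi> (s, q) - \<phi> (s, p0)"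
        have d: "?d = r s + X s (c' h)" by (simp add: r_def)
        have "dist (\<phi> (s, q)) (\<phi> (s, p0)) < \<delta>"
          using d1(2)[of "(s, p0)" "(s, q)"] s' qb q \<rho> by (simp add: dist_Pair_Pair dist_norm)
        then have R: "norm (F (\<phi> (s, q)) - F (\<phi> (s, p0)) - A s ?d) \<le> \<epsilon> * norm ?d"
          unfolding A_def using \<delta>(2)[of "\<phi> (s, p0)" "\<phi> (s, q)"] s' by simp
        have "norm (X s (c' h)) \<le> norm (X s) * norm (c' h)" by (rule norm_blinfun)
        also have "\<dots> \<le> K * (C * norm h)"
          using K(2)[OF s'(2)] C(2)[of h] K(1) by (intro mult_mono) (auto simp: mult.commute)
        finally have X': "norm (X s (c' h)) \<le> K * (C * norm h)" .
        have "r' s = (F (\<phi> (s, q)) - F (\<phi> (s, p0)) - A s ?d) + A s (r s)"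
          unfolding d by (simp add: r'_def blinfun.bilinear_simps)
        then have "norm (r' s) \<le> \<epsilon> * norm ?d + norm (A s (r s))"
          using R by (metis (no_types, lifting) add_mono norm_triangle_le order_refl)
        also have "\<dots> \<le> \<epsilon> * (norm (r s) + K * (C * norm h)) + L * norm (r s)"
        proof (rule add_mono)
          show "\<epsilon> * norm ?d \<le> \<epsilon> * (norm (r s) + K * (C * norm h))"
            unfolding d using X' \<epsilon>(1) norm_triangle_ineq[of "r s" "X s (c' h)"] by (intro mult_left_mono) auto
          show "norm (A s (r s)) \<le> L * norm (r s)"
            by (meson L(2) mult_right_mono norm_blinfun norm_ge_zero order_trans s'(2))
        qed
        also have "\<dots> \<le> (L + 1) * norm (r s) + \<epsilon> * (K * (C * norm h))"
          using mult_right_mono[OF \<epsilon>(2) norm_ge_zero[of "r s"]] by (simp add: algebra_simps)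
        finally show "norm (r' s) \<le> (L + 1) * norm (r s) + \<epsilon> * (K * (C * norm h))" .
      qed (use L K C \<epsilon> in auto)
      also have "\<dots> \<le> exp ((L + 2) * \<tau>) * (\<epsilon> * norm h + \<epsilon> * (K * (C * norm h)))"
      proof (intro mult_mono add_mono)
        show "norm (r 0) \<le> \<epsilon> * norm h" using d2(2)[of q] q X(1) by (simp add: r_def h_def)
        have "(L + 1 + 1) * \<bar>t\<bar> \<le> (L + 2) * \<tau>" using t L(1) by (intro mult_mono) auto
        then show "exp ((L + 1 + 1) * \<bar>t\<bar>) \<le> exp ((L + 2) * \<tau>)" by simp
      qed (use K C \<epsilon> in auto)
      also have "\<dots> = (\<epsilon> * G) * norm h" by (simp add: G_def algebra_simps)
      also have "\<dots> \<le> e * norm h" by (intro mult_right_mono \<epsilon>) simp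
      finally show "norm (\<phi> (t, q) - \<phi> (t, p0) - X t (c' (q - p0))) \<le> e * norm (q - p0)"
        by (simp add: r_def h_def)
    qed
  qed
  show thesis
    using that[OF X(1) X(3)[unfolded A_def] der] .
qed

text \<open>
  The derivative in the parameters exists by the previous lemma and the one in time is continuous by
  the equation, which yields the joint derivative. The parameter derivative \<open>\<xi> h\<close> agrees near every
  time with a column of a matrix solution and therefore solves the linearised equation.
\<close>

lemma ode_parameter_derivative:
  fixes F :: "'s::euclidean_space \<Rightarrow> 's" and \<phi> :: "real \<times> 'p::euclidean_space \<Rightarrow> 's"
  assumes "open S" and F': "\<And>z. z \<in> S \<Longrightarrow> (F has_derivative blinfun_apply (F' z)) (at z)" "continuous_on S F'"
    and "open P"
    and inS: "\<And>t p. t \<in> {-T<..<T} \<Longrightarrow> p \<in> P \<Longrightarrow> \<phi> (t, p) \<in> S"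
    and cont: "continuous_on ({-T<..<T} \<times> P) \<phi>"
    and ode: "\<And>t p. t \<in> {-T<..<T} \<Longrightarrow> p \<in> P \<Longrightarrow>
      ((\<lambda>s. \<phi> (s, p)) has_vector_derivative F (\<phi> (t, p))) (at t)"
    and init: "\<And>p. p \<in> P \<Longrightarrow> (\<lambda>q. \<phi> (0, q)) differentiable (at p)"
    and t: "t \<in> {-T<..<T}" and p: "p \<in> P"
  defines "\<xi> \<equiv> \<lambda>h z. frechet_derivative (\<lambda>q. \<phi> (fst z, q)) (at (snd z)) h"
  shows "(\<phi> has_derivative (\<lambda>(\<tau>, h). \<tau> *\<^sub>R F (\<phi> (t, p)) + \<xi> h (t, p))) (at (t, p))"
    and "((\<lambda>s. \<xi> h (s, p)) has_vector_derivative F' (\<phi> (t, p)) (\<xi> h (t, p))) (at t)"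
proof -
  let ?I = "{-T<..<T}"
  define \<tau> where "\<tau> = (\<bar>t\<bar> + T) / 2"
  have \<tau>: "0 < \<tau>" "\<tau> < T" "t \<in> {-\<tau><..<\<tau>}" using t by (auto simp: \<tau>_def abs_if field_simps split: if_splits)
  obtain c' where c': "((\<lambda>q. \<phi> (0, q)) has_derivative c') (at p)"
    using init[OF p] by (auto simp: differentiable_def)
  obtain X where X: "X 0 = id_blinfun"
    "\<And>t. t \<in> {-\<tau><..<\<tau>} \<Longrightarrow> (X has_vector_derivative (F' (\<phi> (t, p)) o\<^sub>L X t)) (at t)"
    "\<And>t. t \<in> {-\<tau><..<\<tau>} \<Longrightarrow> ((\<lambda>q. \<phi> (t, q)) has_derivative (\<lambda>h. X t (c' h))) (at p)"
    using ode_variational[OF \<open>open S\<close> F' \<open>open P\<close> inS cont ode c' p \<tau>(1,2)] by blast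
  have \<xi>: "\<xi> h (s, p) = X s (c' h)" if "s \<in> {-\<tau><..<\<tau>}" for s h
    using frechet_derivative_at[OF X(3)[OF that]] by (simp add: \<xi>_def fun_eq_iff)
  have "((\<lambda>s. X s (c' h)) has_vector_derivative (F' (\<phi> (t, p)) o\<^sub>L X t) (c' h)) (at t)"
    using bounded_linear.has_vector_derivative[OF blinfun.bounded_linear_left X(2)[OF \<tau>(3)]] .
  then show "((\<lambda>s. \<xi> h (s, p)) has_vector_derivative F' (\<phi> (t, p)) (\<xi> h (t, p))) (at t)"
    unfolding \<xi>[OF \<tau>(3)] blinfun_apply_blinfun_compose
    by (rule has_vector_derivative_transform_within_open[where S = "{-\<tau><..<\<tau>}"]) (use \<tau> \<xi> in auto)
  let ?fy = "\<lambda>q s. blinfun_scaleR_left (F (\<phi> (s, q)))"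
  have contF: "continuous_on S F"
    using F'(1) by (meson differentiableI differentiable_at_imp_differentiable_on differentiable_imp_continuous_on)
  have "((\<lambda>(q, s). \<phi> (s, q)) has_derivative (\<lambda>(h, \<tau>). X t (c' h) + ?fy p t \<tau>)) (at (p, t) within P \<times> ?I)"
  proof (rule has_derivative_partialsI)
    show "((\<lambda>q. \<phi> (t, q)) has_derivative (\<lambda>h. X t (c' h))) (at p within P)"
      using X(3)[OF \<tau>(3)] by (rule has_derivative_at_withinI)
    show "((\<lambda>s. \<phi> (s, q)) has_derivative blinfun_apply (?fy q s)) (at s within ?I)" if "q \<in> P" "s \<in> ?I" for q s
      using ode[OF that(2,1)] by (auto simp: has_vector_derivative_def intro: has_derivative_at_withinI)
    have "continuous_on (P \<times> ?I) (\<lambda>z. ?fy (fst z) (snd z))"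
      by (intro bounded_linear.continuous_on[OF bounded_linear_blinfun_scaleR_left]
          continuous_on_compose2[OF contF] continuous_on_compose2[OF cont] continuous_intros)
        (use inS in auto)
    then show "continuous (at (p, t) within P \<times> ?I) (\<lambda>(q, s). ?fy q s)"
      unfolding case_prod_beta continuous_on_eq_continuous_within using p t by blast
  qed (use t in auto)
  then have d: "((\<lambda>(q, s). \<phi> (s, q)) has_derivative (\<lambda>(h, \<tau>). X t (c' h) + ?fy p t \<tau>)) (at (p, t))"
    using p t \<open>open P\<close> at_within_open[of "(p, t)" "P \<times> ?I"] by (simp add: open_Times)
  have "((\<lambda>z. (\<lambda>(q, s). \<phi> (s, q)) (snd z, fst z)) has_derivative
      (\<lambda>z. (\<lambda>(h, \<tau>). X t (c' h) + ?fy p t \<tau>) (snd z, fst z))) (at (t, p))"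
  proof (rule has_derivative_compose[of "\<lambda>z. (snd z, fst z)"])
    show "((\<lambda>z. (snd z, fst z)) has_derivative (\<lambda>z. (snd z, fst z))) (at (t, p))"
      by (auto intro!: derivative_eq_intros)
    show "((\<lambda>(q, s). \<phi> (s, q)) has_derivative (\<lambda>(h, \<tau>). X t (c' h) + ?fy p t \<tau>)) (at (snd (t, p), fst (t, p)))"
      using d by simp
  qed
  then show "(\<phi> has_derivative (\<lambda>(\<tau>, h). \<tau> *\<^sub>R F (\<phi> (t, p)) + \<xi> h (t, p))) (at (t, p))"
    by (simp add: \<xi>[OF \<tau>(3)] case_prod_beta' add.commute)
qed

text \<open>
  The difference of the solutions for two parameters solves the linear equation with an inhomogeneity
  that is small, uniformly over a compact time interval, if the parameters are close.
\<close>

lemma linear_ode_continuous: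
  fixes A :: "real \<times> 'p::euclidean_space \<Rightarrow> 'v::euclidean_space \<Rightarrow>\<^sub>L 'v" and b \<psi> :: "real \<times> 'p \<Rightarrow> 'v"
  assumes "open P" and A: "continuous_on ({-T<..<T} \<times> P) A" and b: "continuous_on ({-T<..<T} \<times> P) b"
    and init: "continuous_on P (\<lambda>p. \<psi> (0, p))"
    and ode: "\<And>t p. t \<in> {-T<..<T} \<Longrightarrow> p \<in> P \<Longrightarrow>
      ((\<lambda>s. \<psi> (s, p)) has_vector_derivative A (t, p) (\<psi> (t, p)) + b (t, p)) (at t)"
  shows "continuous_on ({-T<..<T} \<times> P) \<psi>"
proof -
  have "\<exists>d>0. \<forall>z. dist z (t0, p0) < d \<longrightarrow> dist (\<psi> z) (\<psi> (t0, p0)) < e"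
    if t0: "t0 \<in> {-T<..<T}" and p0: "p0 \<in> P" and "0 < e" for t0 p0 e
  proof -
    define \<tau> where "\<tau> = (\<bar>t0\<bar> + T) / 2"
    have \<tau>: "0 < \<tau>" "\<tau> < T" "t0 \<in> {-\<tau><..<\<tau>}" using t0 by (auto simp: \<tau>_def abs_if field_simps split: if_splits)
    have I: "t \<in> {-T<..<T}" if "t \<in> {-\<tau>..\<tau>}" for t using that \<tau> by auto
    obtain \<rho> where \<rho>: "0 < \<rho>" "cball p0 \<rho> \<subseteq> P"
      using \<open>open P\<close> p0 open_contains_cball by blast
    let ?K = "{-\<tau>..\<tau>} \<times> cball p0 \<rho>"
    have K: "compact ?K" "?K \<subseteq> {-T<..<T} \<times> P" using I \<rho> by (auto intro: compact_Times)
    have "bounded (A ` ?K)"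
      by (intro compact_imp_bounded compact_continuous_image continuous_on_subset[OF A] K)
    then obtain L where L: "0 < L" "\<And>z. z \<in> ?K \<Longrightarrow> norm (A z) \<le> L"
      unfolding bounded_pos by blast
    have \<psi>0: "continuous_on {-\<tau>..\<tau>} (\<lambda>t. \<psi> (t, p0))"
      by (rule continuous_at_imp_continuous_on)
        (use ode[OF I p0] has_vector_derivative_continuous in blast)
    then have "bounded ((\<lambda>t. \<psi> (t, p0)) ` {-\<tau>..\<tau>})"
      by (intro compact_imp_bounded compact_continuous_image) simp_all
    then obtain M where M: "0 < M" "\<And>t. t \<in> {-\<tau>..\<tau>} \<Longrightarrow> norm (\<psi> (t, p0)) \<le> M"
      unfolding bounded_pos by blast
    define G where "G = exp ((L + 1) * \<tau>) * (M + 2)"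
    have G: "0 < G" using M by (simp add: G_def)
    define \<epsilon> where "\<epsilon> = e / (2 * G)"
    have \<epsilon>: "0 < \<epsilon>" "\<epsilon> * G = e / 2" using \<open>0 < e\<close> G by (auto simp: \<epsilon>_def)
    have "uniformly_continuous_on ?K A" "uniformly_continuous_on ?K b"
      by (intro compact_uniformly_continuous continuous_on_subset[OF A] continuous_on_subset[OF b] K)+
    note uc = this
    obtain dA where dA: "0 < dA" "\<And>z z'. z \<in> ?K \<Longrightarrow> z' \<in> ?K \<Longrightarrow> dist z' z < dA \<Longrightarrow> dist (A z') (A z) < \<epsilon>"
      using uc(1) \<epsilon>(1) unfolding uniformly_continuous_on_def by metis
    obtain db where db: "0 < db" "\<And>z z'. z \<in> ?K \<Longrightarrow> z' \<in> ?K \<Longrightarrow> dist z' z < db \<Longrightarrow> dist (b z') (b z) < \<epsilon>"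
      using uc(2) \<epsilon>(1) unfolding uniformly_continuous_on_def by metis
    have "isCont (\<lambda>p. \<psi> (0, p)) p0"
      using init \<open>open P\<close> p0 by (simp add: continuous_on_eq_continuous_at)
    then obtain dc where dc: "0 < dc" "\<And>p. dist p p0 < dc \<Longrightarrow> dist (\<psi> (0, p)) (\<psi> (0, p0)) < \<epsilon>"
      using \<epsilon>(1) unfolding continuous_at_eps_delta by blast
    have "isCont (\<lambda>t. \<psi> (t, p0)) t0"
      using ode[OF t0 p0] by (rule has_vector_derivative_continuous)
    then obtain dt where dt: "0 < dt" "\<And>t. dist t t0 < dt \<Longrightarrow> dist (\<psi> (t, p0)) (\<psi> (t0, p0)) < e / 2"
      using \<open>0 < e\<close> unfolding continuous_at_eps_delta by (meson half_gt_zero)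
    have near: "norm (\<psi> (t, p) - \<psi> (t, p0)) \<le> e / 2"
      if t: "t \<in> {-\<tau>..\<tau>}" and p: "dist p p0 < min (min dA db) (min dc \<rho>)" for t p
    proof -
      have pK: "p \<in> cball p0 \<rho>" using p by (simp add: dist_commute)
      have pP: "p \<in> P" using pK \<rho> by auto
      define r where "r s = \<psi> (s, p) - \<psi> (s, p0)" for s
      have "norm (r t) \<le> exp ((L + 1) * \<bar>t\<bar>) * (norm (r 0) + \<epsilon> * (M + 1))"
      proof (rule gronwall)
        fix s assume "s \<in> closed_segment 0 t"
        then have s: "s \<in> {-\<tau>..\<tau>}" using t by (auto simp: closed_segment_eq_real_ivl split: if_splits)
        show "(r has_vector_derivative (A (s, p) (\<psi> (s, p)) + b (s, p)) - (A (s, p0) (\<psi> (s, p0)) + b (s, p0))) (at s)"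
          unfolding r_def by (intro has_vector_derivative_diff ode I s pP p0)
        have z: "(s, p) \<in> ?K" "(s, p0) \<in> ?K" using s pK \<rho> by auto
        have "dist (A (s, p)) (A (s, p0)) < \<epsilon>" "dist (b (s, p)) (b (s, p0)) < \<epsilon>"
          using dA(2)[OF z(2,1)] db(2)[OF z(2,1)] p by (simp_all add: dist_Pair_Pair)
        then have AB: "norm (A (s, p) - A (s, p0)) \<le> \<epsilon>" "norm (b (s, p) - b (s, p0)) \<le> \<epsilon>"
          by (simp_all add: dist_norm)
        have "(A (s, p) (\<psi> (s, p)) + b (s, p)) - (A (s, p0) (\<psi> (s, p0)) + b (s, p0)) =
            A (s, p) (r s) + (A (s, p) - A (s, p0)) (\<psi> (s, p0)) + (b (s, p) - b (s, p0))"
          by (simp add: r_def blinfun.bilinear_simps)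
        also have "norm \<dots> \<le> norm (A (s, p) (r s)) + norm ((A (s, p) - A (s, p0)) (\<psi> (s, p0))) + norm (b (s, p) - b (s, p0))"
          by (meson add_right_mono norm_triangle_ineq order_trans)
        also have "\<dots> \<le> L * norm (r s) + \<epsilon> * M + \<epsilon>"
        proof (intro add_mono AB(2))
          show "norm (A (s, p) (r s)) \<le> L * norm (r s)"
            by (meson L(2) mult_right_mono norm_blinfun norm_ge_zero order_trans z(1))
          have "norm ((A (s, p) - A (s, p0)) (\<psi> (s, p0))) \<le> norm (A (s, p) - A (s, p0)) * norm (\<psi> (s, p0))"
            by (rule norm_blinfun)
          also have "\<dots> \<le> \<epsilon> * M" using AB(1) M s \<epsilon>(1) by (intro mult_mono) auto
          finally show "norm ((A (s, p) - A (s, p0)) (\<psi> (s, p0))) \<le> \<epsilon> * M" .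
        qed
        finally show "norm ((A (s, p) (\<psi> (s, p)) + b (s, p)) - (A (s, p0) (\<psi> (s, p0)) + b (s, p0)))
            \<le> L * norm (r s) + \<epsilon> * (M + 1)" by (simp add: algebra_simps)
      qed (use L \<epsilon> M in auto)
      also have "\<dots> \<le> exp ((L + 1) * \<tau>) * (\<epsilon> + \<epsilon> * (M + 1))"
      proof (intro mult_mono add_mono)
        show "norm (r 0) \<le> \<epsilon>" using dc(2)[of p] p by (simp add: r_def dist_norm)
        have "(L + 1) * \<bar>t\<bar> \<le> (L + 1) * \<tau>" using t L(1) by (intro mult_left_mono) auto
        then show "exp ((L + 1) * \<bar>t\<bar>) \<le> exp ((L + 1) * \<tau>)" by simp
      qed (use M \<epsilon> in auto)
      also have "\<dots> = \<epsilon> * G" by (simp add: G_def algebra_simps)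
      finally show ?thesis using \<epsilon>(2) by (simp add: r_def)
    qed
    define d where "d = min (min dt (\<tau> - \<bar>t0\<bar>)) (min (min dA db) (min dc \<rho>))"
    show ?thesis
    proof (intro exI[of _ d] conjI allI impI)
      show "0 < d" using dt dA db dc \<rho> \<tau>(3) by (auto simp: d_def)
      fix z :: "real \<times> 'p" assume z: "dist z (t0, p0) < d"
      obtain t p where tp: "z = (t, p)" by force
      have "dist t t0 < d" "dist p p0 < d"
        using z dist_fst_le[of z "(t0, p0)"] dist_snd_le[of z "(t0, p0)"] by (auto simp: tp)
      moreover from this have "t \<in> {-\<tau>..\<tau>}" by (auto simp: d_def dist_real_def)
      ultimately have "dist (\<psi> (t, p)) (\<psi> (t, p0)) \<le> e / 2" "dist (\<psi> (t, p0)) (\<psi> (t0, p0)) < e / 2"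
        using near[of t p] dt(2)[of t] by (auto simp: d_def dist_norm)
      then have "dist (\<psi> (t, p)) (\<psi> (t0, p0)) < e"
        using dist_triangle[of "\<psi> (t, p)" "\<psi> (t0, p0)" "\<psi> (t, p0)"] by linarith
      then show "dist (\<psi> z) (\<psi> (t0, p0)) < e" by (simp add: tp)
    qed
  qed
  then show ?thesis
    by (intro continuous_at_imp_continuous_on) (auto simp: continuous_at_eps_delta)
qed

lemma has_vector_derivative_along_curve:
  assumes "(f has_derivative f') (at (\<gamma> t))" "(\<gamma> has_vector_derivative v) (at t)"
  shows "((\<lambda>s. f (\<gamma> s)) has_vector_derivative f' v) (at t)"
  using vector_derivative_diff_chain_within[OF assms(2), of f f'] assms(1)
  by (simp add: o_def has_derivative_at_withinI)

text \<open>
  A parameter derivative \<open>\<eta> h\<close> of \<open>\<psi>\<close> solves a linear equation with the same coefficient \<open>A\<close> and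
  with the inhomogeneity \<open>(\<partial>\<^sub>h A) \<psi> + \<partial>\<^sub>h b\<close>, which is one degree less differentiable than \<open>A\<close>
  and \<open>b\<close>. So the induction hypothesis applies to \<open>\<eta> h\<close>. Since the unknown stays in the same space,
  no iterated tangent bundles arise. That \<open>\<psi>\<close> is differentiable at all is an instance of the
  result for autonomous equations.
\<close>

lemma linear_ode_Ck:
  fixes A :: "real \<times> 'p::euclidean_space \<Rightarrow> 'v::euclidean_space \<Rightarrow>\<^sub>L 'v" and b \<psi> :: "real \<times> 'p \<Rightarrow> 'v"
  assumes "open P" and "Ck_on n ({-T<..<T} \<times> P) A" and "Ck_on n ({-T<..<T} \<times> P) b"
    and "Ck_on n P (\<lambda>p. \<psi> (0, p))"
    and "\<And>t p. t \<in> {-T<..<T} \<Longrightarrow> p \<in> P \<Longrightarrow>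
      ((\<lambda>s. \<psi> (s, p)) has_vector_derivative A (t, p) (\<psi> (t, p)) + b (t, p)) (at t)"
  shows "Ck_on n ({-T<..<T} \<times> P) \<psi>"
  using assms(2-)
proof (induction n arbitrary: b \<psi>)
  case 0
  then show ?case using linear_ode_continuous[OF \<open>open P\<close>, of T A b \<psi>] by simp
next
  case (Suc n)
  let ?I = "{-T<..<T}" and ?IP = "{-T<..<T} \<times> P"
  have oIP: "open ?IP" using \<open>open P\<close> by (simp add: open_Times)
  note ode = Suc.prems(4)
  have \<psi>n: "Ck_on n ?IP \<psi>"
    by (rule Suc.IH[OF Ck_on_Suc_imp[OF Suc.prems(1)] Ck_on_Suc_imp[OF Suc.prems(2)] Ck_on_Suc_imp[OF Suc.prems(3)] ode])
  define S where "S = ?I \<times> (P \<times> (UNIV :: 'v set))"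
  have S: "open S" using \<open>open P\<close> by (simp add: S_def open_Times)
  define F where "F z = (1 :: real, 0 :: 'p, A (fst z, fst (snd z)) (snd (snd z)) + b (fst z, fst (snd z)))"
    for z :: "real \<times> 'p \<times> 'v"
  define \<phi> where "\<phi> z = (fst z, snd z, \<psi> z)" for z
  have pr: "bounded_linear (\<lambda>z::real \<times> 'p \<times> 'v. (fst z, fst (snd z)))"
    "bounded_linear (\<lambda>z::real \<times> 'p \<times> 'v. snd (snd z))"
    by (intro bounded_linear_Pair bounded_linear_fst bounded_linear_snd
        bounded_linear_fst_comp bounded_linear_snd_comp)+
  have SIP: "(\<lambda>z. (fst z, fst (snd z))) ` S \<subseteq> ?IP" by (auto simp: S_def)
  have FS: "Ck_on (Suc n) S F"
    unfolding F_def
    by (intro Ck_on_Pair Ck_on_const Ck_on_add Ck_on_blinfun_apply S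
        Ck_on_compose[OF S oIP SIP Ck_on_bounded_linear[OF S pr(1)]]
        Ck_on_bounded_linear[OF S pr(2)] Suc.prems)
  obtain F' where F': "\<And>z. z \<in> S \<Longrightarrow> (F has_derivative blinfun_apply (F' z)) (at z)" "Ck_on n S F'"
    using Ck_on_SucE[OF S FS] by blast
  define A' where "A' z = frechet_derivative A (at z)" for z
  define b' where "b' z = frechet_derivative b (at z)" for z
  have A': "(A has_derivative A' z) (at z)" and b': "(b has_derivative b' z) (at z)" if "z \<in> ?IP" for z
    unfolding A'_def b'_def by (rule Ck_on_SucD[OF Suc.prems(1) that] Ck_on_SucD[OF Suc.prems(2) that])+
  \<comment> \<open>The augmented system \<open>(t, p, x)' = (1, 0, A x + b)\<close> is autonomous.\<close>
  have F'eq: "F' (t, p, x) (\<tau>, h, v) = (0, 0, A (t, p) v + A' (t, p) (\<tau>, h) x + b' (t, p) (\<tau>, h))"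
    if "t \<in> ?I" "p \<in> P" for t p x \<tau> h v
  proof -
    let ?z = "(t, p, x)"
    have z: "?z \<in> S" "(t, p) \<in> ?IP" using that by (auto simp: S_def)
    have pr': "((\<lambda>z. (fst z, fst (snd z))) has_derivative (\<lambda>z. (fst z, fst (snd z)))) (at ?z)"
      by (rule bounded_linear_imp_has_derivative[OF pr(1)])
    have dA: "((\<lambda>z. A (fst z, fst (snd z))) has_derivative (\<lambda>z. A' (t, p) (fst z, fst (snd z)))) (at ?z)"
      using has_derivative_compose[OF pr', of A "A' (t, p)"] A'[OF z(2)] by simp
    have db: "((\<lambda>z. b (fst z, fst (snd z))) has_derivative (\<lambda>z. b' (t, p) (fst z, fst (snd z)))) (at ?z)"
      using has_derivative_compose[OF pr', of b "b' (t, p)"] b'[OF z(2)] by simp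
    have "(F has_derivative (\<lambda>z. (0, 0, (A (fst ?z, fst (snd ?z)) (snd (snd z)) + A' (t, p) (fst z, fst (snd z)) (snd (snd ?z)))
        + b' (t, p) (fst z, fst (snd z))))) (at ?z)"
      unfolding F_def
      by (intro has_derivative_Pair has_derivative_const has_derivative_add db
          bounded_bilinear.FDERIV[OF bounded_bilinear_blinfun_apply dA] bounded_linear_imp_has_derivative[OF pr(2)])
    from has_derivative_unique[OF F'(1)[OF z(1)] this] show ?thesis by simp
  qed
  have inS: "\<phi> (t, p) \<in> S" if "t \<in> ?I" "p \<in> P" for t p
    using that by (simp add: \<phi>_def S_def)
  have cont: "continuous_on ?IP \<phi>"
    unfolding \<phi>_def by (intro continuous_intros Ck_on_imp_continuous_on[OF \<psi>n])
  have ode\<phi>: "((\<lambda>s. \<phi> (s, p)) has_vector_derivative F (\<phi> (t, p))) (at t)" if "t \<in> ?I" "p \<in> P" for t p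
    unfolding \<phi>_def F_def using ode[OF that]
    by (auto intro!: has_vector_derivative_Pair simp: has_vector_derivative_id[unfolded id_def])
  have init\<phi>: "(\<lambda>q. \<phi> (0, q)) differentiable (at p)" if "p \<in> P" for p
  proof -
    have "((\<lambda>q. \<psi> (0, q)) has_derivative frechet_derivative (\<lambda>q. \<psi> (0, q)) (at p)) (at p)"
      by (rule Ck_on_SucD[OF Suc.prems(3) that])
    then have "((\<lambda>q. \<phi> (0, q)) has_derivative (\<lambda>h. (0, h, frechet_derivative (\<lambda>q. \<psi> (0, q)) (at p) h))) (at p)"
      unfolding \<phi>_def fst_conv snd_conv by (intro has_derivative_Pair has_derivative_const has_derivative_ident)
    then show ?thesis by (rule differentiableI)
  qed
  note D = ode_parameter_derivative[OF S F'(1) Ck_on_imp_continuous_on[OF F'(2)] \<open>open P\<close> inS cont ode\<phi> init\<phi>]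
  have D1: "(\<phi> has_derivative (\<lambda>(\<tau>, h). \<tau> *\<^sub>R F (\<phi> (t, p)) + frechet_derivative (\<lambda>q. \<phi> (t, q)) (at p) h)) (at (t, p))"
    and D2: "((\<lambda>s. frechet_derivative (\<lambda>q. \<phi> (s, q)) (at p) h) has_vector_derivative
      F' (\<phi> (t, p)) (frechet_derivative (\<lambda>q. \<phi> (t, q)) (at p) h)) (at t)"
    if "t \<in> {-T<..<T}" "p \<in> P" for t p h
    using D[unfolded fst_conv snd_conv] that by blast+
  define \<eta> where "\<eta> h z = frechet_derivative (\<lambda>q. \<psi> (fst z, q)) (at (snd z)) h" for h z
  have \<xi>: "frechet_derivative (\<lambda>q. \<phi> (t, q)) (at p) h = (0, h, \<eta> h (t, p))" if tp: "t \<in> ?I" "p \<in> P" for t p h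
  proof -
    have *: "((\<lambda>q. (t, q)) has_derivative (\<lambda>h. (0, h))) (at p)"
      by (intro has_derivative_Pair has_derivative_const has_derivative_ident)
    obtain D' where "(\<phi> has_derivative D') (at (t, p))" using D1[OF tp] by blast
    then have "((\<lambda>z. snd (snd (\<phi> z))) has_derivative (\<lambda>v. snd (snd (D' v)))) (at (t, p))"
      by (intro has_derivative_snd)
    then have "(\<psi> has_derivative (\<lambda>v. snd (snd (D' v)))) (at (t, p))" by (simp add: \<phi>_def)
    from has_derivative_compose[OF * this]
    have d: "((\<lambda>q. \<psi> (t, q)) has_derivative (\<lambda>h. snd (snd (D' (0, h))))) (at p)" .
    then have "((\<lambda>q. \<phi> (t, q)) has_derivative (\<lambda>h. (0, h, snd (snd (D' (0, h)))))) (at p)"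
      unfolding \<phi>_def fst_conv snd_conv by (intro has_derivative_Pair has_derivative_const has_derivative_ident)
    from frechet_derivative_at[OF this] frechet_derivative_at[OF d] show ?thesis
      by (simp add: \<eta>_def fun_eq_iff)
  qed
  have d\<psi>: "(\<psi> has_derivative (\<lambda>v. fst v *\<^sub>R (A z (\<psi> z) + b z) + \<eta> (snd v) z)) (at z)" if z: "z \<in> ?IP" for z
  proof -
    obtain t p where tp: "z = (t, p)" "t \<in> ?I" "p \<in> P" using z by auto
    have "((\<lambda>z. snd (snd (\<phi> z))) has_derivative
        (\<lambda>v. snd (snd ((\<lambda>(\<tau>, h). \<tau> *\<^sub>R F (\<phi> (t, p)) + frechet_derivative (\<lambda>q. \<phi> (t, q)) (at p) h) v))))
        (at (t, p))"
      by (intro has_derivative_snd D1 tp)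
    then show ?thesis
      unfolding tp(1) by (simp add: \<xi>[OF tp(2,3)] case_prod_beta' F_def) (simp add: \<phi>_def)
  qed
  have \<eta>n: "Ck_on n ?IP (\<eta> h)" for h
  proof (rule Suc.IH[where b = "\<lambda>z. A' z (0, h) (\<psi> z) + b' z (0, h)"])
    show "Ck_on n ?IP A" by (rule Ck_on_Suc_imp[OF Suc.prems(1)])
    show "Ck_on n ?IP (\<lambda>z. A' z (0, h) (\<psi> z) + b' z (0, h))"
      unfolding A'_def b'_def using Suc.prems(1,2)
      by (intro Ck_on_add Ck_on_blinfun_apply oIP \<psi>n) simp_all
    show "Ck_on n P (\<lambda>p. \<eta> h (0, p))" using Suc.prems(3) by (simp add: \<eta>_def)
    fix t p assume tp: "t \<in> ?I" "p \<in> P"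
    have "((\<lambda>s. frechet_derivative (\<lambda>q. \<phi> (s, q)) (at p) h) has_vector_derivative
        F' (\<phi> (t, p)) (0, h, \<eta> h (t, p))) (at t)"
      using D2[OF tp, of h] \<xi>[OF tp] by simp
    then have "((\<lambda>s. (0 :: real, h, \<eta> h (s, p))) has_vector_derivative F' (\<phi> (t, p)) (0, h, \<eta> h (t, p))) (at t)"
      by (rule has_vector_derivative_transform_within_open[where S = ?I]) (use tp \<xi> in auto)
    then have "((\<lambda>s. (0 :: real, h, \<eta> h (s, p))) has_vector_derivative
        (0, 0 :: 'p, A (t, p) (\<eta> h (t, p)) + A' (t, p) (0, h) (\<psi> (t, p)) + b' (t, p) (0, h))) (at t)"
      by (simp add: \<phi>_def F'eq[OF tp])
    from bounded_linear.has_vector_derivative[OF bounded_linear_snd_comp[OF bounded_linear_snd] this]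
    show "((\<lambda>s. \<eta> h (s, p)) has_vector_derivative A (t, p) (\<eta> h (t, p)) + (A' (t, p) (0, h) (\<psi> (t, p)) + b' (t, p) (0, h))) (at t)"
      by (simp add: add.assoc)
  qed
  show ?case
  proof (rule Ck_on_SucI[OF oIP d\<psi>])
    show "Ck_on n ?IP (\<lambda>z. fst v *\<^sub>R (A z (\<psi> z) + b z) + \<eta> (snd v) z)" for v
      by (intro Ck_on_add Ck_on_scaleR Ck_on_const Ck_on_blinfun_apply oIP \<psi>n \<eta>n
          Ck_on_Suc_imp[OF Suc.prems(1)] Ck_on_Suc_imp[OF Suc.prems(2)])
  qed
qed

text \<open>
  If \<open>\<phi>\<close> is \<open>n\<close> times differentiable, then so is the coefficient \<open>F' \<circ> \<phi>\<close> of the linear equation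
  that its parameter derivatives solve, hence so are these derivatives.
\<close>

lemma ode_flow_Ck:
  fixes F :: "'s::euclidean_space \<Rightarrow> 's" and \<phi> :: "real \<times> 'p::euclidean_space \<Rightarrow> 's"
  assumes "open S" and F: "\<And>n. Ck_on n S F" and "open P"
    and inS: "\<And>t p. t \<in> {-T<..<T} \<Longrightarrow> p \<in> P \<Longrightarrow> \<phi> (t, p) \<in> S"
    and cont: "continuous_on ({-T<..<T} \<times> P) \<phi>"
    and ode: "\<And>t p. t \<in> {-T<..<T} \<Longrightarrow> p \<in> P \<Longrightarrow>
      ((\<lambda>s. \<phi> (s, p)) has_vector_derivative F (\<phi> (t, p))) (at t)"
    and init: "\<And>n. Ck_on n P (\<lambda>p. \<phi> (0, p))"
  shows "Ck_on n ({-T<..<T} \<times> P) \<phi>"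
proof (induction n)
  case 0
  then show ?case using cont by simp
next
  case (Suc n)
  let ?IP = "{-T<..<T} \<times> P"
  have oIP: "open ?IP" using \<open>open P\<close> by (simp add: open_Times)
  have im: "\<phi> ` ?IP \<subseteq> S" using inS by auto
  obtain F' where F': "\<And>z. z \<in> S \<Longrightarrow> (F has_derivative blinfun_apply (F' z)) (at z)" "Ck_on n S F'"
    using Ck_on_SucE[OF \<open>open S\<close> F] by blast
  have init': "(\<lambda>q. \<phi> (0, q)) differentiable (at p)" if "p \<in> P" for p
    using init[of "Suc 0"] that by simp
  note D = ode_parameter_derivative[OF \<open>open S\<close> F'(1) Ck_on_imp_continuous_on[OF F'(2)] \<open>open P\<close> inS cont ode init']
  have D1: "(\<phi> has_derivative (\<lambda>(\<tau>, h). \<tau> *\<^sub>R F (\<phi> (t, p)) + frechet_derivative (\<lambda>q. \<phi> (t, q)) (at p) h)) (at (t, p))"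
    and D2: "((\<lambda>s. frechet_derivative (\<lambda>q. \<phi> (s, q)) (at p) h) has_vector_derivative
      F' (\<phi> (t, p)) (frechet_derivative (\<lambda>q. \<phi> (t, q)) (at p) h)) (at t)"
    if "t \<in> {-T<..<T}" "p \<in> P" for t p h
    using D[unfolded fst_conv snd_conv] that by blast+
  define \<xi> where "\<xi> h z = frechet_derivative (\<lambda>q. \<phi> (fst z, q)) (at (snd z)) h" for h z
  have \<xi>: "Ck_on n ?IP (\<xi> h)" for h
  proof (rule linear_ode_Ck[OF \<open>open P\<close>, where A = "\<lambda>z. F' (\<phi> z)" and b = "\<lambda>z. 0"])
    show "Ck_on n ?IP (\<lambda>z. F' (\<phi> z))" by (rule Ck_on_compose[OF oIP \<open>open S\<close> im Suc.IH F'(2)])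
    show "Ck_on n P (\<lambda>p. \<xi> h (0, p))" using init[of "Suc n"] by (simp add: \<xi>_def)
    show "((\<lambda>s. \<xi> h (s, p)) has_vector_derivative F' (\<phi> (t, p)) (\<xi> h (t, p)) + 0) (at t)"
      if "t \<in> {-T<..<T}" "p \<in> P" for t p
      using D2[OF that, of h] by (simp add: \<xi>_def)
  qed (simp add: oIP)
  show ?case
  proof (rule Ck_on_SucI[OF oIP])
    show "(\<phi> has_derivative (\<lambda>v. fst v *\<^sub>R F (\<phi> z) + \<xi> (snd v) z)) (at z)" if z: "z \<in> ?IP" for z
    proof -
      obtain t p where tp: "z = (t, p)" "t \<in> {-T<..<T}" "p \<in> P" using z by auto
      show ?thesis using D1[OF tp(2,3)] by (simp add: tp(1) \<xi>_def case_prod_beta')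
    qed
    show "Ck_on n ?IP (\<lambda>z. fst v *\<^sub>R F (\<phi> z) + \<xi> (snd v) z)" for v
      by (intro Ck_on_add Ck_on_scaleR Ck_on_const oIP \<xi> Ck_on_compose[OF oIP \<open>open S\<close> im Suc.IH F])
  qed
qed

theorem smooth_local_flow:
  fixes F :: "'s::euclidean_space \<Rightarrow> 's"
  assumes "open S" and F: "smooth_on S F" and "s0 \<in> S"
  obtains T P and \<phi> :: "real \<times> 's \<Rightarrow> 's" where "0 < T" "open P" "s0 \<in> P"
    "\<And>t p. t \<in> {-T<..<T} \<Longrightarrow> p \<in> P \<Longrightarrow> \<phi> (t, p) \<in> S"
    "\<And>t p. t \<in> {-T<..<T} \<Longrightarrow> p \<in> P \<Longrightarrow> ((\<lambda>s. \<phi> (s, p)) has_vector_derivative F (\<phi> (t, p))) (at t)"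
    "\<And>p. p \<in> P \<Longrightarrow> \<phi> (0, p) = p"
    "smooth_on ({-T<..<T} \<times> P) \<phi>"
proof -
  have Fn: "Ck_on n S F" for n using F by (simp add: smooth_on_def)
  obtain F' where F': "\<And>z. z \<in> S \<Longrightarrow> (F has_derivative blinfun_apply (F' z)) (at z)" "Ck_on 0 S F'"
    using Ck_on_SucE[OF \<open>open S\<close> Fn] by blast
  obtain r where r: "0 < r" "cball s0 r \<subseteq> S"
    using \<open>open S\<close> \<open>s0 \<in> S\<close> open_contains_cball by blast
  let ?B = "cball s0 r"
  have B: "convex ?B" "closed ?B" "?B \<noteq> {}" using r(1) by auto
  have "bounded (F' ` ?B)" "bounded (F ` ?B)"
    by (intro compact_imp_bounded compact_continuous_image continuous_on_subset[OF _ r(2)] compact_cball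
        Ck_on_imp_continuous_on[OF F'(2)] Ck_on_imp_continuous_on[OF Fn[of 0]])+
  then obtain L M where L: "0 < L" "\<And>z. z \<in> ?B \<Longrightarrow> norm (F' z) \<le> L"
    and M: "0 < M" "\<And>z. z \<in> ?B \<Longrightarrow> norm (F z) \<le> M"
    unfolding bounded_pos by blast
  have Flip: "norm (F x - F y) \<le> L * norm (x - y)" if "x \<in> ?B" "y \<in> ?B" for x y
  proof (rule differentiable_bound[OF B(1) _ _ that])
    show "(F has_derivative F' z) (at z within ?B)" if "z \<in> ?B" for z
      using F'(1) r(2) that by (meson has_derivative_at_withinI subsetD)
    show "onorm (F' z) \<le> L" if "z \<in> ?B" for z using L(2)[OF that] by (simp add: norm_blinfun.rep_eq)
  qed
  \<comment> \<open>Precomposing with the nearest point retraction makes the field globally Lipschitz and bounded.\<close>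
  define H where "H x = F (closest_point ?B x)" for x
  have cp: "closest_point ?B x \<in> ?B" for x by (rule closest_point_in_set[OF B(2,3)])
  have HM: "norm (H x) \<le> M" for x unfolding H_def by (rule M(2)[OF cp])
  have Hlip: "norm (H x - H y) \<le> L * norm (x - y)" for x y
  proof -
    have "norm (H x - H y) \<le> L * norm (closest_point ?B x - closest_point ?B y)"
      unfolding H_def by (rule Flip[OF cp cp])
    also have "\<dots> \<le> L * norm (x - y)"
      using closest_point_lipschitz[OF B] L(1) by (simp add: dist_norm)
    finally show ?thesis .
  qed
  have Hcont: "continuous_on UNIV H"
    using Hlip L(1) by (intro lipschitz_on_continuous_on[of L] lipschitz_onI) (auto simp: dist_norm)
  have "\<exists>\<phi>. \<phi> 0 = p \<and> (\<forall>t\<in>{-1<..<1}. (\<phi> has_vector_derivative H (\<phi> t)) (at t))" for p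
  proof -
    have "continuous_on ({-1..1::real} \<times> UNIV) (\<lambda>(t, x). H x)"
      unfolding case_prod_beta' by (rule continuous_on_compose2[OF Hcont]) (auto intro!: continuous_intros)
    then show ?thesis
      using ode_exists[of 1 "\<lambda>t. H" L p] Hlip by (metis zero_less_one)
  qed
  then obtain \<Phi> where \<Phi>: "\<And>p. \<Phi> p 0 = p" "\<And>p t. t \<in> {-1<..<1} \<Longrightarrow> (\<Phi> p has_vector_derivative H (\<Phi> p t)) (at t)"
    by metis
  have time: "norm (\<Phi> p s - \<Phi> p t) \<le> M * norm (s - t)" if "s \<in> {-1<..<1}" "t \<in> {-1<..<1}" for p s t
  proof (rule differentiable_bound[OF _ _ _ that])
    show "(\<Phi> p has_derivative (\<lambda>h. h *\<^sub>R H (\<Phi> p x))) (at x within {-1<..<1})" if "x \<in> {-1<..<1}" for x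
      using \<Phi>(2)[OF that] by (simp add: has_vector_derivative_def has_derivative_at_withinI)
    show "onorm (\<lambda>h. h *\<^sub>R H (\<Phi> p x)) \<le> M" for x
      using HM M(1) by (intro onorm_bound) (auto simp: mult.commute[of M] intro!: mult_left_mono)
  qed simp
  have space: "norm (\<Phi> p t - \<Phi> q t) \<le> exp (L + 1) * norm (p - q)" if t: "t \<in> {-1<..<1}" for p q t
  proof -
    have "norm (\<Phi> p t - \<Phi> q t) \<le> exp ((L + 1) * \<bar>t\<bar>) * (norm (\<Phi> p 0 - \<Phi> q 0) + 0)"
    proof (rule gronwall)
      fix s assume "s \<in> closed_segment 0 t"
      then have s: "s \<in> {-1<..<1}" using t by (auto simp: closed_segment_eq_real_ivl split: if_splits)
      show "((\<lambda>s. \<Phi> p s - \<Phi> q s) has_vector_derivative H (\<Phi> p s) - H (\<Phi> q s)) (at s)"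
        by (intro has_vector_derivative_diff \<Phi>(2) s)
      show "norm (H (\<Phi> p s) - H (\<Phi> q s)) \<le> L * norm (\<Phi> p s - \<Phi> q s) + 0" using Hlip by simp
    qed (use L in auto)
    also have "\<dots> \<le> exp (L + 1) * norm (p - q)"
    proof -
      have "(L + 1) * \<bar>t\<bar> \<le> (L + 1) * 1" using t L(1) by (intro mult_left_mono) auto
      then show ?thesis by (simp add: \<Phi>(1) mult_right_mono)
    qed
    finally show ?thesis .
  qed
  define T where "T = min 1 (r / (2 * M))"
  define P where "P = ball s0 (r / 2)"
  define \<phi> where "\<phi> z = \<Phi> (snd z) (fst z)" for z
  have T: "0 < T" "T \<le> 1" "M * T \<le> r / 2" using r M by (auto simp: T_def min_def field_simps)
  have I: "t \<in> {-1<..<1}" if "t \<in> {-T<..<T}" for t using that T by auto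
  have inB: "\<phi> (t, p) \<in> ?B" if t: "t \<in> {-T<..<T}" and p: "p \<in> P" for t p
  proof -
    have "norm (\<Phi> p t - \<Phi> p 0) \<le> M * norm (t - 0)" by (rule time) (use I[OF t] in auto)
    also have "\<dots> \<le> M * T" using t M(1) by (intro mult_left_mono) auto
    finally have "dist (\<Phi> p t) p \<le> r / 2" using T(3) by (simp add: \<Phi>(1) dist_norm)
    then have "dist s0 (\<Phi> p t) \<le> r"
      using p dist_triangle[of s0 "\<Phi> p t" p] by (simp add: P_def dist_commute)
    then show ?thesis by (simp add: \<phi>_def)
  qed
  have ode: "((\<lambda>s. \<phi> (s, p)) has_vector_derivative F (\<phi> (t, p))) (at t)" if t: "t \<in> {-T<..<T}" and p: "p \<in> P" for t p
    using \<Phi>(2)[OF I[OF t], of p] closest_point_self[OF inB[OF that]] by (simp add: \<phi>_def H_def)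
  have cont: "continuous_on ({-T<..<T} \<times> P) \<phi>"
  proof (rule lipschitz_on_continuous_on[of "M + exp (L + 1)"], rule lipschitz_onI)
    fix z w assume z: "z \<in> {-T<..<T} \<times> P" and w: "w \<in> {-T<..<T} \<times> P"
    then have zw: "fst z \<in> {-1<..<1}" "fst w \<in> {-1<..<1}" using I by auto
    have "norm (\<phi> z - \<phi> w) \<le> norm (\<Phi> (snd z) (fst z) - \<Phi> (snd z) (fst w)) + norm (\<Phi> (snd z) (fst w) - \<Phi> (snd w) (fst w))"
      unfolding \<phi>_def
      using norm_triangle_ineq[of "\<Phi> (snd z) (fst z) - \<Phi> (snd z) (fst w)" "\<Phi> (snd z) (fst w) - \<Phi> (snd w) (fst w)"]
      by simp
    also have "\<dots> \<le> M * dist z w + exp (L + 1) * dist z w"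
    proof (rule add_mono)
      have "norm (\<Phi> (snd z) (fst z) - \<Phi> (snd z) (fst w)) \<le> M * dist (fst z) (fst w)"
        using time[OF zw] by (simp add: dist_norm)
      also have "\<dots> \<le> M * dist z w" using M(1) by (intro mult_left_mono dist_fst_le) simp
      finally show "norm (\<Phi> (snd z) (fst z) - \<Phi> (snd z) (fst w)) \<le> M * dist z w" .
      have "norm (\<Phi> (snd z) (fst w) - \<Phi> (snd w) (fst w)) \<le> exp (L + 1) * dist (snd z) (snd w)"
        using space[OF zw(2)] by (simp add: dist_norm)
      also have "\<dots> \<le> exp (L + 1) * dist z w" by (intro mult_left_mono dist_snd_le) simp
      finally show "norm (\<Phi> (snd z) (fst w) - \<Phi> (snd w) (fst w)) \<le> exp (L + 1) * dist z w" .
    qed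
    finally show "dist (\<phi> z) (\<phi> w) \<le> (M + exp (L + 1)) * dist z w" by (simp add: dist_norm algebra_simps)
  qed (use M in \<open>simp add: add_nonneg_nonneg\<close>)
  have P: "open P" "s0 \<in> P" using r(1) by (auto simp: P_def)
  have inS: "\<phi> (t, p) \<in> S" if "t \<in> {-T<..<T}" "p \<in> P" for t p using inB[OF that] r(2) by auto
  have "Ck_on n ({-T<..<T} \<times> P) \<phi>" for n
  proof (rule ode_flow_Ck[OF \<open>open S\<close> Fn P(1) inS cont ode])
    show "Ck_on n P (\<lambda>p. \<phi> (0, p))" for n
      using Ck_on_bounded_linear[OF P(1) bounded_linear_ident] by (simp add: \<phi>_def \<Phi>(1))
  qed
  then have "smooth_on ({-T<..<T} \<times> P) \<phi>" by (simp add: smooth_on_def)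
  with T(1) P inS ode show thesis
    by (intro that[of T P \<phi>]) (auto simp: \<phi>_def \<Phi>(1))
qed

section \<open>Smooth inverses and Taylor coefficients\<close>

lemma smooth_onE:
  fixes f :: "'e::euclidean_space \<Rightarrow> 'f::real_normed_vector"
  assumes "open S" "smooth_on S f"
  obtains f' :: "'e \<Rightarrow> 'e \<Rightarrow>\<^sub>L 'f"
  where "\<And>x. x \<in> S \<Longrightarrow> (f has_derivative blinfun_apply (f' x)) (at x)" "smooth_on S f'"
proof -
  have f: "Ck_on n S f" for n using assms(2) by (simp add: smooth_on_def)
  obtain f' :: "'e \<Rightarrow> 'e \<Rightarrow>\<^sub>L 'f" where f': "\<And>x. x \<in> S \<Longrightarrow> (f has_derivative blinfun_apply (f' x)) (at x)" "Ck_on 0 S f'"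
    using Ck_on_SucE[OF assms(1) f] by blast
  have "Ck_on n S f'" for n
  proof -
    obtain h :: "'e \<Rightarrow> 'e \<Rightarrow>\<^sub>L 'f" where h: "\<And>x. x \<in> S \<Longrightarrow> (f has_derivative blinfun_apply (h x)) (at x)" "Ck_on n S h"
      using Ck_on_SucE[OF assms(1) f] by blast
    have "f' x = h x" if "x \<in> S" for x
      using has_derivative_unique[OF f'(1)[OF that] h(1)[OF that]] by (simp add: blinfun_apply_inject)
    then show ?thesis using h(2) Ck_on_cong[OF assms(1), of f' h n] by simp
  qed
  then show thesis using that[OF f'(1)] by (simp add: smooth_on_def)
qed

text \<open>
  The inverse function theorem gives a continuously differentiable inverse \<open>g\<close> with
  \<open>g' = (f' \<circ> g)\<^sup>-\<^sup>1\<close>. As inversion of operators preserves the degree of differentiability, \<open>g'\<close> is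
  always as smooth as \<open>g\<close>.
\<close>

lemma smooth_inverse_function:
  fixes f :: "'e::euclidean_space \<Rightarrow> 'e"
  assumes "open U" and f: "smooth_on U f" and "x0 \<in> U" and id: "(f has_derivative (\<lambda>h. h)) (at x0)"
  obtains U' V g where "open U'" "U' \<subseteq> U" "x0 \<in> U'" "open V" "f x0 \<in> V" "homeomorphism U' V f g" "smooth_on V g"
proof -
  obtain f' :: "'e \<Rightarrow> 'e \<Rightarrow>\<^sub>L 'e" where f': "\<And>x. x \<in> U \<Longrightarrow> (f has_derivative blinfun_apply (f' x)) (at x)" "smooth_on U f'"
    using smooth_onE[OF \<open>open U\<close> f] by blast
  have f'n: "Ck_on n U f'" for n using f'(2) by (simp add: smooth_on_def)
  have "f' x0 = id_blinfun"
    using has_derivative_unique[OF f'(1)[OF \<open>x0 \<in> U\<close>] id] by (intro blinfun_eqI) simp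
  then have i: "id_blinfun o\<^sub>L f' x0 = id_blinfun" by (intro blinfun_eqI) simp
  obtain U' V g g' where g: "open U'" "U' \<subseteq> U" "x0 \<in> U'" "open V" "f x0 \<in> V" "homeomorphism U' V f g"
    and g': "\<And>y. y \<in> V \<Longrightarrow> (g has_derivative (g' y)) (at y)"
      "\<And>y. y \<in> V \<Longrightarrow> g' y = inv (blinfun_apply (f' (g y)))"
      "\<And>y. y \<in> V \<Longrightarrow> bij (blinfun_apply (f' (g y)))"
    using inverse_function_theorem[OF \<open>open U\<close> f'(1) Ck_on_imp_continuous_on[OF f'n] \<open>x0 \<in> U\<close> i] by metis
  have gV: "g ` V \<subseteq> U" using g(2,6) by (auto simp: homeomorphism_def)
  define C where "C y = Blinfun (g' y)" for y
  have C: "blinfun_apply (C y) = g' y" if "y \<in> V" for y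
    unfolding C_def by (rule bounded_linear_Blinfun_apply[OF has_derivative_bounded_linear[OF g'(1)[OF that]]])
  have "Ck_on n V g" for n
  proof (induction n)
    case 0
    then show ?case using g(6) by (simp add: homeomorphism_def)
  next
    case (Suc n)
    have A: "Ck_on n V (\<lambda>y. f' (g y))" by (rule Ck_on_compose[OF g(4) \<open>open U\<close> gV Suc.IH f'n])
    have "Ck_on n V C"
    proof (rule Ck_on_blinfun_inverse[OF g(4) A])
      fix y assume y: "y \<in> V"
      have b: "bij (blinfun_apply (f' (g y)))" by (rule g'(3)[OF y])
      show "C y o\<^sub>L f' (g y) = id_blinfun"
        using b by (intro blinfun_eqI) (simp add: C[OF y] g'(2)[OF y] bij_is_inj)
      show "f' (g y) o\<^sub>L C y = id_blinfun"
        using b by (intro blinfun_eqI) (simp add: C[OF y] g'(2)[OF y] bij_is_surj surj_f_inv_f)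
    qed
    then show ?case
      using g'(1) C by (intro Ck_on_SucI[where f' = "\<lambda>y. blinfun_apply (C y)"] Ck_on_blinfun_apply Ck_on_const g(4)) simp_all
  qed
  then show thesis using that[OF g] by (simp add: smooth_on_def)
qed

lemma has_vector_derivative_near_cong:
  assumes "\<forall>\<^sub>F s in nhds t. f s = g s" "(g has_vector_derivative v) (at t)"
  shows "(f has_vector_derivative v) (at t)"
proof -
  have "f t = g t" using assms(1) by (rule eventually_nhds_x_imp_x)
  moreover have "\<forall>\<^sub>F s in nhds t. s \<in> UNIV \<longrightarrow> f s = g s" using assms(1) by simp
  ultimately show ?thesis using has_vector_derivative_cong_ev assms(2) by blast
qed

lemma constant_on_interval:
  fixes f :: "real \<Rightarrow> 'v::real_normed_vector"
  assumes "\<And>t. t \<in> {-T<..<T} \<Longrightarrow> (f has_vector_derivative 0) (at t)" "s \<in> {-T<..<T}" "t \<in> {-T<..<T}"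
  shows "f s = f t"
proof -
  have "\<exists>c. \<forall>x\<in>{-T<..<T}. f x = c"
    using assms(1) by (intro has_derivative_zero_constant)
      (auto simp: has_vector_derivative_def intro: has_derivative_at_withinI)
  with assms show ?thesis by auto
qed

lemma smooth_on_continuous_on: "smooth_on S f \<Longrightarrow> continuous_on S f"
  using Ck_on_imp_continuous_on by (auto simp: smooth_on_def)

lemma smooth_on_has_derivative:
  "smooth_on S f \<Longrightarrow> x \<in> S \<Longrightarrow> (f has_derivative frechet_derivative f (at x)) (at x)"
  by (rule Ck_on_SucD[of 0]) (simp_all only: smooth_on_def)

lemma smooth_on_compose:
  fixes f :: "'e::real_normed_vector \<Rightarrow> 'f::euclidean_space" and g :: "'f \<Rightarrow> 'g::real_normed_vector"
  assumes "open S" "open T" "f ` S \<subseteq> T" "smooth_on S f" "smooth_on T g"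
  shows "smooth_on S (\<lambda>x. g (f x))"
  unfolding smooth_on_def
proof
  show "Ck_on n S (\<lambda>x. g (f x))" for n
    using Ck_on_compose[OF assms(1-3), of n g] assms(4,5) by (simp add: smooth_on_def)
qed

lemma smooth_on_subset: "smooth_on S f \<Longrightarrow> T \<subseteq> S \<Longrightarrow> smooth_on T f"
  unfolding smooth_on_def using Ck_on_subset by blast

text \<open>
  The coefficients are \<open>G b x = \<integral>\<^sub>0\<^sup>1 \<partial>\<^sub>b F (x0 + t (x - x0)) dt\<close>, by integrating the derivative of
  \<open>F\<close> along segments. They are smooth because such an integral is the value at time 1 of the solution
  of a differential equation with the parameter \<open>x\<close>.
\<close>

lemma hadamard:
  fixes F :: "'e::euclidean_space \<Rightarrow> real"
  assumes "0 < r" and F: "smooth_on (ball x0 r) F"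
  obtains G :: "'e \<Rightarrow> 'e \<Rightarrow> real" where "\<And>b. b \<in> Basis \<Longrightarrow> smooth_on (ball x0 (r / 2)) (G b)"
    "\<And>x. x \<in> ball x0 (r / 2) \<Longrightarrow> F x = F x0 + (\<Sum>b\<in>Basis. ((x - x0) \<bullet> b) * G b x)"
    "\<And>b. b \<in> Basis \<Longrightarrow> G b x0 = frechet_derivative F (at x0) b"
proof -
  \<comment> \<open>Time 1 is interior to the time interval, and for \<open>\<bar>t\<bar> \<le> 3/2\<close> the segments stay in the larger ball.\<close>
  let ?T = "3 / 2 :: real" and ?B = "ball x0 (r / 2)"
  let ?I = "{-?T<..<?T}"
  define \<beta> where "\<beta> b z = frechet_derivative F (at (x0 + fst z *\<^sub>R (snd z - x0))) b" for b and z :: "real \<times> 'e"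
  have inB: "x0 + t *\<^sub>R (x - x0) \<in> ball x0 r" if "t \<in> {-?T..?T}" "x \<in> ?B" for t x
  proof -
    have "\<bar>t\<bar> * norm (x - x0) \<le> 2 * norm (x - x0)" using that(1) by (intro mult_right_mono) auto
    also have "\<dots> < r" using that(2) by (simp add: dist_norm norm_minus_commute)
    finally show ?thesis by (simp add: dist_norm)
  qed
  have oIB: "open (?I \<times> ?B)" by (simp add: open_Times)
  have F'n: "Ck_on n (ball x0 r) (\<lambda>x. frechet_derivative F (at x) b)" for n b
    using F Ck_on.simps(2) unfolding smooth_on_def by metis
  have \<beta>n: "Ck_on n (?I \<times> ?B) (\<beta> b)" for n b
    unfolding \<beta>_def
  proof (rule Ck_on_compose[OF oIB _ _ _ F'n])
    show "(\<lambda>z. x0 + fst z *\<^sub>R (snd z - x0)) ` (?I \<times> ?B) \<subseteq> ball x0 r" using inB by fastforce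
    show "Ck_on n (?I \<times> ?B) (\<lambda>z. x0 + fst z *\<^sub>R (snd z - x0))"
      by (intro Ck_on_add Ck_on_scaleR Ck_on_diff Ck_on_const oIB Ck_on_bounded_linear[OF oIB bounded_linear_fst]
          Ck_on_bounded_linear[OF oIB bounded_linear_snd])
  qed simp
  have "\<exists>\<psi>. \<psi> 0 = 0 \<and> (\<forall>t\<in>?I. (\<psi> has_vector_derivative \<beta> b (t, x)) (at t))" if x: "x \<in> ?B" for b x
  proof -
    have c: "continuous_on {-?T..?T} (\<lambda>t. \<beta> b (t, x))"
      unfolding \<beta>_def
      by (rule continuous_on_compose2[OF Ck_on_imp_continuous_on[OF F'n[of 0]]])
        (use inB[OF _ x] in \<open>auto intro!: continuous_intros\<close>)
    have "continuous_on ({-?T..?T} \<times> UNIV) (\<lambda>(t, y::real). \<beta> b (t, x))"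
      unfolding case_prod_beta' by (rule continuous_on_compose2[OF c]) (auto intro!: continuous_intros)
    then show ?thesis
      by (rule ode_exists[of ?T "\<lambda>t y. \<beta> b (t, x)" 0 0, rotated]) auto
  qed
  then have "\<forall>b x. \<exists>\<psi>. x \<in> ?B \<longrightarrow> \<psi> 0 = 0 \<and> (\<forall>t\<in>?I. (\<psi> has_vector_derivative \<beta> b (t, x)) (at t))" by blast
  then obtain \<Psi> where "\<forall>b x. x \<in> ?B \<longrightarrow> \<Psi> b x 0 = 0 \<and> (\<forall>t\<in>?I. (\<Psi> b x has_vector_derivative \<beta> b (t, x)) (at t))"
    unfolding choice_iff by blast
  then have \<Psi>: "\<And>b x. x \<in> ?B \<Longrightarrow> \<Psi> b x 0 = 0"
    "\<And>b x t. x \<in> ?B \<Longrightarrow> t \<in> ?I \<Longrightarrow> (\<Psi> b x has_vector_derivative \<beta> b (t, x)) (at t)" by blast+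
  \<comment> \<open>An integral with parameters solves a linear equation without homogeneous part.\<close>
  have \<psi>n: "Ck_on n (?I \<times> ?B) (\<lambda>z. \<Psi> b (snd z) (fst z))" for n b
  proof (rule linear_ode_Ck[where A = "\<lambda>z. 0" and b = "\<beta> b"])
    show "Ck_on n ?B (\<lambda>p. \<Psi> b (snd (0, p)) (fst (0, p)))"
      using Ck_on_cong[of ?B "\<lambda>p. \<Psi> b p 0" "\<lambda>p. 0" n] \<Psi>(1) by simp
  qed (use \<beta>n oIB \<Psi>(2) in auto)
  have F': "(F has_derivative frechet_derivative F (at x)) (at x)" if "x \<in> ball x0 r" for x
    by (rule smooth_on_has_derivative[OF F that])
  show thesis
  proof (rule that[of "\<lambda>b x. \<Psi> b x 1"])
    show "smooth_on ?B (\<lambda>x. \<Psi> b x 1)" for b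
      unfolding smooth_on_def
    proof
      fix n
      have "Ck_on n ?B (\<lambda>x. (1::real, x))" by (intro Ck_on_Pair Ck_on_const Ck_on_bounded_linear bounded_linear_ident) simp_all
      from Ck_on_compose[OF open_ball oIB _ this \<psi>n, of b] show "Ck_on n ?B (\<lambda>x. \<Psi> b x 1)"
        by (simp add: image_subset_iff)
    qed
  next
    fix x assume x: "x \<in> ?B"
    let ?c = "\<lambda>t. F (x0 + t *\<^sub>R (x - x0)) - (\<Sum>b\<in>Basis. ((x - x0) \<bullet> b) *\<^sub>R \<Psi> b x t)"
    have "?c 1 = ?c 0"
    proof (rule constant_on_interval[of ?T ?c])
      fix t assume t: "t \<in> ?I"
      let ?D = "frechet_derivative F (at (x0 + t *\<^sub>R (x - x0)))"
      have D: "(F has_derivative ?D) (at (x0 + t *\<^sub>R (x - x0)))" using F' inB x t by auto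
      have "((\<lambda>t. x0 + t *\<^sub>R (x - x0)) has_vector_derivative x - x0) (at t)"
        by (auto simp: has_vector_derivative_def intro!: derivative_eq_intros)
      from has_vector_derivative_along_curve[OF D this]
      have 1: "((\<lambda>t. F (x0 + t *\<^sub>R (x - x0))) has_vector_derivative ?D (x - x0)) (at t)" .
      have 2: "((\<lambda>t. \<Sum>b\<in>Basis. ((x - x0) \<bullet> b) *\<^sub>R \<Psi> b x t) has_vector_derivative (\<Sum>b\<in>Basis. ((x - x0) \<bullet> b) *\<^sub>R \<beta> b (t, x))) (at t)"
        by (intro has_vector_derivative_sum bounded_linear.has_vector_derivative[OF bounded_linear_scaleR_right] \<Psi>(2) x t)
      have "?D (x - x0) = ?D (\<Sum>b\<in>Basis. ((x - x0) \<bullet> b) *\<^sub>R b)" by (simp only: euclidean_representation)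
      also have "\<dots> = (\<Sum>b\<in>Basis. ((x - x0) \<bullet> b) *\<^sub>R \<beta> b (t, x))"
        by (simp add: linear_sum[OF has_derivative_linear[OF D]] linear_scale[OF has_derivative_linear[OF D]] \<beta>_def)
      finally show "(?c has_vector_derivative 0) (at t)"
        using has_vector_derivative_diff[OF 1 2] by simp
    qed auto
    then show "F x = F x0 + (\<Sum>b\<in>Basis. ((x - x0) \<bullet> b) * \<Psi> b x 1)" using \<Psi>(1)[OF x] by simp
  next
    fix b :: 'e
    have x0: "x0 \<in> ?B" using \<open>0 < r\<close> by simp
    let ?c = "\<lambda>t. \<Psi> b x0 t - t *\<^sub>R frechet_derivative F (at x0) b"
    have "?c 1 = ?c 0"
    proof (rule constant_on_interval[of ?T ?c])
      fix t assume t: "t \<in> ?I"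
      have "((\<lambda>t. t *\<^sub>R frechet_derivative F (at x0) b) has_vector_derivative frechet_derivative F (at x0) b) (at t)"
        by (auto simp: has_vector_derivative_def intro!: derivative_eq_intros)
      from has_vector_derivative_diff[OF \<Psi>(2)[OF x0 t, of b] this]
      show "(?c has_vector_derivative 0) (at t)" by (simp add: \<beta>_def)
    qed auto
    then show "\<Psi> b x0 1 = frechet_derivative F (at x0) b" using \<Psi>(1)[OF x0] by simp
  qed
qed

section \<open>Quasilinear equations of first order\<close>

text \<open>
  The method of characteristics for \<open>V(x, u) \<cdot> \<partial>u = G(x, u)\<close>. A solution of
  \<open>(x, u)' = (V (x, u), G (x, u))\<close> prescribes the values of the unknown function along the curve \<open>x\<close>.
  Start these solutions with the constant value \<open>u0\<close> on the hyperplane through \<open>y0\<close> orthogonal to \<open>e = V (y0, u0)\<close>. Let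
  \<open>f\<close> send a point \<open>foot + t e\<close> to the position at time \<open>t\<close> of the solution that starts in \<open>foot\<close>. Its
  derivative at \<open>y0\<close> is the identity, as it fixes the hyperplane and maps \<open>e\<close> to the initial velocity
  \<open>e\<close>. So \<open>f\<close> has a smooth local inverse, and \<open>u\<close> is the second component of the solutions composed with
  that inverse. Functions \<open>Q\<close> whose derivative annihilates \<open>G\<close> are constant along characteristics.
\<close>

theorem quasilinear_first_order:
  fixes V :: "'e::euclidean_space \<times> 'u::euclidean_space \<Rightarrow> 'e" and G :: "'e \<times> 'u \<Rightarrow> 'u" and Q :: "'u \<Rightarrow> real"
  assumes "open U" and V: "smooth_on (U \<times> UNIV) V" and G: "smooth_on (U \<times> UNIV) G"
    and "y0 \<in> U" and nz: "V (y0, u0) \<noteq> 0"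
    and Q: "\<And>u. (Q has_derivative Q' u) (at u)" "\<And>x u. x \<in> U \<Longrightarrow> Q' u (G (x, u)) = 0"
  obtains N u where "open N" "y0 \<in> N" "N \<subseteq> U" "smooth_on N u" "u y0 = u0"
    "\<And>x. x \<in> N \<Longrightarrow> frechet_derivative u (at x) (V (x, u x)) = G (x, u x)"
    "\<And>x. x \<in> N \<Longrightarrow> Q (u x) = Q u0"
proof -
  let ?S = "U \<times> (UNIV :: 'u set)"
  have S: "open ?S" using \<open>open U\<close> by (simp add: open_Times)
  define F where "F z = (V z, G z)" for z
  have sF: "smooth_on ?S F" using V G S unfolding smooth_on_def F_def by (intro allI Ck_on_Pair) blast+
  have s0: "(y0, u0) \<in> ?S" using \<open>y0 \<in> U\<close> by simp
  obtain T P and \<phi> :: "real \<times> 'e \<times> 'u \<Rightarrow> 'e \<times> 'u" where T: "0 < T" and P: "open P" "(y0, u0) \<in> P"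
    and inS: "\<And>t p. t \<in> {-T<..<T} \<Longrightarrow> p \<in> P \<Longrightarrow> \<phi> (t, p) \<in> ?S"
    and ode: "\<And>t p. t \<in> {-T<..<T} \<Longrightarrow> p \<in> P \<Longrightarrow> ((\<lambda>s. \<phi> (s, p)) has_vector_derivative F (\<phi> (t, p))) (at t)"
    and init: "\<And>p. p \<in> P \<Longrightarrow> \<phi> (0, p) = p"
    and smooth: "smooth_on ({-T<..<T} \<times> P) \<phi>"
    using smooth_local_flow[OF S sF s0] by blast
  let ?IP = "{-T<..<T} \<times> P"
  have oIP: "open ?IP" using P(1) by (simp add: open_Times)
  define e where "e = V (y0, u0)"
  have e: "e \<bullet> e \<noteq> 0" using nz by (simp add: e_def)
  \<comment> \<open>Every point is \<open>foot z + tm z *\<^sub>R e\<close> with its foot on the hyperplane through \<open>y0\<close> orthogonal to \<open>e\<close>.\<close>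
  define tm where "tm z = ((z - y0) \<bullet> e) / (e \<bullet> e)" for z
  define foot where "foot z = z - tm z *\<^sub>R e" for z
  define \<kappa> where "\<kappa> z = (tm z, (foot z, u0))" for z
  have tm: "tm (z + s *\<^sub>R v) = tm z + s * ((v \<bullet> e) / (e \<bullet> e))" for z s v
    by (simp add: tm_def inner_diff_left inner_add_left add_divide_distrib diff_divide_distrib)
  have \<kappa>line: "\<kappa> (z + s *\<^sub>R e) = (tm z + s, (foot z, u0))" for z s
    using e by (simp add: \<kappa>_def foot_def tm algebra_simps)
  have \<kappa>0: "\<kappa> y0 = (0, (y0, u0))" by (simp add: \<kappa>_def foot_def tm_def)
  have \<kappa>smooth: "smooth_on A \<kappa>" if "open A" for A
  proof -
    have 1: "Ck_on n A tm" for n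
      unfolding tm_def divide_inverse
      by (intro Ck_on_mult Ck_on_inner_left Ck_on_diff Ck_on_const that Ck_on_bounded_linear[OF that bounded_linear_ident])
    have "Ck_on n A foot" for n
      unfolding foot_def
      by (intro Ck_on_diff Ck_on_scaleR Ck_on_const that 1 Ck_on_bounded_linear[OF that bounded_linear_ident])
    with 1 show ?thesis
      unfolding smooth_on_def \<kappa>_def by (intro allI Ck_on_Pair Ck_on_const that)
  qed
  define D where "D = \<kappa> -` ?IP"
  have D: "open D"
    unfolding D_def using smooth_on_continuous_on[OF \<kappa>smooth[OF open_UNIV]] oIP
    by (simp add: continuous_on_open_vimage open_vimage)
  have y0D: "y0 \<in> D" using T P(2) by (simp add: D_def \<kappa>0)
  have \<phi>\<kappa>: "smooth_on D (\<lambda>z. \<phi> (\<kappa> z))"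
    by (rule smooth_on_compose[OF D oIP _ \<kappa>smooth[OF D] smooth]) (auto simp: D_def)
  define f where "f z = fst (\<phi> (\<kappa> z))" for z
  define w where "w z = snd (\<phi> (\<kappa> z))" for z
  have f: "smooth_on D f" and w: "smooth_on D w"
    using \<phi>\<kappa> D unfolding f_def w_def smooth_on_def
    by (auto intro: Ck_on_linear_comp bounded_linear_fst bounded_linear_snd)
  have fU: "f z \<in> U" if "z \<in> D" for z
    using inS[of "fst (\<kappa> z)" "snd (\<kappa> z)"] that by (auto simp: D_def f_def mem_Times_iff)
  have line: "((\<lambda>s. \<phi> (\<kappa> (z + s *\<^sub>R e))) has_vector_derivative F (\<phi> (\<kappa> z))) (at 0)" if "z \<in> D" for z
  proof -
    have d: "((\<lambda>s. \<phi> (s, foot z, u0)) has_derivative (\<lambda>h. h *\<^sub>R F (\<phi> (\<kappa> z)))) (at (tm z + 0))"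
      using ode[of "tm z" "(foot z, u0)"] that by (simp add: D_def \<kappa>_def has_vector_derivative_def)
    have sh: "((\<lambda>s. tm z + s) has_derivative (\<lambda>h. h)) (at 0)"
      by (auto intro!: derivative_eq_intros)
    show ?thesis
      unfolding \<kappa>line has_vector_derivative_def
      using has_derivative_compose[where f = "\<lambda>s. tm z + s" and g = "\<lambda>s. \<phi> (s, foot z, u0)", OF sh d] .
  qed
  have shift: "((\<lambda>s. z + s *\<^sub>R v) has_vector_derivative v) (at 0)" for z v :: 'e
    by (auto simp: has_vector_derivative_def intro!: derivative_eq_intros)
  have stay: "\<forall>\<^sub>F s in nhds 0. z + s *\<^sub>R v \<in> A" if "open A" "z \<in> A" for z v :: 'e and A
  proof -
    have "isCont (\<lambda>s::real. z + s *\<^sub>R v) 0" by (intro continuous_intros)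
    then have "((\<lambda>s::real. z + s *\<^sub>R v) \<longlongrightarrow> z) (nhds 0)"
      by (simp add: isCont_def tendsto_nhds_iff)
    then show ?thesis using topological_tendstoD that by blast
  qed
  have fy0: "f y0 = y0" using init[OF P(2)] by (simp add: f_def \<kappa>0)
  have "(f has_derivative (\<lambda>h. h)) (at y0)"
  proof -
    let ?f' = "frechet_derivative f (at y0)"
    have f': "(f has_derivative ?f') (at y0)" by (rule smooth_on_has_derivative[OF f y0D])
    have f'line: "((\<lambda>s. f (y0 + s *\<^sub>R v)) has_vector_derivative ?f' v) (at 0)" for v
      by (rule has_vector_derivative_along_curve[OF _ shift]) (use f' in simp)
    have "((\<lambda>s. f (y0 + s *\<^sub>R e)) has_vector_derivative fst (F (\<phi> (\<kappa> y0)))) (at 0)"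
      unfolding f_def by (rule bounded_linear.has_vector_derivative[OF bounded_linear_fst line[OF y0D]])
    then have fe: "?f' e = e"
      using vector_derivative_unique_at[OF f'line] by (simp add: F_def \<kappa>0 init[OF P(2)] e_def)
    have fk: "?f' k = k" if k: "k \<bullet> e = 0" for k
    proof -
      have \<kappa>k: "\<kappa> (y0 + s *\<^sub>R k) = (0, (y0 + s *\<^sub>R k, u0))" for s
        by (simp add: \<kappa>_def foot_def tm_def k)
      have "\<forall>\<^sub>F s in nhds 0. y0 + s *\<^sub>R k \<in> D" by (rule stay[OF D y0D])
      then have "\<forall>\<^sub>F s in nhds 0. f (y0 + s *\<^sub>R k) = y0 + s *\<^sub>R k"
        by eventually_elim (simp add: f_def D_def \<kappa>k init)
      then have "((\<lambda>s. f (y0 + s *\<^sub>R k)) has_vector_derivative k) (at 0)"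
        using shift by (rule has_vector_derivative_near_cong)
      then show ?thesis using vector_derivative_unique_at[OF f'line] by blast
    qed
    have "?f' h = h" for h
    proof -
      define a where "a = (h \<bullet> e) / (e \<bullet> e)"
      define k where "k = h - a *\<^sub>R e"
      have "k \<bullet> e = 0" using e by (simp add: k_def a_def inner_diff_left)
      then have "?f' (a *\<^sub>R e + k) = a *\<^sub>R e + k"
        using fe fk linear_add[OF has_derivative_linear[OF f']] linear_scale[OF has_derivative_linear[OF f']] by simp
      then show ?thesis by (simp add: k_def)
    qed
    then have "?f' = (\<lambda>h. h)" by (rule ext)
    with f' show ?thesis by simp
  qed
  then obtain U' N g where U': "open U'" "U' \<subseteq> D" "y0 \<in> U'" and N: "open N" "f y0 \<in> N"
    and hom: "homeomorphism U' N f g" and g: "smooth_on N g"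
    using smooth_inverse_function[OF D f y0D] by blast
  have gU': "g x \<in> U'" "f (g x) = x" if "x \<in> N" for x
    using hom that by (auto simp: homeomorphism_def)
  have gf: "g (f z) = z" "f z \<in> N" if "z \<in> U'" for z using hom that by (auto simp: homeomorphism_def)
  define u where "u x = w (g x)" for x
  have u: "smooth_on N u"
    unfolding u_def by (rule smooth_on_compose[OF N(1) D _ g w]) (use gU' U'(2) in auto)
  show thesis
  proof (rule that[of N u])
    show "open N" by (rule N)
    show "y0 \<in> N" using N(2) by (simp add: fy0)
    show "N \<subseteq> U" using fU gU' U'(2) by (metis subsetD subsetI)
    show "smooth_on N u" by (rule u)
    have "g y0 = y0" using gf(1)[OF U'(3)] by (simp add: fy0)
    then show "u y0 = u0" by (simp add: u_def w_def \<kappa>0 init[OF P(2)])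
  next
    fix x assume x: "x \<in> N"
    define z where "z = g x"
    have z: "z \<in> U'" "z \<in> D" "f z = x" using gU'[OF x] U'(2) by (auto simp: z_def)
    have \<phi>z: "\<phi> (\<kappa> z) = (x, u x)" using z(3) by (simp add: f_def u_def w_def z_def[symmetric] prod_eq_iff)
    have "((\<lambda>s. f (z + s *\<^sub>R e)) has_vector_derivative fst (F (\<phi> (\<kappa> z)))) (at 0)"
      unfolding f_def by (rule bounded_linear.has_vector_derivative[OF bounded_linear_fst line[OF z(2)]])
    then have "((\<lambda>s. f (z + s *\<^sub>R e)) has_vector_derivative V (x, u x)) (at 0)"
      by (simp add: F_def \<phi>z)
    from has_vector_derivative_along_curve[OF _ this, of u "frechet_derivative u (at x)"]
    have 1: "((\<lambda>s. u (f (z + s *\<^sub>R e))) has_vector_derivative frechet_derivative u (at x) (V (x, u x))) (at 0)"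
      using smooth_on_has_derivative[OF u x] z(3) by simp
    have "((\<lambda>s. w (z + s *\<^sub>R e)) has_vector_derivative snd (F (\<phi> (\<kappa> z)))) (at 0)"
      unfolding w_def by (rule bounded_linear.has_vector_derivative[OF bounded_linear_snd line[OF z(2)]])
    then have 2: "((\<lambda>s. w (z + s *\<^sub>R e)) has_vector_derivative G (x, u x)) (at 0)"
      by (simp add: F_def \<phi>z)
    have "\<forall>\<^sub>F s in nhds 0. z + s *\<^sub>R e \<in> U'" by (rule stay[OF U'(1) z(1)])
    then have "\<forall>\<^sub>F s in nhds 0. u (f (z + s *\<^sub>R e)) = w (z + s *\<^sub>R e)"
      by eventually_elim (simp add: u_def gf)
    then have "((\<lambda>s. u (f (z + s *\<^sub>R e))) has_vector_derivative G (x, u x)) (at 0)"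
      using 2 by (rule has_vector_derivative_near_cong)
    with 1 show "frechet_derivative u (at x) (V (x, u x)) = G (x, u x)"
      by (rule vector_derivative_unique_at)
    let ?c = "\<lambda>s. Q (snd (\<phi> (s, snd (\<kappa> z))))"
    have \<kappa>z: "fst (\<kappa> z) \<in> {-T<..<T}" "snd (\<kappa> z) \<in> P" using z(2) by (auto simp: D_def mem_Times_iff)
    have "?c (fst (\<kappa> z)) = ?c 0"
    proof (rule constant_on_interval[of T ?c])
      fix t assume t: "t \<in> {-T<..<T}"
      let ?p = "\<phi> (t, snd (\<kappa> z))"
      have "((\<lambda>s. snd (\<phi> (s, snd (\<kappa> z)))) has_vector_derivative snd (F ?p)) (at t)"
        by (rule bounded_linear.has_vector_derivative[OF bounded_linear_snd ode[OF t \<kappa>z(2)]])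
      from has_vector_derivative_along_curve[OF Q(1) this]
      have "(?c has_vector_derivative Q' (snd ?p) (snd (F ?p))) (at t)" .
      moreover have "Q' (snd ?p) (snd (F ?p)) = 0"
        using Q(2)[of "fst ?p" "snd ?p"] inS[OF t \<kappa>z(2)] by (simp add: F_def mem_Times_iff)
      ultimately show "(?c has_vector_derivative 0) (at t)" by simp
    qed (use \<kappa>z T in auto)
    moreover have "?c (fst (\<kappa> z)) = Q (u x)" using \<phi>z by simp
    moreover have "?c 0 = Q u0" using init[OF \<kappa>z(2)] by (simp add: \<kappa>_def)
    ultimately show "Q (u x) = Q u0" by simp
  qed
qed

section \<open>Charts and smooth functions\<close>

lemma chart_is_chart: "smooth_manifold M \<Longrightarrow> c \<in> atlas M \<Longrightarrow> is_chart M c"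
  by (simp add: smooth_manifold_def)

lemma chart_openin: "smooth_manifold M \<Longrightarrow> c \<in> atlas M \<Longrightarrow> openin (mtop M) (fst c)"
  using chart_is_chart[of M c] by (simp add: is_chart_def)

lemma chart_subset: "smooth_manifold M \<Longrightarrow> c \<in> atlas M \<Longrightarrow> fst c \<subseteq> carrier M"
  by (rule openin_subset[OF chart_openin])

lemma chart_topspace:
  "smooth_manifold M \<Longrightarrow> c \<in> atlas M \<Longrightarrow> topspace (subtopology (mtop M) (fst c)) = fst c"
  using chart_subset[of M c] by (simp add: Int_absorb1)

lemma chart_homeo:
  assumes "smooth_manifold M" "c \<in> atlas M"
  shows "homeomorphic_map (subtopology (mtop M) (fst c)) (top_of_set (snd c ` fst c)) (snd c)"
    and "open (snd c ` fst c)"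
  using chart_is_chart[OF assms] by (auto simp: is_chart_def)

lemma chart_inv_left:
  assumes "smooth_manifold M" "c \<in> atlas M" "p \<in> fst c"
  shows "chart_inv c (snd c p) = p"
  using homeomorphic_imp_injective_map[OF chart_homeo(1)[OF assms(1,2)]] assms(3)
  unfolding chart_topspace[OF assms(1,2)] chart_inv_def by (rule inv_into_f_f)

lemma chart_inv_right:
  assumes "x \<in> snd c ` W" "W \<subseteq> fst c"
  shows "snd c (chart_inv c x) = x" "chart_inv c x \<in> fst c"
  using assms unfolding chart_inv_def by (meson f_inv_into_f image_mono inv_into_into subsetD)+

lemma chart_inv_image:
  assumes "smooth_manifold M" "c \<in> atlas M" "x \<in> snd c ` W" "W \<subseteq> fst c"
  shows "chart_inv c x \<in> W"
proof -
  obtain p where "p \<in> W" "x = snd c p" using assms(3) by blast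
  then show ?thesis using chart_inv_left[OF assms(1,2), of p] assms(4) by auto
qed

lemma chart_open_image:
  assumes "smooth_manifold M" "c \<in> atlas M" "openin (mtop M) W"
  shows "open (snd c ` (fst c \<inter> W))"
proof -
  have o: "openin (subtopology (mtop M) (fst c)) (fst c \<inter> W)"
    using assms(3) by (simp add: openin_subtopology_Int2)
  have s: "fst c \<inter> W \<subseteq> topspace (subtopology (mtop M) (fst c))"
    unfolding chart_topspace[OF assms(1,2)] by simp
  have "openin (top_of_set (snd c ` fst c)) (snd c ` (fst c \<inter> W))"
    using homeomorphic_map_openness[OF chart_homeo(1)[OF assms(1,2)] s] o by simp
  then show ?thesis using chart_homeo(2)[OF assms(1,2)] openin_open_trans by blast
qed

lemma chart_open_image':
  assumes "smooth_manifold M" "c \<in> atlas M" "openin (mtop M) W" "W \<subseteq> fst c"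
  shows "open (snd c ` W)"
  using chart_open_image[OF assms(1-3)] assms(4) by (simp add: Int_absorb1)

lemma chart_open_preimage:
  assumes "smooth_manifold M" "c \<in> atlas M" "open A"
  shows "openin (mtop M) {p \<in> fst c. snd c p \<in> A}"
proof -
  have "continuous_map (subtopology (mtop M) (fst c)) (top_of_set (snd c ` fst c)) (snd c)"
    by (rule homeomorphic_imp_continuous_map[OF chart_homeo(1)[OF assms(1,2)]])
  then have "continuous_map (subtopology (mtop M) (fst c)) euclidean (snd c)"
    by (simp add: continuous_map_in_subtopology)
  from openin_continuous_map_preimage[OF this, of A]
  have "openin (subtopology (mtop M) (fst c)) {p \<in> fst c. snd c p \<in> A}"
    unfolding chart_topspace[OF assms(1,2)] using assms(3) by simp
  then show ?thesis
    using openin_trans_full chart_openin[OF assms(1,2)] by blast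
qed

lemma atlas_transition:
  assumes "smooth_manifold M" "c \<in> atlas M" "d \<in> atlas M"
  shows "smooth_on (snd c ` (fst c \<inter> fst d)) (\<lambda>x. snd d (chart_inv c x))"
  using assms by (simp add: smooth_manifold_def smooth_transition_def o_def)

text \<open>
  Inside the domain of one chart of the atlas, that chart alone decides smoothness, because the
  transition maps are smooth.
\<close>

lemma smooth_fun_iff_chart:
  assumes M: "smooth_manifold M" and c: "c \<in> atlas M" and W: "openin (mtop M) W" "W \<subseteq> fst c"
  shows "smooth_fun M W f \<longleftrightarrow> smooth_on (snd c ` W) (\<lambda>x. f (chart_inv c x))"
proof
  assume "smooth_fun M W f"
  with c have "smooth_on (snd c ` (fst c \<inter> W)) (f \<circ> chart_inv c)" by (simp add: smooth_fun_def)
  then show "smooth_on (snd c ` W) (\<lambda>x. f (chart_inv c x))"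
    using W(2) by (simp add: Int_absorb1 o_def)
next
  assume f: "smooth_on (snd c ` W) (\<lambda>x. f (chart_inv c x))"
  show "smooth_fun M W f"
    unfolding smooth_fun_def
  proof
    fix d assume d: "d \<in> atlas M"
    let ?A = "snd d ` (fst d \<inter> W)"
    have A: "open ?A" by (rule chart_open_image[OF M d W(1)])
    have "smooth_on ?A (\<lambda>x. snd c (chart_inv d x))"
      by (rule smooth_on_subset[OF atlas_transition[OF M d c]]) (use W(2) in auto)
    moreover have "(\<lambda>x. snd c (chart_inv d x)) ` ?A \<subseteq> snd c ` W"
      using chart_inv_left[OF M d] by auto
    ultimately have "smooth_on ?A (\<lambda>x. f (chart_inv c (snd c (chart_inv d x))))"
      using smooth_on_compose[OF A chart_open_image'[OF M c W] _ _ f] by blast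
    moreover have "f (chart_inv c (snd c (chart_inv d x))) = (f \<circ> chart_inv d) x" if "x \<in> ?A" for x
      using that chart_inv_left[OF M d] chart_inv_left[OF M c] W(2) by auto
    ultimately show "smooth_on ?A (f \<circ> chart_inv d)"
      using Ck_on_cong[OF A, of "\<lambda>x. f (chart_inv c (snd c (chart_inv d x)))" "f \<circ> chart_inv d"]
      by (simp add: smooth_on_def)
  qed
qed

lemma smooth_fun_Ck_iff:
  "smooth_fun M W f \<longleftrightarrow> (\<forall>c\<in>atlas M. \<forall>n. Ck_on n (snd c ` (fst c \<inter> W)) (\<lambda>x. f (chart_inv c x)))"
  by (simp add: smooth_fun_def smooth_on_def o_def)

lemma smooth_fun_subset: "smooth_fun M W f \<Longrightarrow> W' \<subseteq> W \<Longrightarrow> smooth_fun M W' f"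
  unfolding smooth_fun_Ck_iff by (meson Ck_on_subset Int_mono image_mono order_refl)

lemma smooth_fun_cong:
  assumes "smooth_manifold M" "openin (mtop M) W" "\<And>p. p \<in> W \<Longrightarrow> f p = g p"
  shows "smooth_fun M W f \<longleftrightarrow> smooth_fun M W g"
proof -
  have "Ck_on n (snd c ` (fst c \<inter> W)) (\<lambda>x. f (chart_inv c x)) =
      Ck_on n (snd c ` (fst c \<inter> W)) (\<lambda>x. g (chart_inv c x))" if "c \<in> atlas M" for c n
    using chart_inv_left[OF assms(1) that] assms(3)
    by (intro Ck_on_cong[OF chart_open_image[OF assms(1) that assms(2)]]) auto
  then show ?thesis by (simp add: smooth_fun_Ck_iff)
qed

context
  fixes M :: "('a, 'e::euclidean_space) mfd" and W :: "'a set"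
  assumes M: "smooth_manifold M" and W: "openin (mtop M) W"
begin

lemma chart_open: "c \<in> atlas M \<Longrightarrow> open (snd c ` (fst c \<inter> W))"
  by (rule chart_open_image[OF M _ W])

lemma smooth_fun_const: "smooth_fun M W (\<lambda>p. r)"
  unfolding smooth_fun_Ck_iff by (intro ballI allI Ck_on_const chart_open)

lemma smooth_fun_add:
  "smooth_fun M W f \<Longrightarrow> smooth_fun M W g \<Longrightarrow> smooth_fun M W (\<lambda>p. f p + g p)"
  unfolding smooth_fun_Ck_iff by (intro ballI allI Ck_on_add chart_open) blast+

lemma smooth_fun_mult:
  "smooth_fun M W f \<Longrightarrow> smooth_fun M W g \<Longrightarrow> smooth_fun M W (\<lambda>p. f p * g p)"
  unfolding smooth_fun_Ck_iff by (intro ballI allI Ck_on_mult chart_open) blast+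

lemma smooth_fun_minus: "smooth_fun M W f \<Longrightarrow> smooth_fun M W (\<lambda>p. - f p)"
  unfolding smooth_fun_Ck_iff by (intro ballI allI Ck_on_minus chart_open) blast+

lemma smooth_fun_inverse_sqrt:
  assumes "smooth_fun M W f" "\<And>p. p \<in> W \<Longrightarrow> 0 < f p"
  shows "smooth_fun M W (\<lambda>p. inverse (sqrt (f p)))"
  unfolding smooth_fun_Ck_iff
proof (intro ballI allI)
  fix c n assume c: "c \<in> atlas M"
  show "Ck_on n (snd c ` (fst c \<inter> W)) (\<lambda>x. inverse (sqrt (f (chart_inv c x))))"
  proof (rule Ck_on_compose[OF chart_open_image[OF M c W] _ _ _ Ck_on_inverse_sqrt])
    show "(\<lambda>x. f (chart_inv c x)) ` (snd c ` (fst c \<inter> W)) \<subseteq> {0<..}"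
      using chart_inv_left[OF M c] assms(2) by auto
    show "Ck_on n (snd c ` (fst c \<inter> W)) (\<lambda>x. f (chart_inv c x))"
      using assms(1) c unfolding smooth_fun_Ck_iff by blast
  qed simp
qed

end

lemma smooth_nearI: "smooth_fun M W f \<Longrightarrow> openin (mtop M) W \<Longrightarrow> p \<in> W \<Longrightarrow> smooth_near M p f"
  unfolding smooth_near_def by blast

lemma smooth_nearE2:
  assumes "smooth_near M p f" "smooth_near M p g"
  obtains W where "openin (mtop M) W" "p \<in> W" "smooth_fun M W f" "smooth_fun M W g"
proof -
  obtain W where W: "openin (mtop M) W" "p \<in> W" "smooth_fun M W f"
    using assms(1) by (auto simp: smooth_near_def)
  obtain W' where W': "openin (mtop M) W'" "p \<in> W'" "smooth_fun M W' g"
    using assms(2) by (auto simp: smooth_near_def)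
  show thesis
  proof (rule that[of "W \<inter> W'"])
    show "openin (mtop M) (W \<inter> W')" using W(1) W'(1) by (rule openin_Int)
    show "smooth_fun M (W \<inter> W') f" by (rule smooth_fun_subset[OF W(3)]) simp
    show "smooth_fun M (W \<inter> W') g" by (rule smooth_fun_subset[OF W'(3)]) simp
  qed (use W W' in simp)
qed

lemma smooth_near_germ:
  assumes M: "smooth_manifold M" and "smooth_near M p f" "openin (mtop M) W" "p \<in> W" "\<And>q. q \<in> W \<Longrightarrow> f q = h q"
  shows "smooth_near M p h"
proof -
  obtain W' where W': "openin (mtop M) W'" "p \<in> W'" "smooth_fun M W' f"
    using assms(2) by (auto simp: smooth_near_def)
  have o: "openin (mtop M) (W \<inter> W')" using assms W' by blast
  have "smooth_fun M (W \<inter> W') f" using W'(3) by (rule smooth_fun_subset) simp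
  then have "smooth_fun M (W \<inter> W') h"
    using smooth_fun_cong[OF M o, of f h] assms(5) by simp
  then show ?thesis by (rule smooth_nearI[OF _ o]) (use assms(4) W'(2) in simp)
qed

lemma smooth_near_const: "smooth_manifold M \<Longrightarrow> p \<in> carrier M \<Longrightarrow> smooth_near M p (\<lambda>q. r)"
  by (rule smooth_nearI[OF smooth_fun_const[OF _ openin_topspace]]) auto

lemma smooth_near_add:
  "smooth_manifold M \<Longrightarrow> smooth_near M p f \<Longrightarrow> smooth_near M p g \<Longrightarrow> smooth_near M p (\<lambda>q. f q + g q)"
  by (erule (1) smooth_nearE2) (rule smooth_nearI[OF smooth_fun_add])

lemma smooth_near_mult:
  "smooth_manifold M \<Longrightarrow> smooth_near M p f \<Longrightarrow> smooth_near M p g \<Longrightarrow> smooth_near M p (\<lambda>q. f q * g q)"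
  by (erule (1) smooth_nearE2) (rule smooth_nearI[OF smooth_fun_mult])

lemma smooth_near_sum:
  assumes "smooth_manifold M" "p \<in> carrier M" "\<And>i. i \<in> J \<Longrightarrow> smooth_near M p (f i)"
  shows "smooth_near M p (\<lambda>q. \<Sum>i\<in>J. f i q)"
  using assms(3)
proof (induction J rule: infinite_finite_induct)
  case (insert i J)
  then show ?case using smooth_near_add[OF assms(1)] by simp
qed (simp_all add: smooth_near_const assms(1,2))

lemma smooth_near_chart_derivative:
  assumes M: "smooth_manifold M" and c: "c \<in> atlas M" "p \<in> fst c" and f: "smooth_near M p f"
  shows "((\<lambda>x. f (chart_inv c x)) has_derivative
    frechet_derivative (\<lambda>x. f (chart_inv c x)) (at (snd c p))) (at (snd c p))"
proof -
  obtain W where W: "openin (mtop M) W" "p \<in> W" "smooth_fun M W f"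
    using f by (auto simp: smooth_near_def)
  have "smooth_on (snd c ` (fst c \<inter> W)) (\<lambda>x. f (chart_inv c x))"
    using W(3) c(1) by (simp add: smooth_fun_def o_def)
  then show ?thesis by (rule smooth_on_has_derivative) (use c W in auto)
qed

section \<open>Tangent vectors\<close>

lemma tangent_add:
  "v \<in> tangent_space M p \<Longrightarrow> smooth_near M p f \<Longrightarrow> smooth_near M p h \<Longrightarrow> v (\<lambda>q. f q + h q) = v f + v h"
  by (simp add: tangent_space_def)

lemma tangent_mult:
  "v \<in> tangent_space M p \<Longrightarrow> smooth_near M p f \<Longrightarrow> smooth_near M p h \<Longrightarrow>
    v (\<lambda>q. f q * h q) = f p * v h + h p * v f"
  by (simp add: tangent_space_def)

lemma tangent_scale:
  "v \<in> tangent_space M p \<Longrightarrow> smooth_near M p f \<Longrightarrow> v (\<lambda>q. r * f q) = r * v f"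
  by (simp add: tangent_space_def)

lemma tangent_germ:
  assumes "v \<in> tangent_space M p" "smooth_near M p f" "openin (mtop M) W" "p \<in> W"
    "\<And>q. q \<in> W \<Longrightarrow> f q = h q"
  shows "v f = v h"
proof -
  have "\<forall>f h W. smooth_near M p f \<and> openin (mtop M) W \<and> p \<in> W \<and> (\<forall>q\<in>W. f q = h q) \<longrightarrow> v f = v h"
    using assms(1) unfolding tangent_space_def mem_Collect_eq by (elim conjE)
  from this[rule_format, of f W h] show ?thesis using assms(2-) by simp
qed

lemma tangent_not_smooth: "v \<in> tangent_space M p \<Longrightarrow> \<not> smooth_near M p f \<Longrightarrow> v f = 0"
  by (simp add: tangent_space_def)

lemma tangent_const:
  assumes "smooth_manifold M" "p \<in> carrier M" "v \<in> tangent_space M p"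
  shows "v (\<lambda>q. r) = 0"
proof -
  have s: "smooth_near M p (\<lambda>q. r)" for r by (rule smooth_near_const[OF assms(1,2)])
  have "v (\<lambda>q. 1 * 1) = 1 * v (\<lambda>q. 1) + 1 * v (\<lambda>q. 1)" by (rule tangent_mult[OF assms(3) s s])
  then have "v (\<lambda>q. 1) = 0" by simp
  then show ?thesis using tangent_scale[OF assms(3) s, of r 1] by simp
qed

lemma tangent_sum:
  assumes "smooth_manifold M" "p \<in> carrier M" "v \<in> tangent_space M p"
    and "\<And>i. i \<in> J \<Longrightarrow> smooth_near M p (f i)"
  shows "v (\<lambda>q. \<Sum>i\<in>J. f i q) = (\<Sum>i\<in>J. v (f i))"
  using assms(4)
proof (induction J rule: infinite_finite_induct)
  case (insert i J)
  then show ?case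
    using tangent_add[OF assms(3), of "f i" "\<lambda>q. \<Sum>i\<in>J. f i q"] smooth_near_sum[OF assms(1,2), of J f] by simp
qed (simp_all add: tangent_const[OF assms(1-3)])

lemma subspace_tangent_space: "subspace (tangent_space M p)"
proof (rule subspaceI)
  show "0 \<in> tangent_space M p" by (simp add: tangent_space_def zero_fun_def)
  fix u assume u: "u \<in> tangent_space M p"
  show "r *\<^sub>R u \<in> tangent_space M p" for r
    unfolding tangent_space_def mem_Collect_eq scaleR_fun_def
  proof (intro conjI allI impI)
    fix f h W assume "smooth_near M p f \<and> openin (mtop M) W \<and> p \<in> W \<and> (\<forall>q\<in>W. f q = h q)"
    then have "u f = u h" using tangent_germ[OF u, of f W h] by simp
    then show "r *\<^sub>R u f = r *\<^sub>R u h" by simp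
  qed (use tangent_add[OF u] tangent_mult[OF u] tangent_scale[OF u] tangent_not_smooth[OF u]
      in \<open>simp_all add: algebra_simps\<close>)
  fix v assume v: "v \<in> tangent_space M p"
  show "u + v \<in> tangent_space M p"
    unfolding tangent_space_def mem_Collect_eq plus_fun_def
  proof (intro conjI allI impI)
    fix f h W assume "smooth_near M p f \<and> openin (mtop M) W \<and> p \<in> W \<and> (\<forall>q\<in>W. f q = h q)"
    then have "u f = u h" "v f = v h" using tangent_germ[OF u, of f W h] tangent_germ[OF v, of f W h] by simp_all
    then show "u f + v f = u h + v h" by simp
  qed (use tangent_add[OF u] tangent_add[OF v] tangent_mult[OF u] tangent_mult[OF v]
      tangent_scale[OF u] tangent_scale[OF v] tangent_not_smooth[OF u] tangent_not_smooth[OF v]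
      in \<open>simp_all add: algebra_simps\<close>)
qed

lemma coord_field_eq:
  "coord_field M c b p f =
    (if smooth_near M p f then frechet_derivative (\<lambda>x. f (chart_inv c x)) (at (snd c p)) b else 0)"
  by (simp add: coord_field_def o_def)

lemma coord_field_tangent:
  assumes M: "smooth_manifold M" and c: "c \<in> atlas M" and p: "p \<in> fst c"
  shows "coord_field M c b p \<in> tangent_space M p"
proof -
  note D = smooth_near_chart_derivative[OF M c p]
  have inv: "chart_inv c (snd c p) = p" by (rule chart_inv_left[OF M c p])
  have pM: "p \<in> carrier M" using chart_subset[OF M c] p by auto
  show ?thesis
    unfolding tangent_space_def mem_Collect_eq
  proof (intro conjI allI impI)
    fix f h assume "smooth_near M p f \<and> smooth_near M p h"
    then have f: "smooth_near M p f" and h: "smooth_near M p h" by auto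
    show "coord_field M c b p (\<lambda>q. f q + h q) = coord_field M c b p f + coord_field M c b p h"
      using frechet_derivative_at[OF has_derivative_add[OF D[OF f] D[OF h]]] f h smooth_near_add[OF M f h]
      by (simp add: coord_field_eq fun_eq_iff)
    show "coord_field M c b p (\<lambda>q. f q * h q) = f p * coord_field M c b p h + h p * coord_field M c b p f"
      using frechet_derivative_at[OF has_derivative_mult[OF D[OF f] D[OF h]]] f h smooth_near_mult[OF M f h]
      by (simp add: coord_field_eq fun_eq_iff inv mult.commute)
  next
    fix r f assume f: "smooth_near M p f"
    show "coord_field M c b p (\<lambda>q. r * f q) = r * coord_field M c b p f"
      using frechet_derivative_at[OF has_derivative_mult_right[OF D[OF f], of r]] f
        smooth_near_mult[OF M smooth_near_const[OF M pM] f, of r]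
      by (simp add: coord_field_eq fun_eq_iff)
  next
    fix f h W assume "smooth_near M p f \<and> openin (mtop M) W \<and> p \<in> W \<and> (\<forall>q\<in>W. f q = h q)"
    then have f: "smooth_near M p f" and W: "openin (mtop M) W" "p \<in> W" "\<And>q. q \<in> W \<Longrightarrow> f q = h q" by auto
    have h: "smooth_near M p h" using smooth_near_germ[OF M f W] .
    have "((\<lambda>x. h (chart_inv c x)) has_derivative
        frechet_derivative (\<lambda>x. f (chart_inv c x)) (at (snd c p))) (at (snd c p))"
      by (rule has_derivative_transform_within_open[OF D[OF f] chart_open_image[OF M c W(1)]])
        (use W p chart_inv_left[OF M c] in auto)
    from frechet_derivative_at[OF this] show "coord_field M c b p f = coord_field M c b p h"
      using f h by (simp add: coord_field_eq)
  qed (simp add: coord_field_eq)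
qed

lemma smooth_fun_coord:
  assumes M: "smooth_manifold M" and c: "c \<in> atlas M"
  shows "smooth_fun M (fst c) (coord c b)"
proof -
  have "Ck_on n (snd c ` fst c) (\<lambda>x. coord c b (chart_inv c x))" for n
  proof -
    have "Ck_on n (snd c ` fst c) (\<lambda>x. x \<bullet> b)"
      by (intro Ck_on_inner_left Ck_on_bounded_linear bounded_linear_ident chart_homeo(2)[OF M c])
    moreover have "coord c b (chart_inv c x) = x \<bullet> b" if "x \<in> snd c ` fst c" for x
      using chart_inv_right(1)[OF that] by (simp add: coord_def)
    ultimately show ?thesis
      using Ck_on_cong[OF chart_homeo(2)[OF M c], of "\<lambda>x. coord c b (chart_inv c x)" "\<lambda>x. x \<bullet> b"] by simp
  qed
  then show ?thesis
    by (subst smooth_fun_iff_chart[OF M c chart_openin[OF M c]]) (auto simp: smooth_on_def)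
qed

text \<open>
  By Hadamard's lemma \<open>f\<close> agrees near \<open>p\<close> with \<open>f p + (\<Sum>b. (x\<^sub>b - x\<^sub>b p) g\<^sub>b)\<close> for smooth \<open>g\<^sub>b\<close>
  with \<open>g\<^sub>b p = \<partial>\<^sub>b f p\<close>. A derivation annihilates constants, and in the product rule only the terms
  \<open>g\<^sub>b p v(x\<^sub>b)\<close> survive. So a derivation is determined by its values at the coordinates.
\<close>

lemma tangent_apply:
  assumes M: "smooth_manifold M" and c: "c \<in> atlas M" and p: "p \<in> fst c"
    and v: "v \<in> tangent_space M p" and f: "smooth_near M p f"
  shows "v f = (\<Sum>b\<in>Basis. v (coord c b) * frechet_derivative (\<lambda>x. f (chart_inv c x)) (at (snd c p)) b)"
proof -
  let ?F = "\<lambda>x. f (chart_inv c x)" and ?x0 = "snd c p"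
  have pM: "p \<in> carrier M" using chart_subset[OF M c] p by auto
  have inv: "chart_inv c ?x0 = p" by (rule chart_inv_left[OF M c p])
  obtain W where W: "openin (mtop M) W" "p \<in> W" "smooth_fun M W f"
    using f by (auto simp: smooth_near_def)
  let ?A = "snd c ` (fst c \<inter> W)"
  have A: "open ?A" by (rule chart_open_image[OF M c W(1)])
  have F: "smooth_on ?A ?F" using W(3) c by (simp add: smooth_fun_def o_def)
  obtain r where r: "0 < r" "ball ?x0 r \<subseteq> ?A"
    using A p W(2) open_contains_ball by blast
  obtain G where G: "\<And>b. b \<in> Basis \<Longrightarrow> smooth_on (ball ?x0 (r / 2)) (G b)"
    "\<And>x. x \<in> ball ?x0 (r / 2) \<Longrightarrow> ?F x = ?F ?x0 + (\<Sum>b\<in>Basis. ((x - ?x0) \<bullet> b) * G b x)"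
    "\<And>b. b \<in> Basis \<Longrightarrow> G b ?x0 = frechet_derivative ?F (at ?x0) b"
    using hadamard[OF r(1) smooth_on_subset[OF F r(2)]] by blast
  let ?W' = "{q \<in> fst c. snd c q \<in> ball ?x0 (r / 2)}"
  have W': "openin (mtop M) ?W'" "p \<in> ?W'" "?W' \<subseteq> fst c"
    by (rule chart_open_preimage[OF M c open_ball]) (use p r(1) in auto)
  let ?g = "\<lambda>b q. G b (snd c q)" and ?u = "\<lambda>b q. coord c b q + - (?x0 \<bullet> b)"
  have g: "smooth_near M p (?g b)" if "b \<in> Basis" for b
  proof (rule smooth_nearI[OF _ W'(1,2)])
    have o: "open (snd c ` ?W')" by (rule chart_open_image'[OF M c W'(1,3)])
    have "smooth_on (snd c ` ?W') (G b)"
      by (rule smooth_on_subset[OF G(1)[OF that]]) auto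
    moreover have "G b x = ?g b (chart_inv c x)" if "x \<in> snd c ` ?W'" for x
      using chart_inv_right(1)[OF that W'(3)] by simp
    ultimately have "smooth_on (snd c ` ?W') (\<lambda>x. ?g b (chart_inv c x))"
      using Ck_on_cong[OF o, of "G b" "\<lambda>x. ?g b (chart_inv c x)"] by (simp add: smooth_on_def)
    then show "smooth_fun M ?W' (?g b)" using smooth_fun_iff_chart[OF M c W'(1,3)] by blast
  qed
  have cb: "smooth_near M p (coord c b)" for b
    by (rule smooth_nearI[OF smooth_fun_coord[OF M c] chart_openin[OF M c] p])
  have u: "smooth_near M p (?u b)" for b
    by (intro smooth_near_add[OF M] cb smooth_near_const[OF M pM])
  have ug: "smooth_near M p (\<lambda>q. ?u b q * ?g b q)" if "b \<in> Basis" for b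
    by (intro smooth_near_mult[OF M] u g that)
  have vu: "v (?u b) = v (coord c b)" for b
  proof -
    have "v (?u b) = v (coord c b) + v (\<lambda>q. - (?x0 \<bullet> b))"
      by (rule tangent_add[OF v cb smooth_near_const[OF M pM]])
    then show ?thesis by (simp only: tangent_const[OF M pM v] add_0_right)
  qed
  have eq: "f q = f p + (\<Sum>b\<in>Basis. ?u b q * ?g b q)" if "q \<in> ?W'" for q
    using G(2)[of "snd c q"] that chart_inv_left[OF M c] inv by (simp add: coord_def inner_diff_left)
  have "v f = v (\<lambda>q. f p + (\<Sum>b\<in>Basis. ?u b q * ?g b q))"
    by (rule tangent_germ[OF v f W'(1,2)]) (rule eq)
  also have "\<dots> = v (\<lambda>q. f p) + v (\<lambda>q. \<Sum>b\<in>Basis. ?u b q * ?g b q)"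
    by (rule tangent_add[OF v smooth_near_const[OF M pM] smooth_near_sum[OF M pM ug]])
  also have "v (\<lambda>q. \<Sum>b\<in>Basis. ?u b q * ?g b q) = (\<Sum>b\<in>Basis. v (\<lambda>q. ?u b q * ?g b q))"
    by (rule tangent_sum[OF M pM v ug])
  also have "\<dots> = (\<Sum>b\<in>Basis. v (coord c b) * frechet_derivative ?F (at ?x0) b)"
  proof (rule sum.cong[OF refl])
    fix b :: 'b assume b: "b \<in> Basis"
    have "v (\<lambda>q. ?u b q * ?g b q) = ?u b p * v (?g b) + ?g b p * v (?u b)"
      by (rule tangent_mult[OF v u g[OF b]])
    then show "v (\<lambda>q. ?u b q * ?g b q) = v (coord c b) * frechet_derivative ?F (at ?x0) b"
      using G(3)[OF b] vu by (simp add: coord_def)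
  qed
  finally show ?thesis using tangent_const[OF M pM v] by simp
qed

lemma sum_tangent_apply: "(\<Sum>i\<in>J. w i) f = (\<Sum>i\<in>J. w i f)" for w :: "'i \<Rightarrow> 'a tangent"
  by (induction J rule: infinite_finite_induct) auto

lemma tangent_chart_representation:
  assumes M: "smooth_manifold M" and c: "c \<in> atlas M" and p: "p \<in> fst c" and v: "v \<in> tangent_space M p"
  shows "v = (\<Sum>b\<in>Basis. v (coord c b) *\<^sub>R coord_field M c b p)"
proof
  fix f
  show "v f = (\<Sum>b\<in>Basis. v (coord c b) *\<^sub>R coord_field M c b p) f"
    using tangent_apply[OF M c p v, of f] tangent_not_smooth[OF v, of f]
    by (cases "smooth_near M p f") (simp_all add: sum_tangent_apply scaleR_fun_def coord_field_eq)
qed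

lemma tangent_apply_chart_diff:
  assumes M: "smooth_manifold M" and c: "c \<in> atlas M" and p: "p \<in> fst c"
    and v: "v \<in> tangent_space M p" and f: "smooth_near M p f"
  shows "v f = frechet_derivative (\<lambda>x. f (chart_inv c x)) (at (snd c p)) (chart_diff c v)"
  unfolding tangent_apply[OF assms] chart_diff_def
  using has_derivative_linear[OF smooth_near_chart_derivative[OF M c p f]]
  by (simp add: linear_sum linear_scale)

section \<open>Vector fields and connections\<close>

lemma smooth_field_subset: "smooth_field M W X \<Longrightarrow> W' \<subseteq> W \<Longrightarrow> smooth_field M W' X"
  unfolding smooth_field_def by (meson order_trans subsetD)

lemma smooth_field_tangent: "smooth_field M W X \<Longrightarrow> p \<in> W \<Longrightarrow> X p \<in> tangent_space M p"
  by (simp add: smooth_field_def)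

lemma smooth_field_apply:
  "smooth_field M W X \<Longrightarrow> openin (mtop M) W \<Longrightarrow> smooth_fun M W f \<Longrightarrow> smooth_fun M W (\<lambda>p. X p f)"
  by (simp add: smooth_field_def)

lemma smooth_field_add:
  assumes M: "smooth_manifold M" and X: "smooth_field M W X" and Y: "smooth_field M W Y"
  shows "smooth_field M W (\<lambda>q. X q + Y q)"
  unfolding smooth_field_def
proof (intro conjI ballI allI impI)
  show "X p + Y p \<in> tangent_space M p" if "p \<in> W" for p
    using subspace_add[OF subspace_tangent_space] smooth_field_tangent[OF X that] smooth_field_tangent[OF Y that] .
  fix W' f assume a: "openin (mtop M) W' \<and> W' \<subseteq> W \<and> smooth_fun M W' f"
  then show "smooth_fun M W' (\<lambda>p. (X p + Y p) f)"
    using smooth_fun_add[OF M, of W' "\<lambda>p. X p f" "\<lambda>p. Y p f"]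
      smooth_field_apply[OF smooth_field_subset[OF X]] smooth_field_apply[OF smooth_field_subset[OF Y]]
    by simp
qed

lemma smooth_field_scale:
  assumes M: "smooth_manifold M" and f: "smooth_fun M W f" and X: "smooth_field M W X"
  shows "smooth_field M W (\<lambda>q. f q *\<^sub>R X q)"
  unfolding smooth_field_def
proof (intro conjI ballI allI impI)
  show "f p *\<^sub>R X p \<in> tangent_space M p" if "p \<in> W" for p
    using subspace_scale[OF subspace_tangent_space] smooth_field_tangent[OF X that] .
  fix W' h assume a: "openin (mtop M) W' \<and> W' \<subseteq> W \<and> smooth_fun M W' h"
  then show "smooth_fun M W' (\<lambda>p. (f p *\<^sub>R X p) h)"
    using smooth_fun_mult[OF M, of W' f "\<lambda>p. X p h"] smooth_fun_subset[OF f, of W']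
      smooth_field_apply[OF smooth_field_subset[OF X]]
    by (simp add: scaleR_fun_def)
qed

lemma smooth_field_zero:
  assumes M: "smooth_manifold M" shows "smooth_field M W (\<lambda>q. 0)"
  unfolding smooth_field_def
  using subspace_0[OF subspace_tangent_space] smooth_fun_const[OF M] by (auto simp: zero_fun_def)

lemma smooth_field_sum:
  assumes M: "smooth_manifold M" and "\<And>i. i \<in> J \<Longrightarrow> smooth_fun M W (f i)" "\<And>i. i \<in> J \<Longrightarrow> smooth_field M W (X i)"
  shows "smooth_field M W (\<lambda>q. \<Sum>i\<in>J. f i q *\<^sub>R X i q)"
  using assms(2-)
proof (induction J rule: infinite_finite_induct)
  case (insert i J)
  show ?case
    unfolding sum.insert[OF insert.hyps]
    by (intro smooth_field_add[OF M] smooth_field_scale[OF M] insert.IH insert.prems) simp_all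
qed (simp_all add: smooth_field_zero[OF M])

lemma coord_field_smooth:
  assumes M: "smooth_manifold M" and c: "c \<in> atlas M"
  shows "smooth_field M (fst c) (coord_field M c b)"
  unfolding smooth_field_def
proof (intro conjI ballI allI impI)
  show "coord_field M c b p \<in> tangent_space M p" if "p \<in> fst c" for p
    by (rule coord_field_tangent[OF M c that])
  fix W f assume "openin (mtop M) W \<and> W \<subseteq> fst c \<and> smooth_fun M W f"
  then have W: "openin (mtop M) W" "W \<subseteq> fst c" and f: "smooth_fun M W f" by auto
  have o: "open (snd c ` W)" by (rule chart_open_image'[OF M c W])
  have F: "smooth_on (snd c ` W) (\<lambda>x. f (chart_inv c x))"
    using f smooth_fun_iff_chart[OF M c W] by blast
  have eq: "coord_field M c b (chart_inv c x) f = frechet_derivative (\<lambda>x. f (chart_inv c x)) (at x) b"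
    if "x \<in> snd c ` W" for x
    using smooth_nearI[OF f W(1) chart_inv_image[OF M c that W(2)]] chart_inv_right(1)[OF that W(2)]
    by (simp add: coord_field_eq)
  have "Ck_on n (snd c ` W) (\<lambda>x. coord_field M c b (chart_inv c x) f)" for n
  proof -
    have "Ck_on (Suc n) (snd c ` W) (\<lambda>x. f (chart_inv c x))" using F unfolding smooth_on_def by blast
    then show ?thesis
      using Ck_on_cong[OF o, of "\<lambda>x. coord_field M c b (chart_inv c x) f"
          "\<lambda>x. frechet_derivative (\<lambda>x. f (chart_inv c x)) (at x) b" n] eq by simp
  qed
  then show "smooth_fun M W (\<lambda>p. coord_field M c b p f)"
    using smooth_fun_iff_chart[OF M c W] by (simp add: smooth_on_def)
qed

context
  fixes M :: "('a, 'e::euclidean_space) mfd" and nabla W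
  assumes conn: "connection M nabla" and W: "openin (mtop M) W"
begin

lemmas connection_clauses = mp[OF spec[OF conn[unfolded connection_def], of W] W]

lemma nabla_smooth:
  assumes "smooth_field M W X" "smooth_field M W Y"
  shows "smooth_field M W (nabla X Y)"
proof -
  have "\<forall>X Y. smooth_field M W X \<and> smooth_field M W Y \<longrightarrow> smooth_field M W (nabla X Y)"
    using connection_clauses by (elim conjE)
  then show ?thesis using assms by simp
qed

lemma nabla_cong:
  assumes "smooth_field M W X" "smooth_field M W X'" "smooth_field M W Y" "smooth_field M W Y'"
    "\<And>q. q \<in> W \<Longrightarrow> X q = X' q" "\<And>q. q \<in> W \<Longrightarrow> Y q = Y' q" "p \<in> W"
  shows "nabla X Y p = nabla X' Y' p"
proof -
  have "\<forall>X X' Y Y'. smooth_field M W X \<and> smooth_field M W X' \<and> smooth_field M W Y \<and> smooth_field M W Y' \<and>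
      (\<forall>p\<in>W. X p = X' p \<and> Y p = Y' p) \<longrightarrow> (\<forall>p\<in>W. nabla X Y p = nabla X' Y' p)"
    using connection_clauses by (elim conjE)
  from this[rule_format, of X X' Y Y' p] show ?thesis using assms by simp
qed

lemma nabla_add_left:
  assumes "smooth_field M W X" "smooth_field M W X'" "smooth_field M W Y" "p \<in> W"
  shows "nabla (\<lambda>q. X q + X' q) Y p = nabla X Y p + nabla X' Y p"
proof -
  have "\<forall>X X' Y. smooth_field M W X \<and> smooth_field M W X' \<and> smooth_field M W Y \<longrightarrow>
        (\<forall>p\<in>W. nabla (\<lambda>q. X q + X' q) Y p = nabla X Y p + nabla X' Y p)"
    using connection_clauses by (elim conjE)
  then show ?thesis using assms by blast
qed

lemma nabla_scale_left:
  assumes "smooth_fun M W f" "smooth_field M W X" "smooth_field M W Y" "p \<in> W"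
  shows "nabla (\<lambda>q. f q *\<^sub>R X q) Y p = f p *\<^sub>R nabla X Y p"
proof -
  have "\<forall>f X Y. smooth_fun M W f \<and> smooth_field M W X \<and> smooth_field M W Y \<longrightarrow>
        (\<forall>p\<in>W. nabla (\<lambda>q. f q *\<^sub>R X q) Y p = f p *\<^sub>R nabla X Y p)"
    using connection_clauses by (elim conjE)
  then show ?thesis using assms by blast
qed

lemma nabla_add_right:
  assumes "smooth_field M W X" "smooth_field M W Y" "smooth_field M W Y'" "p \<in> W"
  shows "nabla X (\<lambda>q. Y q + Y' q) p = nabla X Y p + nabla X Y' p"
proof -
  have "\<forall>X Y Y'. smooth_field M W X \<and> smooth_field M W Y \<and> smooth_field M W Y' \<longrightarrow>
        (\<forall>p\<in>W. nabla X (\<lambda>q. Y q + Y' q) p = nabla X Y p + nabla X Y' p)"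
    using connection_clauses by (elim conjE)
  then show ?thesis using assms by blast
qed

lemma nabla_scale_right:
  assumes "smooth_fun M W f" "smooth_field M W X" "smooth_field M W Y" "p \<in> W"
  shows "nabla X (\<lambda>q. f q *\<^sub>R Y q) p = X p f *\<^sub>R Y p + f p *\<^sub>R nabla X Y p"
proof -
  have "\<forall>f X Y. smooth_fun M W f \<and> smooth_field M W X \<and> smooth_field M W Y \<longrightarrow>
        (\<forall>p\<in>W. nabla X (\<lambda>q. f q *\<^sub>R Y q) p = X p f *\<^sub>R Y p + f p *\<^sub>R nabla X Y p)"
    using connection_clauses by (elim conjE)
  then show ?thesis using assms by blast
qed

lemma nabla_sum_right:
  assumes M: "smooth_manifold M" and X: "smooth_field M W X" and p: "p \<in> W" and "finite J"
    and "\<And>i. i \<in> J \<Longrightarrow> smooth_fun M W (f i)" "\<And>i. i \<in> J \<Longrightarrow> smooth_field M W (Y i)"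
  shows "nabla X (\<lambda>q. \<Sum>i\<in>J. f i q *\<^sub>R Y i q) p = (\<Sum>i\<in>J. X p (f i) *\<^sub>R Y i p + f i p *\<^sub>R nabla X (Y i) p)"
  using assms(4-)
proof (induction J rule: finite_induct)
  case empty
  have "nabla X (\<lambda>q. 0 + 0) p = nabla X (\<lambda>q. 0) p + nabla X (\<lambda>q. 0) p"
    by (rule nabla_add_right[OF X smooth_field_zero[OF M] smooth_field_zero[OF M] p])
  then have z: "nabla X (\<lambda>q. 0) p = 0" by simp
  show ?case unfolding sum.empty by (rule z)
next
  case (insert i J)
  have s: "smooth_field M W (\<lambda>q. f i q *\<^sub>R Y i q)" "smooth_field M W (\<lambda>q. \<Sum>i\<in>J. f i q *\<^sub>R Y i q)"
    using insert.prems by (intro smooth_field_scale smooth_field_sum M; simp)+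
  show ?case
    unfolding sum.insert[OF insert.hyps] nabla_add_right[OF X s p]
    by (intro arg_cong2[where f = "(+)"] nabla_scale_right[OF _ X _ p] insert.IH insert.prems) simp_all
qed

lemma nabla_sum_left:
  assumes M: "smooth_manifold M" and Y: "smooth_field M W Y" and p: "p \<in> W" and "finite J"
    and "\<And>i. i \<in> J \<Longrightarrow> smooth_fun M W (f i)" "\<And>i. i \<in> J \<Longrightarrow> smooth_field M W (X i)"
  shows "nabla (\<lambda>q. \<Sum>i\<in>J. f i q *\<^sub>R X i q) Y p = (\<Sum>i\<in>J. f i p *\<^sub>R nabla (X i) Y p)"
  using assms(4-)
proof (induction J rule: finite_induct)
  case empty
  have "nabla (\<lambda>q. 0 + 0) Y p = nabla (\<lambda>q. 0) Y p + nabla (\<lambda>q. 0) Y p"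
    by (rule nabla_add_left[OF smooth_field_zero[OF M] smooth_field_zero[OF M] Y p])
  then have z: "nabla (\<lambda>q. 0) Y p = 0" by simp
  show ?case unfolding sum.empty by (rule z)
next
  case (insert i J)
  have s: "smooth_field M W (\<lambda>q. f i q *\<^sub>R X i q)" "smooth_field M W (\<lambda>q. \<Sum>i\<in>J. f i q *\<^sub>R X i q)"
    using insert.prems by (intro smooth_field_scale smooth_field_sum M; simp)+
  show ?case
    unfolding sum.insert[OF insert.hyps] nabla_add_left[OF s Y p]
    by (intro arg_cong2[where f = "(+)"] nabla_scale_left[OF _ _ Y p] insert.IH insert.prems) simp_all
qed

end

section \<open>Integral curves and covariant derivatives\<close>

lemma velocity_integral_curve:
  assumes "smooth_field M N E" "integral_curve M N E I \<gamma>" "t \<in> I"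
  shows "velocity M \<gamma> t = E (\<gamma> t)"
proof
  fix f
  have "\<gamma> t \<in> N" using assms(2,3) by (auto simp: integral_curve_def)
  then have T: "E (\<gamma> t) \<in> tangent_space M (\<gamma> t)" by (rule smooth_field_tangent[OF assms(1)])
  show "velocity M \<gamma> t f = E (\<gamma> t) f"
  proof (cases "smooth_near M (\<gamma> t) f")
    case True
    then have "((f \<circ> \<gamma>) has_real_derivative E (\<gamma> t) f) (at t)"
      using assms(2,3) by (simp add: integral_curve_def)
    with True show ?thesis by (simp add: velocity_def DERIV_imp_deriv)
  next
    case False
    then show ?thesis using tangent_not_smooth[OF T] by (simp add: velocity_def)
  qed
qed

text \<open>
  Expand \<open>E = (\<Sum>b. E\<^sub>b \<partial>\<^sub>b)\<close> in an arbitrary chart around the point. The product rule for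
  \<open>nabla E E\<close> produces the terms \<open>(E E\<^sub>b) \<partial>\<^sub>b + E\<^sub>b (\<Sum>a. E\<^sub>a nabla \<partial>\<^sub>a \<partial>\<^sub>b)\<close>. Along an integral curve
  \<open>E E\<^sub>b\<close> is the time derivative of the component \<open>E\<^sub>b\<close> of the velocity, so these are the terms of
  \<^const>\<open>cov_deriv_along\<close>.
\<close>

lemma cov_deriv_integral_curve:
  assumes M: "smooth_manifold M" and conn: "connection M nabla" and N: "openin (mtop M) N"
    and E: "smooth_field M N E" and \<gamma>: "integral_curve M N E I \<gamma>" and t: "t \<in> I"
    and c: "c \<in> atlas M" "\<gamma> t \<in> fst c"
  shows "cov_deriv_along M nabla c \<gamma> (velocity M \<gamma>) t = nabla E E (\<gamma> t)"
proof -
  define W where "W = N \<inter> fst c"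
  have W: "openin (mtop M) W" unfolding W_def using N chart_openin[OF M c(1)] by (rule openin_Int)
  let ?p = "\<gamma> t"
  have p: "?p \<in> W" using \<gamma> t c by (auto simp: W_def integral_curve_def)
  have EW: "smooth_field M W E" by (rule smooth_field_subset[OF E]) (simp add: W_def)
  have cfW: "smooth_field M W (coord_field M c b)" for b
    by (rule smooth_field_subset[OF coord_field_smooth[OF M c(1)]]) (simp add: W_def)
  have xW: "smooth_fun M W (coord c b)" for b
    by (rule smooth_fun_subset[OF smooth_fun_coord[OF M c(1)]]) (simp add: W_def)
  define f where "f b q = E q (coord c b)" for b q
  have fW: "smooth_fun M W (f b)" for b
    unfolding f_def by (rule smooth_field_apply[OF EW W xW])
  define E' where "E' q = (\<Sum>b\<in>Basis. f b q *\<^sub>R coord_field M c b q)" for q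
  have E'W: "smooth_field M W E'"
    unfolding E'_def by (intro smooth_field_sum M fW cfW)
  have EE': "E q = E' q" if "q \<in> W" for q
    unfolding E'_def f_def using that
    by (intro tangent_chart_representation[OF M c(1)] smooth_field_tangent[OF EW]) (auto simp: W_def)
  have 1: "nabla E E ?p = nabla E E' ?p"
    by (rule nabla_cong[OF conn W EW EW EW E'W _ EE' p]) auto
  have 2: "nabla E E' ?p = (\<Sum>b\<in>Basis. E ?p (f b) *\<^sub>R coord_field M c b ?p + f b ?p *\<^sub>R nabla E (coord_field M c b) ?p)"
    unfolding E'_def by (intro nabla_sum_right[OF conn W M EW p] finite_Basis fW cfW)
  have 3: "nabla E (coord_field M c b) ?p = (\<Sum>a\<in>Basis. f a ?p *\<^sub>R nabla (coord_field M c a) (coord_field M c b) ?p)" for b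
  proof -
    have "nabla E (coord_field M c b) ?p = nabla E' (coord_field M c b) ?p"
      by (rule nabla_cong[OF conn W EW E'W cfW cfW EE' _ p]) auto
    also have "\<dots> = (\<Sum>a\<in>Basis. f a ?p *\<^sub>R nabla (coord_field M c a) (coord_field M c b) ?p)"
      unfolding E'_def by (intro nabla_sum_left[OF conn W M cfW p] finite_Basis fW cfW)
    finally show ?thesis .
  qed
  have I: "open I" using \<gamma> by (simp add: integral_curve_def)
  have vel: "velocity M \<gamma> s (coord c b) = f b (\<gamma> s)" if "s \<in> I" for s b
    using velocity_integral_curve[OF E \<gamma> that] by (simp add: f_def)
  have 4: "deriv (\<lambda>s. velocity M \<gamma> s (coord c b)) t = E ?p (f b)" for b
  proof (rule DERIV_imp_deriv)
    have "((f b \<circ> \<gamma>) has_real_derivative E ?p (f b)) (at t)"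
      using \<gamma> t smooth_nearI[OF fW W p] by (simp add: integral_curve_def)
    then show "((\<lambda>s. velocity M \<gamma> s (coord c b)) has_real_derivative E ?p (f b)) (at t)"
      by (rule has_field_derivative_transform_within_open[OF _ I t]) (simp add: vel)
  qed
  show ?thesis
    unfolding cov_deriv_along_def 1 2 3 4 by (simp add: vel t)
qed

lemma integral_curve_smooth:
  fixes M :: "('a, 'e::euclidean_space) mfd"
  assumes M: "smooth_manifold M" and N: "openin (mtop M) N"
    and E: "smooth_field M N E" and \<gamma>: "integral_curve M N E I \<gamma>"
  shows "smooth_curve M I \<gamma>"
  unfolding smooth_curve_def
proof (intro conjI ballI)
  show cont: "continuous_map (top_of_set I) (mtop M) \<gamma>" using \<gamma> by (simp add: integral_curve_def)
  have I: "open I" using \<gamma> by (simp add: integral_curve_def)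
  fix c assume c: "c \<in> atlas M"
  let ?J = "{t \<in> I. \<gamma> t \<in> fst c}"
  have "openin (top_of_set I) ?J"
    using openin_continuous_map_preimage[OF cont chart_openin[OF M c]] by simp
  then have J: "open ?J" using I openin_open_trans by blast
  define W where "W = N \<inter> fst c"
  have W: "openin (mtop M) W" "W \<subseteq> fst c"
    unfolding W_def using N chart_openin[OF M c] by (auto intro: openin_Int)
  have \<gamma>W: "\<gamma> t \<in> W" if "t \<in> ?J" for t using that \<gamma> by (auto simp: W_def integral_curve_def)
  have EW: "smooth_field M W E" by (rule smooth_field_subset[OF E]) (simp add: W_def)
  have xW: "smooth_fun M W (coord c b)" for b
    by (rule smooth_fun_subset[OF smooth_fun_coord[OF M c] W(2)])
  have o: "open (snd c ` W)" by (rule chart_open_image'[OF M c W])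
  define e where "e x = (\<Sum>b\<in>Basis. E (chart_inv c x) (coord c b) *\<^sub>R b)" for x
  have e: "Ck_on n (snd c ` W) e" for n
    unfolding e_def
  proof (intro Ck_on_sum Ck_on_scaleR Ck_on_const o)
    fix b :: 'e
    have "smooth_fun M W (\<lambda>p. E p (coord c b))" by (rule smooth_field_apply[OF EW W(1) xW])
    then show "Ck_on n (snd c ` W) (\<lambda>x. E (chart_inv c x) (coord c b))"
      using smooth_fun_iff_chart[OF M c W] by (simp add: smooth_on_def)
  qed
  let ?\<xi> = "\<lambda>t. snd c (\<gamma> t)"
  have d: "(?\<xi> has_derivative (\<lambda>h. h *\<^sub>R e (?\<xi> t))) (at t)" if t: "t \<in> ?J" for t
  proof -
    have "((\<lambda>s. coord c b (\<gamma> s)) has_real_derivative E (\<gamma> t) (coord c b)) (at t)" for b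
      using \<gamma> t smooth_nearI[OF xW W(1) \<gamma>W[OF t]] by (simp add: integral_curve_def o_def)
    then have "((\<lambda>s. coord c b (\<gamma> s) *\<^sub>R b) has_vector_derivative E (\<gamma> t) (coord c b) *\<^sub>R b) (at t)" for b
      unfolding has_real_derivative_iff_has_vector_derivative
      by (rule bounded_linear.has_vector_derivative[OF bounded_linear_scaleR_left])
    then have "((\<lambda>s. \<Sum>b\<in>Basis. coord c b (\<gamma> s) *\<^sub>R b) has_vector_derivative (\<Sum>b\<in>Basis. E (\<gamma> t) (coord c b) *\<^sub>R b)) (at t)"
      by (intro has_vector_derivative_sum)
    moreover have "(\<Sum>b\<in>Basis. coord c b (\<gamma> s) *\<^sub>R b) = ?\<xi> s" for s
      unfolding coord_def by (rule euclidean_representation)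
    moreover have "(\<Sum>b\<in>Basis. E (\<gamma> t) (coord c b) *\<^sub>R b) = e (?\<xi> t)"
      unfolding e_def using t by (simp add: chart_inv_left[OF M c])
    ultimately show ?thesis by (simp add: has_vector_derivative_def)
  qed
  \<comment> \<open>The equation \<open>\<xi>' = e \<circ> \<xi>\<close> with smooth \<open>e\<close> gives \<open>\<xi>'\<close> the degree of differentiability of \<open>\<xi>\<close>.\<close>
  have "Ck_on n ?J ?\<xi>" for n
  proof (induction n)
    case 0
    then show ?case
      using continuous_at_imp_continuous_on[of ?J ?\<xi>] has_derivative_continuous[OF d] by simp
  next
    case (Suc n)
    show ?case
    proof (rule Ck_on_SucI[OF J d])
      show "Ck_on n ?J (\<lambda>t. v *\<^sub>R e (?\<xi> t))" for v
        by (intro Ck_on_scaleR Ck_on_const J Ck_on_compose[OF J o _ Suc.IH e]) (use \<gamma>W in auto)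
    qed
  qed
  then show "smooth_on ?J (snd c \<circ> \<gamma>)" by (simp add: smooth_on_def o_def)
qed

section \<open>Inner products and horizontal projections\<close>

context
  fixes V :: "'v::real_vector set" and ip
  assumes ip: "inner_product_on V ip" and V: "subspace V"
begin

lemma ip_add_left: "u \<in> V \<Longrightarrow> v \<in> V \<Longrightarrow> w \<in> V \<Longrightarrow> ip (u + v) w = ip u w + ip v w"
  using ip by (simp add: inner_product_on_def)

lemma ip_scale_left: "u \<in> V \<Longrightarrow> w \<in> V \<Longrightarrow> ip (r *\<^sub>R u) w = r * ip u w"
  using ip by (simp add: inner_product_on_def)

lemma ip_commute: "u \<in> V \<Longrightarrow> w \<in> V \<Longrightarrow> ip u w = ip w u"
  using ip by (simp add: inner_product_on_def)

lemma ip_pos: "u \<in> V \<Longrightarrow> u \<noteq> 0 \<Longrightarrow> 0 < ip u u"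
  using ip by (simp add: inner_product_on_def)

lemma ip_zero_left: "w \<in> V \<Longrightarrow> ip 0 w = 0"
  using ip_scale_left[OF subspace_0[OF V], of w 0] by simp

lemma ip_sum_left:
  assumes "\<And>i. i \<in> J \<Longrightarrow> v i \<in> V" "w \<in> V"
  shows "ip (\<Sum>i\<in>J. r i *\<^sub>R v i) w = (\<Sum>i\<in>J. r i * ip (v i) w)"
  using assms(1)
proof (induction J rule: infinite_finite_induct)
  case (insert i J)
  have "(\<Sum>i\<in>J. r i *\<^sub>R v i) \<in> V" using insert.prems by (intro subspace_sum V subspace_scale) auto
  then show ?case
    using insert ip_add_left[of "r i *\<^sub>R v i" "\<Sum>i\<in>J. r i *\<^sub>R v i" w] ip_scale_left[of "v i" w]
      subspace_scale[OF V] assms(2) by simp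
qed (simp_all add: ip_zero_left assms(2))

lemma ip_sum_right:
  assumes "\<And>i. i \<in> J \<Longrightarrow> v i \<in> V" "w \<in> V"
  shows "ip w (\<Sum>i\<in>J. r i *\<^sub>R v i) = (\<Sum>i\<in>J. r i * ip w (v i))"
proof -
  have "(\<Sum>i\<in>J. r i *\<^sub>R v i) \<in> V" using assms(1) by (intro subspace_sum V subspace_scale) auto
  then have "ip w (\<Sum>i\<in>J. r i *\<^sub>R v i) = ip (\<Sum>i\<in>J. r i *\<^sub>R v i) w"
    by (rule ip_commute[OF assms(2)])
  also have "\<dots> = (\<Sum>i\<in>J. r i * ip (v i) w)" using assms by (rule ip_sum_left)
  also have "\<dots> = (\<Sum>i\<in>J. r i * ip w (v i))"
    by (intro sum.cong refl) (simp add: ip_commute[OF assms(1) assms(2)])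
  finally show ?thesis .
qed

end

text \<open>
  The vector 0 fits the description of the projection. A second candidate \<open>w\<close> would be a vector of
  \<open>\<Sigma> p\<close> orthogonal to \<open>\<Sigma> p\<close>, thus to itself.
\<close>

lemma horizontal_proj_eq_0:
  assumes ip: "inner_product_on V (g p)" and V: "subspace V" and S: "subspace (\<Sigma> p)" "\<Sigma> p \<subseteq> V"
    and v: "v \<in> V" "\<And>u. u \<in> \<Sigma> p \<Longrightarrow> g p v u = 0"
  shows "horizontal_proj g \<Sigma> p v = 0"
  unfolding horizontal_proj_def
proof (rule the_equality)
  show "0 \<in> \<Sigma> p \<and> (\<forall>u\<in>\<Sigma> p. g p (v - 0) u = 0)" using v(2) subspace_0[OF S(1)] by simp
  fix w assume w: "w \<in> \<Sigma> p \<and> (\<forall>u\<in>\<Sigma> p. g p (v - w) u = 0)"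
  then have wV: "w \<in> V" using S(2) by auto
  have "g p ((v - w) + w) w = g p (v - w) w + g p w w"
    using ip_add_left[OF ip V] subspace_diff[OF V v(1) wV] wV by blast
  then have "g p w w = 0" using w v(2) by simp
  then show "w = 0" using ip_pos[OF ip V wV] by force
qed

text \<open>
  Along an integral curve of \<open>E\<close> the covariant derivative of the velocity is \<open>nabla E E\<close>, so being a
  geodesic is the pointwise condition that \<open>nabla E E\<close> is orthogonal to \<open>\<Sigma>\<close>.
\<close>

lemma integral_curve_nonholonomic_geodesic:
  assumes M: "smooth_manifold M" and conn: "connection M nabla" and g: "riemannian_metric M g"
    and N: "openin (mtop M) N" and E: "smooth_field M N E" and \<gamma>: "integral_curve M N E I \<gamma>"
    and S: "\<And>p. p \<in> N \<Longrightarrow> subspace (\<Sigma> p)" "\<And>p. p \<in> N \<Longrightarrow> \<Sigma> p \<subseteq> tangent_space M p"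
    and hor: "\<And>p. p \<in> N \<Longrightarrow> E p \<in> \<Sigma> p"
    and orth: "\<And>p u. p \<in> N \<Longrightarrow> u \<in> \<Sigma> p \<Longrightarrow> g p (nabla E E p) u = 0"
  shows "nonholonomic_geodesic M \<Sigma> g nabla I \<gamma> \<and> \<gamma> ` I \<subseteq> N"
  unfolding nonholonomic_geodesic_def
proof (intro conjI ballI impI)
  show "open I" "is_interval I" "\<gamma> ` I \<subseteq> N" using \<gamma> by (auto simp: integral_curve_def)
  show "smooth_curve M I \<gamma>" by (rule integral_curve_smooth[OF M N E \<gamma>])
  fix t assume t: "t \<in> I"
  then have p: "\<gamma> t \<in> N" using \<gamma> by (auto simp: integral_curve_def)
  show "velocity M \<gamma> t \<in> \<Sigma> (\<gamma> t)"
    using velocity_integral_curve[OF E \<gamma> t] hor[OF p] by simp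
  fix c assume c: "c \<in> atlas M" "\<gamma> t \<in> fst c"
  have "\<gamma> t \<in> carrier M" using openin_subset[OF N] p by auto
  then have ip: "inner_product_on (tangent_space M (\<gamma> t)) (g (\<gamma> t))"
    using g by (simp add: riemannian_metric_def)
  have "nabla E E (\<gamma> t) \<in> tangent_space M (\<gamma> t)"
    by (rule smooth_field_tangent[OF nabla_smooth[OF conn N E E] p])
  then show "horizontal_proj g \<Sigma> (\<gamma> t) (cov_deriv_along M nabla c \<gamma> (velocity M \<gamma>) t) = 0"
    unfolding cov_deriv_integral_curve[OF M conn N E \<gamma> t c]
    by (intro horizontal_proj_eq_0[where g = g and p = "\<gamma> t", OF ip subspace_tangent_space] S p orth)
qed

section \<open>Orthonormal horizontal frames\<close>

text \<open>
  The Gram--Schmidt process, carried out with fields. Linear independence keeps the norms by which it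
  divides positive, and \<open>1 / sqrt\<close> is smooth on positive numbers.
\<close>

lemma orthonormal_frame:
  fixes M :: "('a, 'e::euclidean_space) mfd" and F :: "nat \<Rightarrow> 'a field"
  assumes M: "smooth_manifold M" and g: "riemannian_metric M g" and W: "openin (mtop M) W"
    and F: "\<And>i. i \<in> {1..k} \<Longrightarrow> smooth_field M W (F i)"
    and inj: "\<And>p. p \<in> W \<Longrightarrow> inj_on (\<lambda>i. F i p) {1..k}"
    and ind: "\<And>p. p \<in> W \<Longrightarrow> independent ((\<lambda>i. F i p) ` {1..k})"
  obtains X where "\<And>i. i \<in> {1..k} \<Longrightarrow> smooth_field M W (X i)"
    "\<And>p i j. p \<in> W \<Longrightarrow> i \<in> {1..k} \<Longrightarrow> j \<in> {1..k} \<Longrightarrow> g p (X i p) (X j p) = (if i = j then 1 else 0)"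
    "\<And>p. p \<in> W \<Longrightarrow> span ((\<lambda>i. X i p) ` {1..k}) = span ((\<lambda>i. F i p) ` {1..k})"
proof -
  have ip: "inner_product_on (tangent_space M p) (g p)" if "p \<in> W" for p
    using g openin_subset[OF W] that unfolding riemannian_metric_def by blast
  note T = subspace_tangent_space
  have gs: "smooth_fun M W (\<lambda>p. g p (X p) (Y p))" if "smooth_field M W X" "smooth_field M W Y" for X Y
    using g W that unfolding riemannian_metric_def by blast
  have "\<exists>X. (\<forall>i\<in>{1..j}. smooth_field M W (X i)) \<and>
      (\<forall>p\<in>W. \<forall>i\<in>{1..j}. \<forall>l\<in>{1..j}. g p (X i p) (X l p) = (if i = l then 1 else 0)) \<and>
      (\<forall>p\<in>W. span ((\<lambda>i. X i p) ` {1..j}) = span ((\<lambda>i. F i p) ` {1..j}))" if "j \<le> k" for j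
    using that
  proof (induction j)
    case 0
    then show ?case by simp
  next
    case (Suc j)
    from Suc.IH[OF Suc_leD[OF Suc.prems]] obtain X where X: "\<And>i. i \<in> {1..j} \<Longrightarrow> smooth_field M W (X i)"
      and on: "\<And>p i l. p \<in> W \<Longrightarrow> i \<in> {1..j} \<Longrightarrow> l \<in> {1..j} \<Longrightarrow> g p (X i p) (X l p) = (if i = l then 1 else 0)"
      and sp: "\<And>p. p \<in> W \<Longrightarrow> span ((\<lambda>i. X i p) ` {1..j}) = span ((\<lambda>i. F i p) ` {1..j})"
      by blast
    let ?F = "F (Suc j)"
    have FS: "smooth_field M W ?F" by (rule F) (use Suc.prems in simp)
    define r where "r i q = - g q (?F q) (X i q)" for i q
    define P where "P q = (\<Sum>i\<in>{1..j}. r i q *\<^sub>R X i q)" for q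
    define Z where "Z q = ?F q + P q" for q
    have r: "smooth_fun M W (r i)" if "i \<in> {1..j}" for i
      unfolding r_def by (intro smooth_fun_minus[OF M W] gs FS X that)
    have PS: "smooth_field M W P" unfolding P_def by (intro smooth_field_sum[OF M] r X)
    have ZS: "smooth_field M W Z" unfolding Z_def by (rule smooth_field_add[OF M FS PS])
    have XT: "X i p \<in> tangent_space M p" if "i \<in> {1..j}" "p \<in> W" for i p
      using smooth_field_tangent[OF X[OF that(1)] that(2)] .
    note FT = smooth_field_tangent[OF FS] and PT = smooth_field_tangent[OF PS] and ZT = smooth_field_tangent[OF ZS]
    have Psp: "P p \<in> span ((\<lambda>i. X i p) ` {1..j})" for p
      unfolding P_def by (intro span_sum span_scale span_base) auto
    have Z0: "Z p \<noteq> 0" if p: "p \<in> W" for p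
    proof
      assume "Z p = 0"
      then have "?F p = - P p" by (simp add: Z_def eq_neg_iff_add_eq_0)
      then have "?F p \<in> span ((\<lambda>i. F i p) ` {1..j})"
        using Psp[of p] sp[OF p] by (simp add: span_neg)
      moreover have "(\<lambda>i. F i p) ` {1..j} \<subseteq> (\<lambda>i. F i p) ` {1..k} - {?F p}"
      proof
        fix v assume "v \<in> (\<lambda>i. F i p) ` {1..j}"
        then obtain i where i: "i \<in> {1..j}" "v = F i p" by blast
        have "F i p \<noteq> ?F p"
          using inj_on_eq_iff[OF inj[OF p], of i "Suc j"] i(1) Suc.prems by auto
        then show "v \<in> (\<lambda>i. F i p) ` {1..k} - {?F p}" using i Suc.prems by auto
      qed
      ultimately have "?F p \<in> span ((\<lambda>i. F i p) ` {1..k} - {?F p})" using span_mono by blast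
      moreover have "?F p \<in> (\<lambda>i. F i p) ` {1..k}" using Suc.prems by auto
      ultimately show False using ind[OF p] unfolding dependent_def by blast
    qed
    define n where "n q = g q (Z q) (Z q)" for q
    have npos: "0 < n p" if "p \<in> W" for p
      unfolding n_def by (rule ip_pos[OF ip[OF that] T ZT[OF that] Z0[OF that]])
    define a where "a q = inverse (sqrt (n q))" for q
    have aS: "smooth_fun M W a"
      unfolding a_def by (intro smooth_fun_inverse_sqrt[OF M W] npos) (simp add: n_def gs ZS)
    have apos: "0 < a p" "a p * a p * n p = 1" if "p \<in> W" for p
      using npos[OF that] by (auto simp: a_def field_simps)
    define Y where "Y q = a q *\<^sub>R Z q" for q
    have YS: "smooth_field M W Y" unfolding Y_def by (rule smooth_field_scale[OF M aS ZS])
    have gZX: "g p (Z p) (X l p) = 0" if p: "p \<in> W" and l: "l \<in> {1..j}" for p l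
    proof -
      have "g p (P p) (X l p) = (\<Sum>i\<in>{1..j}. r i p * g p (X i p) (X l p))"
        unfolding P_def by (rule ip_sum_left[OF ip[OF p] T]) (use XT p l in auto)
      also have "\<dots> = (\<Sum>i\<in>{1..j}. if i = l then r i p else 0)"
        by (rule sum.cong) (use on[OF p] l in auto)
      also have "\<dots> = r l p" using l by simp
      finally show ?thesis
        unfolding Z_def ip_add_left[OF ip[OF p] T FT[OF p] PT[OF p] XT[OF l p]] by (simp add: r_def)
    qed
    have gYX: "g p (Y p) (X l p) = 0" if "p \<in> W" "l \<in> {1..j}" for p l
      unfolding Y_def ip_scale_left[OF ip[OF that(1)] T ZT[OF that(1)] XT[OF that(2,1)]]
      using gZX[OF that] by simp
    have gYY: "g p (Y p) (Y p) = 1" if p: "p \<in> W" for p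
    proof -
      have "g p (Y p) (Y p) = a p * g p (Z p) (Y p)"
        unfolding Y_def by (intro ip_scale_left[OF ip[OF p] T] subspace_scale[OF T] ZT[OF p])
      also have "g p (Z p) (Y p) = g p (Y p) (Z p)"
        by (rule ip_commute[OF ip[OF p] T ZT[OF p] smooth_field_tangent[OF YS p]])
      also have "g p (Y p) (Z p) = a p * n p"
        unfolding Y_def n_def by (intro ip_scale_left[OF ip[OF p] T] ZT[OF p])
      finally show ?thesis using apos(2)[OF p] by simp
    qed
    have spY: "span (insert (Y p) ((\<lambda>i. X i p) ` {1..j})) = span (insert (?F p) ((\<lambda>i. F i p) ` {1..j}))"
      if p: "p \<in> W" for p
    proof -
      let ?A = "(\<lambda>i. X i p) ` {1..j}" and ?B = "(\<lambda>i. F i p) ` {1..j}"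
      have P1: "P p \<in> span (insert v ?A)" and P2: "P p \<in> span (insert v ?B)" for v
        using Psp[of p] sp[OF p] span_mono[OF subset_insertI, of ?A v] span_mono[OF subset_insertI, of ?B v] by auto
      have "Y p \<in> span (insert (?F p) ?B)"
        unfolding Y_def Z_def by (intro span_scale span_add span_base P2) simp
      moreover have "?A \<subseteq> span (insert (?F p) ?B)"
        using span_superset[of ?A] sp[OF p] span_mono[OF subset_insertI, of ?B "?F p"] by auto
      moreover have "?F p \<in> span (insert (Y p) ?A)"
      proof -
        have "?F p = inverse (a p) *\<^sub>R Y p - P p" using apos(1)[OF p] by (simp add: Y_def Z_def)
        then show ?thesis by (simp only:) (intro span_diff span_scale span_base P1, simp)
      qed
      moreover have "?B \<subseteq> span (insert (Y p) ?A)"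
        using span_superset[of ?B] sp[OF p] span_mono[OF subset_insertI, of ?A "Y p"] by auto
      ultimately show ?thesis unfolding span_eq by blast
    qed
    define X' where "X' = X(Suc j := Y)"
    have I: "{1..Suc j} = insert (Suc j) {1..j}" by auto
    have X': "X' (Suc j) = Y" "\<And>i. i \<in> {1..j} \<Longrightarrow> X' i = X i" by (auto simp: X'_def)
    have im: "(\<lambda>i. X' i p) ` {1..j} = (\<lambda>i. X i p) ` {1..j}" for p by (intro image_cong) (auto simp: X')
    show ?case
    proof (intro exI[of _ X'] conjI ballI)
      show "smooth_field M W (X' i)" if "i \<in> {1..Suc j}" for i
        using that X YS X' unfolding I by auto
      show "span ((\<lambda>i. X' i p) ` {1..Suc j}) = span ((\<lambda>i. F i p) ` {1..Suc j})" if "p \<in> W" for p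
        using spY[OF that] unfolding I image_insert im X' .
      fix p i l assume p: "p \<in> W" and il: "i \<in> {1..Suc j}" "l \<in> {1..Suc j}"
      have gXY: "g p (X m p) (Y p) = 0" if "m \<in> {1..j}" for m
        using gYX[OF p that] ip_commute[OF ip[OF p] T XT[OF that p] smooth_field_tangent[OF YS p]] by simp
      consider "i = Suc j" "l = Suc j" | "i = Suc j" "l \<in> {1..j}" | "i \<in> {1..j}" "l = Suc j"
        | "i \<in> {1..j}" "l \<in> {1..j}"
        using il unfolding I by auto
      then show "g p (X' i p) (X' l p) = (if i = l then 1 else 0)"
        by cases (use gYY[OF p] gYX[OF p] gXY on[OF p] X' in auto)
    qed
  qed
  from this[OF order_refl] show thesis using that by blast
qed

text \<open>
  The geodesic fields are in general mutually orthogonal only at the base point. Nearby their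
  coefficient matrix in an orthonormal frame is close to the identity, hence diagonally dominant and invertible.
\<close>

lemma near_identity_frame:
  fixes X E :: "nat \<Rightarrow> 'v::real_vector" and U :: "nat \<Rightarrow> nat \<Rightarrow> real"
  assumes ip: "inner_product_on V ip" and V: "subspace V"
    and XV: "\<And>i. i \<in> {1..k} \<Longrightarrow> X i \<in> V"
    and on: "\<And>i j. i \<in> {1..k} \<Longrightarrow> j \<in> {1..k} \<Longrightarrow> ip (X i) (X j) = (if i = j then 1 else 0)"
    and U: "\<And>i l. i \<in> {1..k} \<Longrightarrow> l \<in> {1..k} \<Longrightarrow> \<bar>U i l - (if i = l then 1 else 0)\<bar> < 1 / (real k + 1)"
    and E: "\<And>i. i \<in> {1..k} \<Longrightarrow> E i = (\<Sum>l\<in>{1..k}. U i l *\<^sub>R X l)"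
  shows "inj_on E {1..k}" "independent (E ` {1..k})" "span (E ` {1..k}) = span (X ` {1..k})"
proof -
  let ?K = "{1..k}"
  have EV: "E i \<in> V" if "i \<in> ?K" for i
    unfolding E[OF that] by (intro subspace_sum V subspace_scale XV)
  have gE: "ip (E i) (X j) = U i j" if "i \<in> ?K" "j \<in> ?K" for i j
  proof -
    have "ip (E i) (X j) = (\<Sum>l\<in>?K. U i l * ip (X l) (X j))"
      unfolding E[OF that(1)] by (rule ip_sum_left[OF ip V XV XV[OF that(2)]])
    also have "\<dots> = (\<Sum>l\<in>?K. if l = j then U i l else 0)"
      by (rule sum.cong) (use on that in auto)
    finally show ?thesis using that by simp
  qed
  \<comment> \<open>If \<open>\<bar>r j\<bar>\<close> is largest, pairing the relation with \<open>X j\<close> yields \<open>\<bar>r j\<bar> \<le> k / (k + 1) \<bar>r j\<bar>\<close>.\<close>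
  have zero: "r m = 0" if r: "(\<Sum>i\<in>?K. r i *\<^sub>R E i) = 0" and m: "m \<in> ?K" for r :: "nat \<Rightarrow> real" and m
  proof -
    let ?R = "Max ((\<lambda>i. \<bar>r i\<bar>) ` ?K)"
    have ne: "(\<lambda>i. \<bar>r i\<bar>) ` ?K \<noteq> {}" using m by auto
    have le: "\<bar>r i\<bar> \<le> ?R" if "i \<in> ?K" for i by (rule Max_ge) (use that in auto)
    have "?R \<in> (\<lambda>i. \<bar>r i\<bar>) ` ?K" by (rule Max_in) (use ne in auto)
    then obtain j where j: "j \<in> ?K" "?R = \<bar>r j\<bar>" by blast
    have "(\<Sum>i\<in>?K. r i * U i j) = (\<Sum>i\<in>?K. r i * ip (E i) (X j))"
      by (rule sum.cong) (simp_all only: gE j(1))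
    also have "\<dots> = ip (\<Sum>i\<in>?K. r i *\<^sub>R E i) (X j)"
      by (rule ip_sum_left[OF ip V EV XV[OF j(1)], symmetric])
    also have "\<dots> = 0" unfolding r by (rule ip_zero_left[OF ip V XV[OF j(1)]])
    finally have 0: "(\<Sum>i\<in>?K. r i * U i j) = 0" .
    have "r j = (\<Sum>i\<in>?K. r i * (if i = j then 1 else 0))"
      using j(1) by (simp add: if_distrib cong: if_cong)
    also have "\<dots> = (\<Sum>i\<in>?K. r i * ((if i = j then 1 else 0) - U i j))"
      using 0 by (simp add: right_diff_distrib sum_subtractf)
    finally have rj: "r j = (\<Sum>i\<in>?K. r i * ((if i = j then 1 else 0) - U i j))" .
    have "\<bar>r j\<bar> \<le> (\<Sum>i\<in>?K. \<bar>r i * ((if i = j then 1 else 0) - U i j)\<bar>)"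
      by (subst rj) (rule sum_abs)
    also have "\<dots> \<le> (\<Sum>i\<in>?K. \<bar>r j\<bar> * (1 / (real k + 1)))"
    proof (rule sum_mono)
      fix i assume i: "i \<in> ?K"
      have "\<bar>(if i = j then 1 else 0) - U i j\<bar> \<le> 1 / (real k + 1)"
        using U[OF i j(1)] by (simp only: abs_minus_commute)
      then show "\<bar>r i * ((if i = j then 1 else 0) - U i j)\<bar> \<le> \<bar>r j\<bar> * (1 / (real k + 1))"
        unfolding abs_mult using le[OF i] j(2) by (intro mult_mono) auto
    qed
    also have "\<dots> = \<bar>r j\<bar> * (real k / (real k + 1))" by simp
    finally have "\<bar>r j\<bar> * (1 - real k / (real k + 1)) \<le> 0" by (simp add: algebra_simps)
    then have "\<bar>r j\<bar> \<le> 0" by (simp add: field_simps mult_le_0_iff)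
    then show ?thesis using le[OF m] j(2) by simp
  qed
  show inj: "inj_on E ?K"
  proof (rule inj_onI, rule ccontr)
    fix i j assume ij: "i \<in> ?K" "j \<in> ?K" "E i = E j" "i \<noteq> j"
    let ?r = "\<lambda>m. (if m = i then 1 else 0) - (if m = j then 1 else 0) :: real"
    have "(\<Sum>m\<in>?K. ?r m *\<^sub>R E m) = (\<Sum>m\<in>?K. if m = i then E m else 0) - (\<Sum>m\<in>?K. if m = j then E m else 0)"
      unfolding sum_subtractf[symmetric] by (rule sum.cong) auto
    also have "\<dots> = 0" using ij by simp
    finally have "?r i = 0" by (rule zero) (use ij in simp)
    with ij(4) show False by simp
  qed
  show ind: "independent (E ` ?K)"
  proof (rule independent_if_scalars_zero)
    fix f x assume f: "(\<Sum>x\<in>E ` ?K. f x *\<^sub>R x) = 0" and "x \<in> E ` ?K"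
    then obtain m where m: "m \<in> ?K" "x = E m" by blast
    have "(\<Sum>i\<in>?K. f (E i) *\<^sub>R E i) = 0" using f unfolding sum.reindex[OF inj] o_def .
    from zero[OF this m(1)] show "f x = 0" by (simp add: m(2))
  qed simp
  have EX: "E ` ?K \<subseteq> span (X ` ?K)"
  proof (rule image_subsetI)
    fix i assume i: "i \<in> ?K"
    show "E i \<in> span (X ` ?K)"
      unfolding E[OF i] by (intro span_sum span_scale span_base imageI)
  qed
  have "X ` ?K \<subseteq> span (E ` ?K)"
  proof (rule ccontr)
    assume "\<not> X ` ?K \<subseteq> span (E ` ?K)"
    then obtain z where z: "z \<in> X ` ?K" "z \<notin> span (E ` ?K)" by blast
    then have "independent (insert z (E ` ?K))" using ind by (simp add: independent_insert)
    moreover have "insert z (E ` ?K) \<subseteq> span (X ` ?K)" using span_base[OF z(1)] EX by blast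
    ultimately have "card (insert z (E ` ?K)) \<le> card (X ` ?K)"
      using independent_span_bound[of "X ` ?K"] by blast
    also have "\<dots> \<le> k" using card_image_le[of ?K X] by simp
    finally have "card (insert z (E ` ?K)) \<le> k" .
    moreover have "z \<notin> E ` ?K" using z(2) span_superset[of "E ` ?K"] by blast
    moreover have "card (E ` ?K) = k" using card_image[OF inj] by simp
    ultimately show False by simp
  qed
  with EX show "span (E ` ?K) = span (X ` ?K)" unfolding span_eq by blast
qed

section \<open>Geodesic frames\<close>

lemma chart_diff_sum:
  "chart_diff c (\<Sum>i\<in>J. r i *\<^sub>R v i) = (\<Sum>i\<in>J. r i *\<^sub>R chart_diff c (v i))"
proof -
  have "chart_diff c (\<Sum>i\<in>J. r i *\<^sub>R v i) = (\<Sum>b\<in>Basis. \<Sum>i\<in>J. (r i * v i (coord c b)) *\<^sub>R b)"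
    unfolding chart_diff_def sum_tangent_apply by (simp add: scaleR_fun_def scaleR_sum_left)
  also have "\<dots> = (\<Sum>i\<in>J. \<Sum>b\<in>Basis. (r i * v i (coord c b)) *\<^sub>R b)" by (rule sum.swap)
  finally show ?thesis by (simp add: chart_diff_def scaleR_sum_right)
qed

text \<open>
  Metric compatibility, applied to an inner product that is constant and hence annihilated by \<open>X\<close>.
\<close>

lemma christoffel_antisymmetric:
  assumes M: "smooth_manifold M" and g: "riemannian_metric M g" and LC: "levi_civita M g nabla"
    and W: "openin (mtop M) W" and S: "smooth_field M W X" "smooth_field M W Y" "smooth_field M W Z"
    and const: "\<And>q. q \<in> W \<Longrightarrow> g q (Y q) (Z q) = r" and p: "p \<in> W"
  shows "g p (nabla X Y p) (Z p) + g p (nabla X Z p) (Y p) = 0"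
proof -
  have pM: "p \<in> carrier M" using openin_subset[OF W] p by auto
  have conn: "connection M nabla" using LC by (simp add: levi_civita_def)
  have ip: "inner_product_on (tangent_space M p) (g p)" using g pM by (simp add: riemannian_metric_def)
  have T: "X p \<in> tangent_space M p" by (rule smooth_field_tangent[OF S(1) p])
  have "X p (\<lambda>q. g q (Y q) (Z q)) = X p (\<lambda>q. r)"
    by (rule tangent_germ[OF T smooth_near_const[OF M pM] W p, symmetric]) (simp add: const)
  also have "\<dots> = 0" by (rule tangent_const[OF M pM T])
  finally have 0: "X p (\<lambda>q. g q (Y q) (Z q)) = 0" .
  note LCW = mp[OF spec[OF conjunct2[OF LC[unfolded levi_civita_def]], of W] W]
  have "\<forall>X Y Z. smooth_field M W X \<and> smooth_field M W Y \<and> smooth_field M W Z \<longrightarrow>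
      (\<forall>p\<in>W. X p (\<lambda>q. g q (Y q) (Z q)) = g p (nabla X Y p) (Z p) + g p (Y p) (nabla X Z p))"
    using LCW by (elim conjE)
  then have "X p (\<lambda>q. g q (Y q) (Z q)) = g p (nabla X Y p) (Z p) + g p (Y p) (nabla X Z p)"
    using S p by blast
  moreover have "g p (Y p) (nabla X Z p) = g p (nabla X Z p) (Y p)"
    by (rule ip_commute[OF ip subspace_tangent_space smooth_field_tangent[OF S(2) p]
        smooth_field_tangent[OF nabla_smooth[OF conn W S(1,3)] p]])
  ultimately show ?thesis using 0 by simp
qed

text \<open>
  For \<open>E = (\<Sum>i. u\<^sub>i X\<^sub>i)\<close> with an orthonormal frame \<open>X\<close> and
  \<open>\<Gamma> l i j = g (nabla X\<^sub>i X\<^sub>j, X\<^sub>l)\<close>, the component of \<open>nabla E E\<close> along \<open>X\<^sub>l\<close> is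
  \<open>E u\<^sub>l + (\<Sum>i j. \<Gamma> l i j u\<^sub>i u\<^sub>j)\<close>. Setting all of them to 0 is a quasilinear equation for \<open>u\<close>,
  solved in the chart with the value \<open>u = e\<^sub>m\<close> at \<open>y\<close>. The antisymmetry
  \<open>\<Gamma> l i j = - \<Gamma> j i l\<close> makes the squared length of \<open>u\<close> constant along characteristics: geodesics have
  constant speed.
\<close>

lemma geodesic_field:
  fixes M :: "('a, 'e::euclidean_space) mfd" and X :: "nat \<Rightarrow> 'a field"
  assumes M: "smooth_manifold M" and g: "riemannian_metric M g" and LC: "levi_civita M g nabla"
    and c: "c \<in> atlas M" and W: "openin (mtop M) W" "W \<subseteq> fst c" and y: "y \<in> W"
    and k: "k < DIM('e)"
    and X: "\<And>i. i \<in> {1..k} \<Longrightarrow> smooth_field M W (X i)"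
    and on: "\<And>p i j. p \<in> W \<Longrightarrow> i \<in> {1..k} \<Longrightarrow> j \<in> {1..k} \<Longrightarrow> g p (X i p) (X j p) = (if i = j then 1 else 0)"
    and m: "m \<in> {1..k}" and "0 < \<epsilon>"
  obtains N u where "openin (mtop M) N" "y \<in> N" "N \<subseteq> W"
    "\<And>l. l \<in> {1..k} \<Longrightarrow> smooth_fun M N (u l)"
    "\<And>p. p \<in> N \<Longrightarrow> (\<Sum>l\<in>{1..k}. (u l p)\<^sup>2) = 1"
    "\<And>p l. p \<in> N \<Longrightarrow> l \<in> {1..k} \<Longrightarrow> \<bar>u l p - (if m = l then 1 else 0)\<bar> < \<epsilon>"
    "\<And>p l. p \<in> N \<Longrightarrow> l \<in> {1..k} \<Longrightarrow>
      (\<Sum>i\<in>{1..k}. u i p *\<^sub>R X i p) (u l) =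
      - (\<Sum>j\<in>{1..k}. \<Sum>i\<in>{1..k}. u j p * u i p * g p (nabla (X i) (X j) p) (X l p))"
proof -
  let ?K = "{1..k}"
  note T = subspace_tangent_space
  have conn: "connection M nabla" using LC by (simp add: levi_civita_def)
  \<comment> \<open>The \<open>k\<close> unknowns are coordinates of one vector of the model space, whose dimension exceeds \<open>k\<close>.\<close>
  obtain \<beta> :: "nat \<Rightarrow> 'e" where \<beta>: "\<beta> ` ?K \<subseteq> Basis" "inj_on \<beta> ?K"
    using card_le_inj[of ?K "Basis :: 'e set"] k by auto
  have \<beta>\<beta>: "\<beta> i \<bullet> \<beta> j = (if i = j then 1 else 0)" if "i \<in> ?K" "j \<in> ?K" for i j
  proof -
    have "\<beta> i \<in> Basis" "\<beta> j \<in> Basis" using \<beta>(1) that by auto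
    then show ?thesis using inj_on_eq_iff[OF \<beta>(2) that] by (simp add: inner_Basis)
  qed
  define \<Gamma> where "\<Gamma> l i j p = g p (nabla (X i) (X j) p) (X l p)" for l i j p
  have \<Gamma>S: "smooth_fun M W (\<Gamma> l i j)" if "l \<in> ?K" "i \<in> ?K" "j \<in> ?K" for l i j
    using g W(1) nabla_smooth[OF conn W(1) X[OF that(2)] X[OF that(3)]] X[OF that(1)]
    unfolding riemannian_metric_def \<Gamma>_def by blast
  have anti: "\<Gamma> l i j p = - \<Gamma> j i l p" if "l \<in> ?K" "i \<in> ?K" "j \<in> ?K" "p \<in> W" for l i j p
  proof -
    have "g p (nabla (X i) (X j) p) (X l p) + g p (nabla (X i) (X l) p) (X j p) = 0"
      by (rule christoffel_antisymmetric[where r = "if j = l then 1 else 0",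
          OF M g LC W(1) X[OF that(2)] X[OF that(3)] X[OF that(1)] _ that(4)])
        (rule on[OF _ that(3,1)])
    then show ?thesis by (simp add: \<Gamma>_def)
  qed
  define U where "U = snd c ` W"
  have U: "open U" unfolding U_def by (rule chart_open_image'[OF M c W])
  have inv: "chart_inv c x \<in> W" if "x \<in> U" for x
    using chart_inv_image[OF M c _ W(2)] that by (simp add: U_def)
  define X' where "X' i x = chart_diff c (X i (chart_inv c x))" for i x
  have X'S: "Ck_on n U (X' i)" if "i \<in> ?K" for n i
    unfolding X'_def chart_diff_def
  proof (intro Ck_on_sum Ck_on_scaleR Ck_on_const U)
    fix b :: 'e
    have "smooth_fun M W (\<lambda>p. X i p (coord c b))"
      by (rule smooth_field_apply[OF X[OF that] W(1) smooth_fun_subset[OF smooth_fun_coord[OF M c] W(2)]])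
    then show "Ck_on n U (\<lambda>x. X i (chart_inv c x) (coord c b))"
      using smooth_fun_iff_chart[OF M c W] by (simp add: U_def smooth_on_def)
  qed
  have \<Gamma>'S: "Ck_on n U (\<lambda>x. \<Gamma> l i j (chart_inv c x))" if "l \<in> ?K" "i \<in> ?K" "j \<in> ?K" for n l i j
    using \<Gamma>S[OF that] smooth_fun_iff_chart[OF M c W] by (simp add: U_def smooth_on_def)
  let ?S = "U \<times> (UNIV :: 'e set)"
  have S: "open ?S" using U by (simp add: open_Times)
  have fstS: "Ck_on n ?S (\<lambda>z. h (fst z))" if "Ck_on n U h" for n and h :: "'e \<Rightarrow> 'f::real_normed_vector"
    by (rule Ck_on_compose[OF S U _ Ck_on_bounded_linear[OF S bounded_linear_fst] that]) auto
  have sndS: "Ck_on n ?S (\<lambda>z. snd z \<bullet> b)" for n and b :: 'e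
    by (intro Ck_on_inner_left S Ck_on_bounded_linear bounded_linear_snd)
  define V where "V z = (\<Sum>i\<in>?K. (snd z \<bullet> \<beta> i) *\<^sub>R X' i (fst z))" for z
  define G where "G z = - (\<Sum>l\<in>?K. (\<Sum>j\<in>?K. \<Sum>i\<in>?K. (snd z \<bullet> \<beta> j) * (snd z \<bullet> \<beta> i) * \<Gamma> l i j (chart_inv c (fst z))) *\<^sub>R \<beta> l)" for z
  have VS: "smooth_on ?S V"
    unfolding smooth_on_def V_def
    by (intro allI Ck_on_sum Ck_on_scaleR S sndS fstS X'S)
  have GS: "smooth_on ?S G"
    unfolding smooth_on_def G_def
    by (intro allI Ck_on_minus Ck_on_sum Ck_on_scaleR Ck_on_mult Ck_on_const S sndS fstS[OF \<Gamma>'S])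
  have G\<beta>: "G z \<bullet> \<beta> l = - (\<Sum>j\<in>?K. \<Sum>i\<in>?K. (snd z \<bullet> \<beta> j) * (snd z \<bullet> \<beta> i) * \<Gamma> l i j (chart_inv c (fst z)))"
    if "l \<in> ?K" for z l
  proof -
    let ?G = "\<lambda>l. \<Sum>j\<in>?K. \<Sum>i\<in>?K. (snd z \<bullet> \<beta> j) * (snd z \<bullet> \<beta> i) * \<Gamma> l i j (chart_inv c (fst z))"
    have "G z \<bullet> \<beta> l = - (\<Sum>h\<in>?K. ?G h * (\<beta> h \<bullet> \<beta> l))"
      by (simp add: G_def inner_sum_left)
    also have "(\<Sum>h\<in>?K. ?G h * (\<beta> h \<bullet> \<beta> l)) = (\<Sum>h\<in>?K. if h = l then ?G h else 0)"
      by (rule sum.cong) (use \<beta>\<beta> that in auto)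
    also have "\<dots> = ?G l" using that by simp
    finally show ?thesis .
  qed
  define y0 where "y0 = snd c y"
  have y0: "y0 \<in> U" "chart_inv c y0 = y"
    using y W(2) chart_inv_left[OF M c] by (auto simp: y0_def U_def)
  have "V (y0, \<beta> m) \<noteq> 0"
  proof
    assume "V (y0, \<beta> m) = 0"
    moreover have "V (y0, \<beta> m) = (\<Sum>i\<in>?K. if i = m then X' i y0 else 0)"
      unfolding V_def by (rule sum.cong) (use \<beta>\<beta> m in auto)
    ultimately have "chart_diff c (X m y) = 0" using m by (simp add: X'_def y0)
    then have "X m y (coord c b) = 0" if "b \<in> Basis" for b
      using that inner_sum_left_Basis[of b "\<lambda>b. X m y (coord c b)"] unfolding chart_diff_def by simp
    then have "X m y = 0"
      using tangent_chart_representation[OF M c _ smooth_field_tangent[OF X[OF m] y]] y W(2) by auto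
    moreover have "g y (X m y) (X m y) = 1" using on[OF y m m] by simp
    moreover have "inner_product_on (tangent_space M y) (g y)"
      using g openin_subset[OF W(1)] y unfolding riemannian_metric_def by blast
    ultimately show False
      using ip_zero_left[OF _ T subspace_0[OF T]] by fastforce
  qed
  note nz = this
  define Q where "Q w = (\<Sum>l\<in>?K. (w \<bullet> \<beta> l)\<^sup>2)" for w
  define Q' where "Q' w h = (\<Sum>l\<in>?K. 2 * (w \<bullet> \<beta> l) * (h \<bullet> \<beta> l))" for w h
  have QD: "(Q has_derivative Q' w) (at w)" for w
    unfolding Q_def Q'_def by (rule derivative_eq_intros refl | simp add: algebra_simps)+
  \<comment> \<open>Exchanging \<open>l\<close> and \<open>j\<close> changes the sign of the sum of all \<open>\<Gamma> l i j u\<^sub>l u\<^sub>i u\<^sub>j\<close>.\<close>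
  have Q0: "Q' w (G (x, w)) = 0" if x: "x \<in> U" for x w
  proof -
    let ?a = "\<lambda>i. w \<bullet> \<beta> i" and ?p = "chart_inv c x"
    define s where "s = (\<Sum>l\<in>?K. \<Sum>j\<in>?K. \<Sum>i\<in>?K. ?a l * ?a j * ?a i * \<Gamma> l i j ?p)"
    have "s = (\<Sum>j\<in>?K. \<Sum>l\<in>?K. \<Sum>i\<in>?K. ?a l * ?a j * ?a i * \<Gamma> l i j ?p)"
      unfolding s_def by (rule sum.swap)
    also have "\<dots> = (\<Sum>j\<in>?K. \<Sum>l\<in>?K. \<Sum>i\<in>?K. - (?a j * ?a l * ?a i * \<Gamma> j i l ?p))"
    proof (intro sum.cong refl)
      fix j l i assume "j \<in> ?K" "l \<in> ?K" "i \<in> ?K"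
      from anti[OF this(2,3,1) inv[OF x]]
      show "?a l * ?a j * ?a i * \<Gamma> l i j ?p = - (?a j * ?a l * ?a i * \<Gamma> j i l ?p)" by simp
    qed
    also have "\<dots> = - s" by (simp add: s_def sum_negf)
    finally have s: "s = 0" by simp
    have "Q' w (G (x, w)) = (\<Sum>l\<in>?K. - 2 * (\<Sum>j\<in>?K. \<Sum>i\<in>?K. ?a l * ?a j * ?a i * \<Gamma> l i j ?p))"
      unfolding Q'_def by (rule sum.cong) (simp_all add: G\<beta> sum_distrib_left mult.assoc sum_negf)
    also have "\<dots> = - 2 * s" by (simp only: s_def sum_distrib_left)
    finally show ?thesis using s by simp
  qed
  obtain N0 w where N0: "open N0" "y0 \<in> N0" "N0 \<subseteq> U" and w: "smooth_on N0 w" "w y0 = \<beta> m"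
    and pde: "\<And>x. x \<in> N0 \<Longrightarrow> frechet_derivative w (at x) (V (x, w x)) = G (x, w x)"
    and cons: "\<And>x. x \<in> N0 \<Longrightarrow> Q (w x) = Q (\<beta> m)"
    using quasilinear_first_order[OF U VS GS y0(1) nz QD Q0] by blast
  define N1 where "N1 = N0 \<inter> w -` ball (\<beta> m) \<epsilon>"
  have N1: "open N1" "y0 \<in> N1" "N1 \<subseteq> N0"
    unfolding N1_def using continuous_open_preimage[OF smooth_on_continuous_on[OF w(1)] N0(1) open_ball] N0 w(2) \<open>0 < \<epsilon>\<close>
    by auto
  define N where "N = {p \<in> fst c. snd c p \<in> N1}"
  define u where "u l p = w (snd c p) \<bullet> \<beta> l" for l p
  have N: "openin (mtop M) N" unfolding N_def by (rule chart_open_preimage[OF M c N1(1)])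
  have NW: "N \<subseteq> W"
  proof
    fix p assume "p \<in> N"
    then have "p \<in> fst c" "snd c p \<in> U" using N1 N0 by (auto simp: N_def)
    then show "p \<in> W" using inv chart_inv_left[OF M c] by metis
  qed
  have Nc: "N \<subseteq> fst c" by (auto simp: N_def)
  have uS: "smooth_fun M N (u l)" for l
  proof -
    have o: "open (snd c ` N)" by (rule chart_open_image'[OF M c N Nc])
    have "Ck_on n (snd c ` N) (\<lambda>x. w x \<bullet> \<beta> l)" for n
    proof (intro Ck_on_inner_left o)
      show "Ck_on n (snd c ` N) w"
      proof (rule Ck_on_subset)
        show "Ck_on n N0 w" using w(1) by (simp add: smooth_on_def)
        show "snd c ` N \<subseteq> N0" using N1(3) by (auto simp: N_def)
      qed
    qed
    moreover have "u l (chart_inv c x) = w x \<bullet> \<beta> l" if "x \<in> snd c ` N" for x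
      using chart_inv_right(1)[OF that Nc] by (simp add: u_def)
    ultimately show ?thesis
      unfolding smooth_fun_iff_chart[OF M c N Nc] smooth_on_def
      using Ck_on_cong[OF o, of "\<lambda>x. u l (chart_inv c x)" "\<lambda>x. w x \<bullet> \<beta> l"] by simp
  qed
  show thesis
  proof (rule that[OF N _ NW uS])
    show "y \<in> N" using y W(2) N1(2) by (auto simp: N_def y0_def)
  next
    fix p assume p: "p \<in> N"
    then have x: "snd c p \<in> N0" "snd c p \<in> N1" using N1 by (auto simp: N_def)
    have "Q (\<beta> m) = (\<Sum>l\<in>?K. if l = m then 1 else 0)"
      unfolding Q_def by (rule sum.cong) (use \<beta>\<beta> m in auto)
    then show "(\<Sum>l\<in>?K. (u l p)\<^sup>2) = 1" using cons[OF x(1)] m by (simp add: Q_def u_def)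
    fix l assume l: "l \<in> ?K"
    have "u l p - (if m = l then 1 else 0) = (w (snd c p) - \<beta> m) \<bullet> \<beta> l"
      by (simp add: u_def inner_diff_left \<beta>\<beta>[OF m l])
    also have "\<bar>\<dots>\<bar> \<le> norm (w (snd c p) - \<beta> m)"
      by (rule Basis_le_norm) (use \<beta>(1) l in auto)
    also have "\<dots> < \<epsilon>" using x(2) by (simp add: N1_def dist_norm norm_minus_commute)
    finally show "\<bar>u l p - (if m = l then 1 else 0)\<bar> < \<epsilon>" .
    have pc: "p \<in> fst c" using p Nc by auto
    have pW: "p \<in> W" using p NW by auto
    let ?E = "\<Sum>i\<in>?K. u i p *\<^sub>R X i p" and ?x = "snd c p"
    have ET: "?E \<in> tangent_space M p"
      by (intro subspace_sum T subspace_scale smooth_field_tangent[OF X pW])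
    have Ed: "chart_diff c ?E = V (?x, w ?x)"
      unfolding chart_diff_sum V_def X'_def by (simp add: u_def chart_inv_left[OF M c pc])
    have "(w has_derivative frechet_derivative w (at ?x)) (at ?x)"
      by (rule smooth_on_has_derivative[OF w(1) x(1)])
    then have d: "((\<lambda>z. w z \<bullet> \<beta> l) has_derivative (\<lambda>h. frechet_derivative w (at ?x) h \<bullet> \<beta> l)) (at ?x)"
      by (rule bounded_linear.has_derivative[OF bounded_linear_inner_left])
    have d': "((\<lambda>z. u l (chart_inv c z)) has_derivative (\<lambda>h. frechet_derivative w (at ?x) h \<bullet> \<beta> l)) (at ?x)"
    proof (rule has_derivative_transform_within_open[OF d])
      show "open (snd c ` N)" by (rule chart_open_image'[OF M c N Nc])
      show "?x \<in> snd c ` N" using p by simp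
      show "w z \<bullet> \<beta> l = u l (chart_inv c z)" if "z \<in> snd c ` N" for z
        using chart_inv_right(1)[OF that Nc] by (simp add: u_def)
    qed
    have "?E (u l) = frechet_derivative (\<lambda>z. u l (chart_inv c z)) (at ?x) (chart_diff c ?E)"
      by (rule tangent_apply_chart_diff[OF M c pc ET smooth_nearI[OF uS N p]])
    also have "\<dots> = G (?x, w ?x) \<bullet> \<beta> l"
      unfolding frechet_derivative_at[OF d', symmetric] Ed pde[OF x(1)] ..
    also have "\<dots> = - (\<Sum>j\<in>?K. \<Sum>i\<in>?K. u j p * u i p * g p (nabla (X i) (X j) p) (X l p))"
      unfolding G\<beta>[OF l] by (simp add: u_def \<Gamma>_def chart_inv_left[OF M c pc])
    finally show "?E (u l) = - (\<Sum>j\<in>?K. \<Sum>i\<in>?K. u j p * u i p * g p (nabla (X i) (X j) p) (X l p))" .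
  qed
qed

text \<open>
  By the product rule, \<open>g (nabla E E, X\<^sub>l) = E u\<^sub>l + (\<Sum>i j. u\<^sub>i u\<^sub>j g (nabla X\<^sub>i X\<^sub>j, X\<^sub>l))\<close>, and
  the equation for \<open>u\<^sub>l\<close> says that this vanishes.
\<close>

lemma covariant_derivative_orthogonal:
  fixes M :: "('a, 'e::euclidean_space) mfd" and X :: "nat \<Rightarrow> 'a field"
  assumes M: "smooth_manifold M" and g: "riemannian_metric M g" and conn: "connection M nabla"
    and N: "openin (mtop M) N" and p: "p \<in> N"
    and X: "\<And>i. i \<in> {1..k} \<Longrightarrow> smooth_field M N (X i)"
    and on: "\<And>i j. i \<in> {1..k} \<Longrightarrow> j \<in> {1..k} \<Longrightarrow> g p (X i p) (X j p) = (if i = j then 1 else 0)"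
    and u: "\<And>i. i \<in> {1..k} \<Longrightarrow> smooth_fun M N (u i)"
    and geo: "\<And>l. l \<in> {1..k} \<Longrightarrow> (\<Sum>i\<in>{1..k}. u i p *\<^sub>R X i p) (u l) =
      - (\<Sum>j\<in>{1..k}. \<Sum>i\<in>{1..k}. u j p * u i p * g p (nabla (X i) (X j) p) (X l p))"
    and v: "v \<in> span ((\<lambda>i. X i p) ` {1..k})"
  defines "E \<equiv> \<lambda>q. \<Sum>i\<in>{1..k}. u i q *\<^sub>R X i q"
  shows "g p (nabla E E p) v = 0"
proof -
  let ?K = "{1..k}" and ?T = "tangent_space M p"
  note T = subspace_tangent_space
  have ip: "inner_product_on ?T (g p)"
    using g openin_subset[OF N] p unfolding riemannian_metric_def by blast
  have ES: "smooth_field M N E" unfolding E_def by (intro smooth_field_sum[OF M] u X)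
  have XT: "X i p \<in> ?T" if "i \<in> ?K" for i by (rule smooth_field_tangent[OF X[OF that] p])
  have nT: "nabla Y Z p \<in> ?T" if "smooth_field M N Y" "smooth_field M N Z" for Y Z
    by (rule smooth_field_tangent[OF nabla_smooth[OF conn N that] p])
  have 1: "nabla E E p = (\<Sum>j\<in>?K. E p (u j) *\<^sub>R X j p) + (\<Sum>j\<in>?K. u j p *\<^sub>R nabla E (X j) p)"
  proof -
    have "nabla E E p = nabla E (\<lambda>q. \<Sum>j\<in>?K. u j q *\<^sub>R X j q) p" by (simp only: E_def)
    also have "\<dots> = (\<Sum>j\<in>?K. E p (u j) *\<^sub>R X j p + u j p *\<^sub>R nabla E (X j) p)"
      by (intro nabla_sum_right[OF conn N M ES p] u X) simp
    finally show ?thesis by (simp only: sum.distrib)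
  qed
  have 2: "nabla E (X j) p = (\<Sum>i\<in>?K. u i p *\<^sub>R nabla (X i) (X j) p)" if "j \<in> ?K" for j
    unfolding E_def by (intro nabla_sum_left[OF conn N M X[OF that] p] u X) simp
  have basis: "g p (nabla E E p) (X l p) = 0" if l: "l \<in> ?K" for l
  proof -
    have s1: "(\<Sum>j\<in>?K. E p (u j) *\<^sub>R X j p) \<in> ?T" by (intro subspace_sum T subspace_scale XT)
    have s2: "(\<Sum>j\<in>?K. u j p *\<^sub>R nabla E (X j) p) \<in> ?T" by (intro subspace_sum T subspace_scale nT ES X)
    have "g p (\<Sum>j\<in>?K. E p (u j) *\<^sub>R X j p) (X l p) = (\<Sum>j\<in>?K. E p (u j) * g p (X j p) (X l p))"
      by (rule ip_sum_left[OF ip T XT XT[OF l]])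
    also have "\<dots> = (\<Sum>j\<in>?K. if j = l then E p (u j) else 0)"
      by (rule sum.cong) (use on l in auto)
    also have "\<dots> = E p (u l)" using l by simp
    finally have e1: "g p (\<Sum>j\<in>?K. E p (u j) *\<^sub>R X j p) (X l p) = E p (u l)" .
    have "g p (\<Sum>j\<in>?K. u j p *\<^sub>R nabla E (X j) p) (X l p) = (\<Sum>j\<in>?K. u j p * g p (nabla E (X j) p) (X l p))"
      by (rule ip_sum_left[OF ip T nT[OF ES X] XT[OF l]])
    also have "\<dots> = (\<Sum>j\<in>?K. \<Sum>i\<in>?K. u j p * u i p * g p (nabla (X i) (X j) p) (X l p))"
    proof (rule sum.cong[OF refl])
      fix j assume j: "j \<in> ?K"
      have "g p (nabla E (X j) p) (X l p) = (\<Sum>i\<in>?K. u i p * g p (nabla (X i) (X j) p) (X l p))"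
        unfolding 2[OF j] by (rule ip_sum_left[OF ip T nT[OF X X[OF j]] XT[OF l]])
      then show "u j p * g p (nabla E (X j) p) (X l p) = (\<Sum>i\<in>?K. u j p * u i p * g p (nabla (X i) (X j) p) (X l p))"
        by (simp add: sum_distrib_left mult.assoc)
    qed
    finally show ?thesis
      unfolding 1 ip_add_left[OF ip T s1 s2 XT[OF l]] e1 using geo[OF l] by (simp add: E_def)
  qed
  let ?O = "{v \<in> ?T. g p (nabla E E p) v = 0}"
  have D: "nabla E E p \<in> ?T" by (rule nT[OF ES ES])
  have comm: "g p (nabla E E p) v = g p v (nabla E E p)" if "v \<in> ?T" for v
    by (rule ip_commute[OF ip T D that])
  have "subspace ?O"
  proof (rule subspaceI)
    show "0 \<in> ?O" using comm[OF subspace_0[OF T]] ip_zero_left[OF ip T D] subspace_0[OF T] by simp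
    show "a + b \<in> ?O" if "a \<in> ?O" "b \<in> ?O" for a b
    proof -
      have ab: "a \<in> ?T" "b \<in> ?T" "g p (nabla E E p) a = 0" "g p (nabla E E p) b = 0" using that by auto
      show ?thesis
        using comm[OF subspace_add[OF T ab(1,2)]] ip_add_left[OF ip T ab(1,2) D] ab comm[OF ab(1)] comm[OF ab(2)]
          subspace_add[OF T ab(1,2)] by simp
    qed
    show "r *\<^sub>R a \<in> ?O" if "a \<in> ?O" for r a
    proof -
      have a: "a \<in> ?T" "g p (nabla E E p) a = 0" using that by auto
      show ?thesis
        using comm[OF subspace_scale[OF T a(1)]] ip_scale_left[OF ip T a(1) D] a comm[OF a(1)]
          subspace_scale[OF T a(1)] by simp
    qed
  qed
  moreover have "(\<lambda>i. X i p) ` ?K \<subseteq> ?O" using XT basis by blast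
  ultimately have "v \<in> ?O" using v span_minimal by blast
  then show ?thesis by simp
qed

theorem theorem3p5:
  fixes M :: "('a, 'e::euclidean_space) mfd"
    and \<Sigma> :: "'a distribution"
    and g gc :: "'a metric_tensor"
    and nabla :: "'a field \<Rightarrow> 'a field \<Rightarrow> 'a field"
    and k :: nat
    and y :: 'a
  assumes "sub_riemannian_manifold M k \<Sigma> gc"
    and "riemannian_metric M g"
    and "\<forall>p\<in>carrier M. \<forall>u\<in>\<Sigma> p. \<forall>v\<in>\<Sigma> p. gc p u v = g p u v"
    and "levi_civita M g nabla"
    and "y \<in> carrier M"
  shows "\<exists>N E. openin (mtop M) N \<and> y \<in> N \<and>
    horizontal_frame M \<Sigma> k N E \<and>
    (\<forall>i\<in>{1..k}. \<forall>p\<in>N. gc p (E i p) (E i p) = 1) \<and>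
    (\<forall>i\<in>{1..k}. \<forall>I \<gamma>. integral_curve M N (E i) I \<gamma> \<longrightarrow>
      nonholonomic_geodesic M \<Sigma> g nabla I \<gamma> \<and> \<gamma> ` I \<subseteq> N)"
proof -
  let ?K = "{1..k}"
  note g = assms(2) and LC = assms(4)
  have M: "smooth_manifold M" and k: "k < DIM('e)" and \<Sigma>: "smooth_distribution M k \<Sigma>"
    using assms(1) by (auto simp: sub_riemannian_manifold_def)
  have conn: "connection M nabla" using LC by (simp add: levi_civita_def)
  note T = subspace_tangent_space
  have "y \<in> (\<Union>c\<in>atlas M. fst c)"
    using M assms(5) by (simp add: smooth_manifold_def)
  then obtain c where c: "c \<in> atlas M" "y \<in> fst c" by blast
  obtain W0 F where W0: "openin (mtop M) W0" "y \<in> W0" and F: "horizontal_frame M \<Sigma> k W0 F"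
    using \<Sigma> assms(5) unfolding smooth_distribution_def by blast
  define W where "W = W0 \<inter> fst c"
  have W: "openin (mtop M) W" "W \<subseteq> fst c" "y \<in> W"
    unfolding W_def using W0 c(2) chart_openin[OF M c(1)] by (auto intro: openin_Int)
  have WM: "W \<subseteq> carrier M" by (rule openin_subset[OF W(1)])
  have FS: "smooth_field M W (F i)" if "i \<in> ?K" for i
    using F that unfolding horizontal_frame_def by (auto simp: W_def intro: smooth_field_subset)
  have Fp: "inj_on (\<lambda>i. F i p) ?K" "independent ((\<lambda>i. F i p) ` ?K)" "span ((\<lambda>i. F i p) ` ?K) = \<Sigma> p"
    if "p \<in> W" for p
    using F that unfolding horizontal_frame_def by (auto simp: W_def)
  obtain X where X: "\<And>i. i \<in> ?K \<Longrightarrow> smooth_field M W (X i)"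
    and on: "\<And>p i j. p \<in> W \<Longrightarrow> i \<in> ?K \<Longrightarrow> j \<in> ?K \<Longrightarrow> g p (X i p) (X j p) = (if i = j then 1 else 0)"
    and spF: "\<And>p. p \<in> W \<Longrightarrow> span ((\<lambda>i. X i p) ` ?K) = span ((\<lambda>i. F i p) ` ?K)"
    using orthonormal_frame[OF M g W(1) FS Fp(1,2)] by blast
  have sp: "span ((\<lambda>i. X i p) ` ?K) = \<Sigma> p" if "p \<in> W" for p
    using spF[OF that] Fp(3)[OF that] by simp
  define good where "good m N u \<longleftrightarrow> openin (mtop M) N \<and> y \<in> N \<and> N \<subseteq> W \<and>
    (\<forall>l\<in>?K. smooth_fun M N (u l)) \<and> (\<forall>p\<in>N. (\<Sum>l\<in>?K. (u l p)\<^sup>2) = 1) \<and>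
    (\<forall>p\<in>N. \<forall>l\<in>?K. \<bar>u l p - (if m = l then 1 else 0)\<bar> < 1 / (real k + 1)) \<and>
    (\<forall>p\<in>N. \<forall>l\<in>?K. (\<Sum>i\<in>?K. u i p *\<^sub>R X i p) (u l) =
      - (\<Sum>j\<in>?K. \<Sum>i\<in>?K. u j p * u i p * g p (nabla (X i) (X j) p) (X l p)))" for m N u
  have "\<exists>N u. good m N u" if m: "m \<in> ?K" for m
  proof (rule geodesic_field[where X = X and m = m and \<epsilon> = "1 / (real k + 1)", OF M g LC c(1) W k])
    show "smooth_field M W (X i)" if "i \<in> ?K" for i by (rule X[OF that])
    show "g p (X i p) (X j p) = (if i = j then 1 else 0)" if "p \<in> W" "i \<in> ?K" "j \<in> ?K" for p i j
      by (rule on[OF that])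
    show "m \<in> ?K" "0 < 1 / (real k + 1)" by (fact m) simp
    fix N u
    assume a: "openin (mtop M) N" "y \<in> N" "N \<subseteq> W"
      "\<And>l. l \<in> ?K \<Longrightarrow> smooth_fun M N (u l)"
      "\<And>p. p \<in> N \<Longrightarrow> (\<Sum>l\<in>?K. (u l p)\<^sup>2) = 1"
      "\<And>p l. p \<in> N \<Longrightarrow> l \<in> ?K \<Longrightarrow> \<bar>u l p - (if m = l then 1 else 0)\<bar> < 1 / (real k + 1)"
      "\<And>p l. p \<in> N \<Longrightarrow> l \<in> ?K \<Longrightarrow> (\<Sum>i\<in>?K. u i p *\<^sub>R X i p) (u l) =
        - (\<Sum>j\<in>?K. \<Sum>i\<in>?K. u j p * u i p * g p (nabla (X i) (X j) p) (X l p))"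
    have "good m N u" unfolding good_def by (intro conjI ballI a)
    then show "\<exists>N u. good m N u" by blast
  qed
  then obtain Nf u where good: "\<And>m. m \<in> ?K \<Longrightarrow> good m (Nf m) (u m)" by metis
  note good' = good[unfolded good_def]
  define N where "N = W \<inter> ((\<Inter>m\<in>?K. Nf m) \<inter> carrier M)"
  have N: "openin (mtop M) N"
    unfolding N_def using good' by (intro openin_Int W(1) openin_INT) simp_all
  have yN: "y \<in> N" using good' W(3) assms(5) by (simp add: N_def)
  have NW: "N \<subseteq> W" and Nm: "m \<in> ?K \<Longrightarrow> N \<subseteq> Nf m" for m by (auto simp: N_def)
  have uS: "smooth_fun M N (u m l)" if "m \<in> ?K" "l \<in> ?K" for m l
    by (rule smooth_fun_subset[OF _ Nm[OF that(1)]]) (use good'[OF that(1)] that(2) in blast)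
  have unit: "(\<Sum>l\<in>?K. (u m l p)\<^sup>2) = 1" if "m \<in> ?K" "p \<in> N" for m p
    using good'[OF that(1)] that(2) Nm[OF that(1)] by blast
  have close: "\<bar>u m l p - (if m = l then 1 else 0)\<bar> < 1 / (real k + 1)" if "m \<in> ?K" "l \<in> ?K" "p \<in> N" for m l p
    using good'[OF that(1)] that(2,3) Nm[OF that(1)] by blast
  have geo: "(\<Sum>i\<in>?K. u m i p *\<^sub>R X i p) (u m l) =
      - (\<Sum>j\<in>?K. \<Sum>i\<in>?K. u m j p * u m i p * g p (nabla (X i) (X j) p) (X l p))"
    if "m \<in> ?K" "l \<in> ?K" "p \<in> N" for m l p
    using good'[OF that(1)] that(2,3) Nm[OF that(1)] by blast
  define E where "E m q = (\<Sum>i\<in>?K. u m i q *\<^sub>R X i q)" for m q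
  have XN: "smooth_field M N (X i)" if "i \<in> ?K" for i by (rule smooth_field_subset[OF X[OF that] NW])
  have ES: "smooth_field M N (E m)" if "m \<in> ?K" for m
    unfolding E_def by (intro smooth_field_sum[OF M] uS XN that)
  have E\<Sigma>: "E m p \<in> \<Sigma> p" if "p \<in> N" for m p
    unfolding E_def sp[OF subsetD[OF NW that], symmetric]
    by (intro span_sum span_scale span_base) auto
  have ip: "inner_product_on (tangent_space M p) (g p)" if "p \<in> N" for p
    using g openin_subset[OF N] that unfolding riemannian_metric_def by blast
  have XT: "X i p \<in> tangent_space M p" if "i \<in> ?K" "p \<in> N" for i p
    by (rule smooth_field_tangent[OF XN[OF that(1)] that(2)])
  have frame: "horizontal_frame M \<Sigma> k N E"
    unfolding horizontal_frame_def
  proof (intro conjI ballI)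
    show "smooth_field M N (E i)" if "i \<in> ?K" for i by (rule ES[OF that])
    show "E i p \<in> \<Sigma> p" if "p \<in> N" for i p by (rule E\<Sigma>[OF that])
    fix p assume p: "p \<in> N"
    have pW: "p \<in> W" using p NW by auto
    note nif = near_identity_frame[where X = "\<lambda>i. X i p" and E = "\<lambda>i. E i p" and U = "\<lambda>i l. u i l p",
        OF ip[OF p] T XT[OF _ p] on[OF pW] close[OF _ _ p] E_def]
    show "inj_on (\<lambda>i. E i p) ?K" by (rule nif(1))
    show "independent ((\<lambda>i. E i p) ` ?K)" by (rule nif(2))
    have "span ((\<lambda>i. E i p) ` ?K) = span ((\<lambda>i. X i p) ` ?K)" by (rule nif(3))
    then show "span ((\<lambda>i. E i p) ` ?K) = \<Sigma> p" using sp[OF pW] by simp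
  qed
  have norm1: "gc p (E m p) (E m p) = 1" if m: "m \<in> ?K" and p: "p \<in> N" for m p
  proof -
    have pW: "p \<in> W" using p NW by auto
    have ET: "E m p \<in> tangent_space M p" by (rule smooth_field_tangent[OF ES[OF m] p])
    have "gc p (E m p) (E m p) = g p (E m p) (E m p)"
      using assms(3) E\<Sigma>[OF p] openin_subset[OF N] p by blast
    also have "\<dots> = (\<Sum>i\<in>?K. u m i p * g p (X i p) (E m p))"
      unfolding E_def[of m p] by (rule ip_sum_left[OF ip[OF p] T XT[OF _ p]]) (use ET in \<open>simp_all add: E_def\<close>)
    also have "\<dots> = (\<Sum>i\<in>?K. u m i p * u m i p)"
    proof (intro sum.cong refl arg_cong2[where f = "(*)"])
      fix i assume i: "i \<in> ?K"
      have "g p (X i p) (E m p) = (\<Sum>l\<in>?K. u m l p * g p (X i p) (X l p))"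
        unfolding E_def by (rule ip_sum_right[OF ip[OF p] T XT[OF _ p] XT[OF i p]])
      also have "\<dots> = (\<Sum>l\<in>?K. if l = i then u m l p else 0)"
        by (rule sum.cong) (use on[OF pW i] in auto)
      finally show "g p (X i p) (E m p) = u m i p" using i by simp
    qed
    also have "\<dots> = 1" using unit[OF that] by (simp add: power2_eq_square)
    finally show ?thesis .
  qed
  have sub: "subspace (\<Sigma> p)" "\<Sigma> p \<subseteq> tangent_space M p" if "p \<in> N" for p
    using \<Sigma> openin_subset[OF N] that unfolding smooth_distribution_def by blast+
  have orth: "g p (nabla (E m) (E m) p) v = 0" if m: "m \<in> ?K" and p: "p \<in> N" and v: "v \<in> \<Sigma> p" for m p v
  proof -
    have pW: "p \<in> W" using p NW by auto
    have "v \<in> span ((\<lambda>i. X i p) ` ?K)" using v sp[OF pW] by simp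
    moreover have "E m = (\<lambda>q. \<Sum>i\<in>?K. u m i q *\<^sub>R X i q)" by (rule ext) (rule E_def)
    moreover have "g p (nabla (\<lambda>q. \<Sum>i\<in>?K. u m i q *\<^sub>R X i q) (\<lambda>q. \<Sum>i\<in>?K. u m i q *\<^sub>R X i q) p) v = 0"
      if "v \<in> span ((\<lambda>i. X i p) ` ?K)"
      by (rule covariant_derivative_orthogonal[where X = X and u = "u m" and v = v, OF M g conn N p])
        (use XN on[OF pW] uS[OF m] geo[OF m _ p] that in \<open>blast+\<close>)
    ultimately show ?thesis by simp
  qed
  have "nonholonomic_geodesic M \<Sigma> g nabla I \<gamma> \<and> \<gamma> ` I \<subseteq> N"
    if "m \<in> ?K" "integral_curve M N (E m) I \<gamma>" for m I \<gamma>
  proof (rule integral_curve_nonholonomic_geodesic[where \<Sigma> = \<Sigma> and E = "E m",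
        OF M conn g N ES[OF that(1)] that(2)])
    fix p assume p: "p \<in> N"
    show "subspace (\<Sigma> p)" "\<Sigma> p \<subseteq> tangent_space M p" by (fact sub[OF p])+
    show "E m p \<in> \<Sigma> p" by (rule E\<Sigma>[OF p])
    show "g p (nabla (E m) (E m) p) v = 0" if "v \<in> \<Sigma> p" for v by (rule orth[OF \<open>m \<in> ?K\<close> p that])
  qed
  then show ?thesis
    using N yN frame norm1 by (intro exI[of _ N] exI[of _ E] conjI ballI allI impI) simp_all
qed

end
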